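(* Let $\lambda\ge 0$, $\varepsilon>0$, $\sigma=\sigma(\lambda,\varepsilon)$, and for $t\ge0$, $x\in\mathbb{R}$ define $w_\sigma(t,x)$ by $$1-w_\sigma(t,x)=\widehat P_{\lambda,t}\big(x_i(t)\le x\ \text{ for all } i=1,\dots,n(t)\big).$$ Then $w_\sigma$ is the unique solution of $$\partial_t w=\frac12\,\partial_{xx}w+w(1-w)\,\frac{\sigma}{(1-\sigma)e^{t}+\sigma},\qquad t>0,\ x\in\mathbb{R},$$ with initial condition $w(0,x)=\mathbf 1_{x<0}$.
   Context: Binary branching Brownian motion (BBM) on $\mathbb{R}$: start with a single particle at $0$ at time $0$. Each particle moves as a standard Brownian motion and lives for an independent standard (rate $1$) exponential time, at the end of which it is replaced by exactly two particles that continue from its position independently according to the same rules. $\mathbb{P}$, $\mathbb{E}$ denote the law and expectation of BBM, $n(t)$ is the number of particles at time $t$, and $x_1(t),\dots,x_{n(t)}(t)$ are their positions. Set $\sigma(\lambda,\varepsilon)=\operatorname{sech}(\varepsilon\sqrt{2\lambda})$, $v_\sigma(t)=\mathbb{E}[\sigma^{n(t)-1}]$ and $\widehat P_{\lambda,t}(A)=\mathbb{E}[\mathbf 1_A\,\sigma(\lambda,\varepsilon)^{n(t)-1}]/v_{\sigma(\lambda,\varepsilon)}(t)$. A solution is understood as a bounded function that is $C^1$ in $t$ and $C^2$ in $x$ on $(0,\infty)\times\mathbb{R}$, satisfies the equation there, and attains the initial datum: $\lim_{t\downarrow0}w(t,x)=w(0,x)$ at every continuity point $x\neq0$ of the datum;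 uniqueness is on $(0,\infty)\times\mathbb{R}$. *)

theory Defs
  imports "HOL-Probability.Probability"
begin

text \<open>
  Path properties (continuity and starting point here, positivity of the lifetimes below) are
  required at every sample point rather than almost surely, so that the events considered are
  measurable without completing the probability space.
\<close>

definition standard_BM :: "'a measure \<Rightarrow> (real \<Rightarrow> 'a \<Rightarrow> real) \<Rightarrow> bool" where
  "standard_BM M B \<longleftrightarrow>
     (\<forall>t\<ge>0. B t \<in> borel_measurable M) \<and>
     (\<forall>\<omega>\<in>space M. B 0 \<omega> = 0 \<and> continuous_on {0..} (\<lambda>t. B t \<omega>)) \<and>
     (\<forall>s t. 0 \<le> s \<and> s < t \<longrightarrow>
        distributed M lborel (\<lambda>\<omega>. B t \<omega> - B s \<omega>) (normal_density 0 (sqrt (t - s)))) \<and>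
     (\<forall>(T :: nat \<Rightarrow> real) n. 0 \<le> T 0 \<and> incseq T \<longrightarrow>
        prob_space.indep_vars M (\<lambda>_. borel) (\<lambda>i \<omega>. B (T (Suc i)) \<omega> - B (T i) \<omega>) {..<n})"

text \<open>
  Binary branching Brownian motion in Ulam--Harris labelling: \<open>[]\<close> is the initial particle, the
  two children of \<open>u\<close> are \<open>u @ [False]\<close> and \<open>u @ [True]\<close>, and the proper ancestors of \<open>u\<close> are the
  \<open>take k u\<close> with \<open>k < length u\<close>. Particle \<open>u\<close> lives for time \<open>\<tau> u\<close> and its displacement from its
  birthplace at age \<open>s\<close> is \<open>B u s\<close>; the process \<open>B u\<close> is independent of \<open>\<tau> u\<close> and
  only its values up to age \<open>\<tau> u\<close> are used.
\<close>

locale binary_BBM = prob_space M for M :: "'a measure" +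
  fixes \<tau> :: "bool list \<Rightarrow> 'a \<Rightarrow> real"
    and B :: "bool list \<Rightarrow> real \<Rightarrow> 'a \<Rightarrow> real"
  assumes lifetime_pos: "\<And>u \<omega>. \<omega> \<in> space M \<Longrightarrow> 0 < \<tau> u \<omega>"
    and lifetime_exponential: "\<And>u. distributed M lborel (\<tau> u) (exponential_density 1)"
    and motion_BM: "\<And>u. standard_BM M (B u)"
    and independent:
      "indep_sets
         (\<lambda>i. case i of
            Inl u \<Rightarrow> sigma_sets (space M) {\<tau> u -` A \<inter> space M | A. A \<in> sets borel}
          | Inr u \<Rightarrow> sigma_sets (space M) {B u t -` A \<inter> space M | t A. 0 \<le> t \<and> A \<in> sets borel})
         UNIV"

definition birth_time :: "(bool list \<Rightarrow> 'a \<Rightarrow> real) \<Rightarrow> bool list \<Rightarrow> 'a \<Rightarrow> real" where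
  "birth_time \<tau> u \<omega> = (\<Sum>k<length u. \<tau> (take k u) \<omega>)"

definition birth_place ::
  "(bool list \<Rightarrow> 'a \<Rightarrow> real) \<Rightarrow> (bool list \<Rightarrow> real \<Rightarrow> 'a \<Rightarrow> real) \<Rightarrow> bool list \<Rightarrow> 'a \<Rightarrow> real" where
  "birth_place \<tau> B u \<omega> = (\<Sum>k<length u. B (take k u) (\<tau> (take k u) \<omega>) \<omega>)"

definition alive :: "(bool list \<Rightarrow> 'a \<Rightarrow> real) \<Rightarrow> real \<Rightarrow> 'a \<Rightarrow> bool list set" where
  "alive \<tau> t \<omega> = {u. birth_time \<tau> u \<omega> \<le> t \<and> t < birth_time \<tau> u \<omega> + \<tau> u \<omega>}"

definition position ::
  "(bool list \<Rightarrow> 'a \<Rightarrow> real) \<Rightarrow> (bool list \<Rightarrow> real \<Rightarrow> 'a \<Rightarrow> real) \<Rightarrow> bool list \<Rightarrow> real \<Rightarrow> 'a \<Rightarrow> real" where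
  "position \<tau> B u t \<omega> = birth_place \<tau> B u \<omega> + B u (t - birth_time \<tau> u \<omega>) \<omega>"

text \<open>The set of living particles is almost surely finite; off that event the value is irrelevant.\<close>

definition num_particles :: "(bool list \<Rightarrow> 'a \<Rightarrow> real) \<Rightarrow> real \<Rightarrow> 'a \<Rightarrow> nat" where
  "num_particles \<tau> t \<omega> = card (alive \<tau> t \<omega>)"

definition sigma_param :: "real \<Rightarrow> real \<Rightarrow> real" where
  "sigma_param lam eps = 1 / cosh (eps * sqrt (2 * lam))"

definition v_gen :: "'a measure \<Rightarrow> (bool list \<Rightarrow> 'a \<Rightarrow> real) \<Rightarrow> real \<Rightarrow> real \<Rightarrow> real" where
  "v_gen M \<tau> \<sigma> t = (\<integral>\<omega>. \<sigma> ^ (num_particles \<tau> t \<omega> - 1) \<partial>M)"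

definition P_hat ::
  "'a measure \<Rightarrow> (bool list \<Rightarrow> 'a \<Rightarrow> real) \<Rightarrow> real \<Rightarrow> real \<Rightarrow> real \<Rightarrow> 'a set \<Rightarrow> real" where
  "P_hat M \<tau> lam eps t A =
     (\<integral>\<omega>. indicator A \<omega> * sigma_param lam eps ^ (num_particles \<tau> t \<omega> - 1) \<partial>M)
       / v_gen M \<tau> (sigma_param lam eps) t"

definition w_sigma ::
  "'a measure \<Rightarrow> (bool list \<Rightarrow> 'a \<Rightarrow> real) \<Rightarrow> (bool list \<Rightarrow> real \<Rightarrow> 'a \<Rightarrow> real) \<Rightarrow>
     real \<Rightarrow> real \<Rightarrow> real \<Rightarrow> real \<Rightarrow> real" where
  "w_sigma M \<tau> B lam eps t x =
     1 - P_hat M \<tau> lam eps t {\<omega> \<in> space M. \<forall>u\<in>alive \<tau> t \<omega>. position \<tau> B u t \<omega> \<le> x}"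

text \<open>
  Bounded classical solutions of \<open>\<partial>\<^sub>t w = 1/2 \<partial>\<^sub>x\<^sub>x w + w (1 - w) k(t)\<close> with datum \<open>f\<close>.
  Here \<open>wt\<close>, \<open>wx\<close>, \<open>wxx\<close> are the partial derivatives of \<open>w\<close>, and \<open>C\<^sup>1\<close> in time and \<open>C\<^sup>2\<close> in space
  means, as usual for parabolic equations, that they are jointly continuous.
\<close>

definition FKPP_solution ::
  "(real \<Rightarrow> real) \<Rightarrow> (real \<Rightarrow> real) \<Rightarrow> (real \<Rightarrow> real \<Rightarrow> real) \<Rightarrow> bool" where
  "FKPP_solution k f w \<longleftrightarrow>
     bounded ((\<lambda>(t, x). w t x) ` ({0<..} \<times> UNIV)) \<and>
     (\<exists>wt wx wxx.
        (\<forall>t>0. \<forall>x.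
           ((\<lambda>s. w s x) has_real_derivative wt t x) (at t) \<and>
           ((\<lambda>y. w t y) has_real_derivative wx t x) (at x) \<and>
           ((\<lambda>y. wx t y) has_real_derivative wxx t x) (at x) \<and>
           wt t x = 1 / 2 * wxx t x + w t x * (1 - w t x) * k t) \<and>
        (\<forall>g\<in>{w, wt, wx, wxx}. continuous_on ({0<..} \<times> UNIV) (\<lambda>(t, x). g t x))) \<and>
     (\<forall>x. w 0 x = f x) \<and>
     (\<forall>x. isCont f x \<longrightarrow> ((\<lambda>t. w t x) \<longlongrightarrow> f x) (at_right 0))"

end

theory Submission
  imports Defs
begin

text \<open>Give each particle the weight \<open>\<sigma>\<close> if it is at or below \<open>x\<close> and the weight
\<open>0\<close> otherwise, and let \<open>H(t, x)\<close> be the expected product of the weights of the particles alive at time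
\<open>t\<close>; let \<open>V(t)\<close> be the same expectation with the constant weight \<open>\<sigma>\<close>. Up to the same factor \<open>\<sigma>\<close> these
are the numerator and the denominator of the tilted probability, so \<open>1 - w = H / V\<close>. Conditioning on
the first branching, as McKean did, shows that both solve the integral equation
\<open>H(t) = exp (- t) P\<^sub>t g + \<integral>\<^sub>0\<^sup>t exp (- s) P\<^sub>s (H(t - s)\<^sup>2) ds\<close>, where \<open>P\<close> is the heat semigroup and \<open>g\<close> the weight function,
which is the mild form of \<open>\<partial>\<^sub>t H = 1/2 \<partial>\<^sub>x\<^sub>x H + H\<^sup>2 - H\<close>. For the constant weight this is the ordinary
equation \<open>V' = V\<^sup>2 - V\<close> with \<open>V(0) = \<sigma>\<close>, whose solution is exactly the coefficient
\<open>\<sigma> / ((1 - \<sigma>) exp t + \<sigma>)\<close>. The quotient rule then turns the equations of \<open>H\<close> and \<open>V\<close> into the equation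
of \<open>w\<close>.

Three things need work. First, the probabilistic identity (\<open>product_mean_mild\<close>). The product over the
living particles is replaced by a recursively defined product that is cut off at generation \<open>n\<close>
(\<open>tree_product\<close>). Its expectation is computed by induction on \<open>n\<close>, simultaneously for all subtrees, so
that the equality in law of the subtrees with the whole tree comes out as a by-product.
The cut-off is harmless because generation \<open>n\<close> is reached before time \<open>t\<close> with probability at most
\<open>exp (3 t) / 2\<^sup>n\<close> (\<open>generation_bound\<close>), which comes out of the same recursion.

Second, regularity: a bounded measurable mild solution is classical (\<open>mild_solution\<close>). One space
derivative falls on the heat kernel and costs the integrable singularity \<open>1 / \<surd>s\<close>. For the second
derivative the equation is restarted at a positive time, after which the nonlinearity has a
bounded space derivative, and again only one derivative falls on the kernel. The time derivative comes from
restarting the equation just before the time in question and expanding the heat semigroup to first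
order.

Third, uniqueness (\<open>FKPP_solution_unique\<close>): the difference \<open>d\<close> of two solutions solves a linear
equation with bounded potential, so by the maximum principle \<open>d(t) \<le> exp (C (t - s)) P\<^sub>t\<^sub>-\<^sub>s \<bar>d(s)\<bar>\<close>
for every \<open>s\<close> between \<open>0\<close> and \<open>t\<close>. As \<open>s\<close> decreases to \<open>0\<close>, \<open>d(s)\<close> tends to \<open>0\<close> boundedly off the origin, and the heat kernel
does not charge a single point.\<close>

section \<open>Limits and derivatives under the integral sign\<close>

lemma tendsto_integral_dominated_at:
  fixes f :: "'b::metric_space \<Rightarrow> 'a \<Rightarrow> real"
  assumes f: "\<forall>\<^sub>F p in at p0 within A. f p \<in> borel_measurable M"
    and l: "l \<in> borel_measurable M"
    and lim: "AE \<omega> in M. ((\<lambda>p. f p \<omega>) \<longlongrightarrow> l \<omega>) (at p0 within A)"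
    and bound: "\<forall>\<^sub>F p in at p0 within A. AE \<omega> in M. \<bar>f p \<omega>\<bar> \<le> g \<omega>"
    and g: "integrable M g"
  shows "((\<lambda>p. \<integral>\<omega>. f p \<omega> \<partial>M) \<longlongrightarrow> (\<integral>\<omega>. l \<omega> \<partial>M)) (at p0 within A)"
  unfolding tendsto_at_iff_sequentially
proof (intro allI impI)
  fix X assume X: "\<forall>i. X i \<in> A - {p0}" "X \<longlonglongrightarrow> p0"
  have fl: "filterlim X (at p0 within A) sequentially"
    using X by (auto simp: filterlim_at)
  have "\<forall>\<^sub>F n in sequentially. f (X n) \<in> borel_measurable M \<and> (AE \<omega> in M. \<bar>f (X n) \<omega>\<bar> \<le> g \<omega>)"
    by (rule eventually_compose_filterlim[OF eventually_conj[OF f bound] fl])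
  then obtain N where N: "\<And>n. n \<ge> N \<Longrightarrow> f (X n) \<in> borel_measurable M"
    "\<And>n. n \<ge> N \<Longrightarrow> AE \<omega> in M. \<bar>f (X n) \<omega>\<bar> \<le> g \<omega>"
    by (auto simp: eventually_sequentially)
  have "(\<lambda>n. \<integral>\<omega>. f (X (n + N)) \<omega> \<partial>M) \<longlonglongrightarrow> (\<integral>\<omega>. l \<omega> \<partial>M)"
  proof (rule integral_dominated_convergence[OF l _ g])
    show "AE \<omega> in M. (\<lambda>n. f (X (n + N)) \<omega>) \<longlonglongrightarrow> l \<omega>"
      using lim
    proof eventually_elim
      case (elim \<omega>)
      have "(\<lambda>n. f (X n) \<omega>) \<longlonglongrightarrow> l \<omega>"
        by (rule filterlim_compose[OF elim fl])
      then show ?case by (rule LIMSEQ_ignore_initial_segment)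
    qed
  qed (use N in auto)
  then show "((\<lambda>p. \<integral>\<omega>. f p \<omega> \<partial>M) \<circ> X) \<longlonglongrightarrow> (\<integral>\<omega>. l \<omega> \<partial>M)"
    unfolding o_def by (rule LIMSEQ_offset)
qed

text \<open>By the mean value theorem the difference quotients are dominated by the same function as the
derivatives, so that dominated convergence applies to them.\<close>

lemma has_real_derivative_integral_dominated:
  fixes u u' :: "real \<Rightarrow> 'a \<Rightarrow> real"
  assumes r: "0 < r"
    and u: "\<And>y. \<bar>y - x\<bar> < r \<Longrightarrow> integrable M (u y)"
    and u': "u' x \<in> borel_measurable M"
    and deriv: "\<And>y \<omega>. \<bar>y - x\<bar> < r \<Longrightarrow> \<omega> \<in> space M \<Longrightarrow> ((\<lambda>y. u y \<omega>) has_real_derivative u' y \<omega>) (at y)"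
    and bound: "\<And>y \<omega>. \<bar>y - x\<bar> < r \<Longrightarrow> \<omega> \<in> space M \<Longrightarrow> \<bar>u' y \<omega>\<bar> \<le> g \<omega>"
    and g: "integrable M g"
  shows "((\<lambda>y. \<integral>\<omega>. u y \<omega> \<partial>M) has_real_derivative (\<integral>\<omega>. u' x \<omega> \<partial>M)) (at x)"
proof -
  have near: "\<forall>\<^sub>F h in at 0. \<bar>h\<bar> < r"
    using r by (auto simp: eventually_at intro!: exI[of _ r])
  have ux: "integrable M (u x)" using u[of x] r by auto
  have "((\<lambda>h. \<integral>\<omega>. (u (x + h) \<omega> - u x \<omega>) / h \<partial>M) \<longlongrightarrow> (\<integral>\<omega>. u' x \<omega> \<partial>M)) (at 0)"
  proof (rule tendsto_integral_dominated_at[OF _ u' _ _ g])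
    show "\<forall>\<^sub>F h in at 0. (\<lambda>\<omega>. (u (x + h) \<omega> - u x \<omega>) / h) \<in> borel_measurable M"
      using near
    proof eventually_elim
      case (elim h)
      have [measurable]: "u (x + h) \<in> borel_measurable M" "u x \<in> borel_measurable M"
        using u[of "x + h"] ux elim by auto
      show ?case by measurable
    qed
    show "AE \<omega> in M. ((\<lambda>h. (u (x + h) \<omega> - u x \<omega>) / h) \<longlongrightarrow> u' x \<omega>) (at 0)"
    proof (rule AE_I2)
      fix \<omega> assume "\<omega> \<in> space M"
      then show "((\<lambda>h. (u (x + h) \<omega> - u x \<omega>) / h) \<longlongrightarrow> u' x \<omega>) (at 0)"
        using deriv[of x \<omega>] r by (simp add: DERIV_def)
    qed
    show "\<forall>\<^sub>F h in at 0. AE \<omega> in M. \<bar>(u (x + h) \<omega> - u x \<omega>) / h\<bar> \<le> g \<omega>"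
      using near
    proof eventually_elim
      case (elim h)
      show ?case
      proof (rule AE_I2)
        fix \<omega> assume \<omega>: "\<omega> \<in> space M"
        have "norm (u (x + h) \<omega> - u x \<omega>) \<le> g \<omega> * norm (x + h - x)"
        proof (rule field_differentiable_bound[of "ball x r" "\<lambda>y. u y \<omega>" "\<lambda>y. u' y \<omega>"])
          fix z assume "z \<in> ball x r"
          then have z: "\<bar>z - x\<bar> < r" by (auto simp: dist_real_def)
          show "((\<lambda>y. u y \<omega>) has_field_derivative u' z \<omega>) (at z within ball x r)"
            using deriv[OF z \<omega>] by (rule has_field_derivative_at_within)
          show "norm (u' z \<omega>) \<le> g \<omega>" using bound[OF z \<omega>] by simp
        qed (use elim r in \<open>auto simp: dist_real_def\<close>)
        moreover have "0 \<le> g \<omega>" using bound[of x \<omega>] \<omega> r by auto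
        ultimately show "\<bar>(u (x + h) \<omega> - u x \<omega>) / h\<bar> \<le> g \<omega>"
          by (cases "h = 0") (auto simp: abs_divide divide_le_eq)
      qed
    qed
  qed
  then have "((\<lambda>h. ((\<integral>\<omega>. u (x + h) \<omega> \<partial>M) - (\<integral>\<omega>. u x \<omega> \<partial>M)) / h) \<longlongrightarrow> (\<integral>\<omega>. u' x \<omega> \<partial>M)) (at 0)"
  proof (rule Lim_transform_eventually)
    show "\<forall>\<^sub>F h in at 0. (\<integral>\<omega>. (u (x + h) \<omega> - u x \<omega>) / h \<partial>M) =
        ((\<integral>\<omega>. u (x + h) \<omega> \<partial>M) - (\<integral>\<omega>. u x \<omega> \<partial>M)) / h"
      using near by eventually_elim (use u ux in \<open>auto simp: Bochner_Integration.integral_diff\<close>)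
  qed
  then show ?thesis by (simp add: DERIV_def)
qed

section \<open>Gaussian averages\<close>

abbreviation \<gamma> :: "real measure" where "\<gamma> \<equiv> std_normal_distribution"

interpretation \<gamma>: prob_space \<gamma>
  by (rule prob_space_normal_density) simp

text \<open>The expectation of \<open>Z\<^sup>j f (x + \<surd>s Z)\<close> for a standard normal \<open>Z\<close>. For \<open>j = 0\<close> this is the heat semigroup;
every space derivative that falls on the heat kernel brings down a factor \<open>Z / \<surd>s\<close>, which is why the
higher moments occur.\<close>

definition heat_mom :: "nat \<Rightarrow> real \<Rightarrow> (real \<Rightarrow> real) \<Rightarrow> real \<Rightarrow> real" where
  "heat_mom j s f x = (\<integral>z. z ^ j * f (x + sqrt s * z) \<partial>\<gamma>)"

definition abs_moment :: "nat \<Rightarrow> real" where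
  "abs_moment j = (\<integral>z. \<bar>z\<bar> ^ j \<partial>\<gamma>)"

lemma integrable_moment: "integrable \<gamma> (\<lambda>z. \<bar>z\<bar> ^ j)"
  using integrable_abs[OF integrable_std_normal_distribution_moment[of j]] by (simp add: power_abs)

lemma abs_moment_nonneg: "0 \<le> abs_moment j"
  unfolding abs_moment_def by simp

lemma abs_moment_0[simp]: "abs_moment 0 = 1"
  unfolding abs_moment_def using \<gamma>.prob_space by simp

lemma integrable_moment_times:
  assumes [measurable]: "f \<in> borel_measurable borel" and K: "\<And>y. \<bar>f y\<bar> \<le> K"
  shows "integrable \<gamma> (\<lambda>z. z ^ j * f z)"
proof (rule Bochner_Integration.integrable_bound)
  show "integrable \<gamma> (\<lambda>z. K * \<bar>z\<bar> ^ j)" using integrable_moment by simp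
  have "0 \<le> K" using K[of 0] by linarith
  then show "AE z in \<gamma>. norm (z ^ j * f z) \<le> norm (K * \<bar>z\<bar> ^ j)"
    using K by (intro AE_I2) (auto simp: abs_mult power_abs mult.commute intro: mult_right_mono)
qed simp

lemma heat_mom_integrable:
  assumes [measurable]: "f \<in> borel_measurable borel" and K: "\<And>y. \<bar>f y\<bar> \<le> K"
  shows "integrable \<gamma> (\<lambda>z. z ^ j * f (x + sqrt s * z))"
  by (rule integrable_moment_times[where K = K]) (use K in auto)

lemma heat_mom_bound:
  assumes [measurable]: "f \<in> borel_measurable borel" and K: "\<And>y. \<bar>f y\<bar> \<le> K"
  shows "\<bar>heat_mom j s f x\<bar> \<le> K * abs_moment j"
proof -
  have "\<bar>heat_mom j s f x\<bar> \<le> (\<integral>z. norm (z ^ j * f (x + sqrt s * z)) \<partial>\<gamma>)"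
    unfolding heat_mom_def using integral_norm_bound by force
  also have "\<dots> \<le> (\<integral>z. K * \<bar>z\<bar> ^ j \<partial>\<gamma>)"
  proof (rule integral_mono)
    show "integrable \<gamma> (\<lambda>z. norm (z ^ j * f (x + sqrt s * z)))"
      using heat_mom_integrable[OF assms] by auto
    show "norm (z ^ j * f (x + sqrt s * z)) \<le> K * \<bar>z\<bar> ^ j" for z
    proof -
      have "norm (z ^ j * f (x + sqrt s * z)) = \<bar>f (x + sqrt s * z)\<bar> * \<bar>z\<bar> ^ j"
        by (simp add: abs_mult power_abs)
      also have "\<dots> \<le> K * \<bar>z\<bar> ^ j" by (intro mult_right_mono K) simp
      finally show ?thesis .
    qed
  qed (use integrable_moment in simp)
  also have "\<dots> = K * abs_moment j" by (simp add: abs_moment_def)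
  finally show ?thesis .
qed

lemma heat_mom_borel[measurable]:
  assumes [measurable]: "f \<in> borel_measurable (N \<Otimes>\<^sub>M borel)" "s \<in> borel_measurable N" "x \<in> borel_measurable N"
  shows "(\<lambda>\<omega>. heat_mom j (s \<omega>) (\<lambda>y. f (\<omega>, y)) (x \<omega>)) \<in> borel_measurable N"
  unfolding heat_mom_def by measurable

text \<open>The density that represents \<open>heat_mom j s f x\<close> as an integral of \<open>f (y)\<close> at \<open>u = y - x\<close>. This form is
used when \<open>f\<close> is merely measurable and the dependence on \<open>s\<close> and \<open>x\<close> has to sit in a smooth kernel.\<close>

definition heat_ker :: "nat \<Rightarrow> real \<Rightarrow> real \<Rightarrow> real" where
  "heat_ker j s u = (u / sqrt s) ^ j * std_normal_density (u / sqrt s) / sqrt s"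

lemma heat_ker_borel[measurable]: "heat_ker j s \<in> borel_measurable borel"
  unfolding heat_ker_def by measurable

lemma heat_mom_eq_heat_ker:
  assumes s: "0 < s" and [measurable]: "f \<in> borel_measurable borel"
  shows "heat_mom j s f x = (\<integral>y. f y * heat_ker j s (y - x) \<partial>lborel)"
proof -
  have "(\<integral>y. f y * heat_ker j s (y - x) \<partial>lborel) =
     sqrt s * (\<integral>z. f (x + sqrt s * z) * heat_ker j s (sqrt s * z) \<partial>lborel)"
    using lborel_integral_real_affine[of "sqrt s" "\<lambda>y. f y * heat_ker j s (y - x)" x] s by simp
  also have "\<dots> = (\<integral>z. std_normal_density z * (z ^ j * f (x + sqrt s * z)) \<partial>lborel)"
    using s by (subst integral_mult_right_zero[symmetric])
      (auto intro!: Bochner_Integration.integral_cong simp: heat_ker_def)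
  also have "\<dots> = heat_mom j s f x"
    unfolding heat_mom_def by (subst integral_density) (auto simp: normal_density_nonneg)
  finally show ?thesis by simp
qed

lemma heat_ker_integrable:
  assumes s: "0 < s" and [measurable]: "f \<in> borel_measurable borel" and K: "\<And>y. \<bar>f y\<bar> \<le> K"
  shows "integrable lborel (\<lambda>y. f y * heat_ker j s (y - x))"
proof -
  have "integrable \<gamma> (\<lambda>z. z ^ j * f (x + sqrt s * z))" by (rule heat_mom_integrable[OF assms(2,3)])
  then have "integrable lborel (\<lambda>z. std_normal_density z * (z ^ j * f (x + sqrt s * z)))"
    by (subst (asm) integrable_density) (auto simp: normal_density_nonneg)
  then have "integrable lborel (\<lambda>z. (1 / sqrt s) * (std_normal_density z * (z ^ j * f (x + sqrt s * z))))"
    by simp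
  also have "(\<lambda>z. (1 / sqrt s) * (std_normal_density z * (z ^ j * f (x + sqrt s * z)))) =
     (\<lambda>z. f (x + sqrt s * z) * heat_ker j s (x + sqrt s * z - x))"
    using s by (auto simp: heat_ker_def)
  finally show ?thesis
    using lborel_integrable_real_affine_iff[of "sqrt s" "\<lambda>y. f y * heat_ker j s (y - x)" x] s by simp
qed

lemma power_le_fact_exp: "0 \<le> u \<Longrightarrow> u ^ j \<le> fact j * exp (u::real)"
proof -
  assume u: "0 \<le> u"
  have "(\<Sum>n\<in>{j}. u ^ n /\<^sub>R fact n) \<le> (\<Sum>n. u ^ n /\<^sub>R fact n)"
    by (rule sum_le_suminf) (use u exp_converges[of u] in \<open>auto simp: sums_iff\<close>)
  then have "u ^ j / fact j \<le> exp u" by (simp add: exp_def divide_inverse mult.commute)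
  then show ?thesis by (simp add: divide_le_eq mult.commute)
qed

text \<open>An exponential bound suffices as a dominating function, and it behaves well under the translations
and dilations below. It holds since a power is at most a multiple of \<open>exp \<bar>u\<bar>\<close>, and
\<open>2 \<bar>u\<bar> - u\<^sup>2 / 2 \<le> 2\<close>.\<close>

lemma moment_density_bound:
  "\<bar>u ^ j * std_normal_density u\<bar> \<le> fact j * exp 2 * exp (- \<bar>u\<bar>)"
proof -
  have "std_normal_density u \<le> exp (- u\<^sup>2 / 2)"
  proof -
    have "1 \<le> sqrt (2 * pi)" using pi_ge_two by (simp add: real_le_rsqrt)
    then show ?thesis by (simp add: std_normal_density_def divide_le_eq)
  qed
  then have "\<bar>u ^ j * std_normal_density u\<bar> \<le> (fact j * exp \<bar>u\<bar>) * exp (- u\<^sup>2 / 2)"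
    using power_le_fact_exp[of "\<bar>u\<bar>" j]
    by (auto simp: abs_mult power_abs normal_density_nonneg intro!: mult_mono)
  also have "\<dots> = fact j * exp (\<bar>u\<bar> - u\<^sup>2 / 2)" by (simp add: exp_add[symmetric])
  also have "\<dots> \<le> fact j * exp (2 - \<bar>u\<bar>)"
  proof -
    have "0 \<le> (\<bar>u\<bar> - 2)\<^sup>2" by simp
    then have "\<bar>u\<bar> - u\<^sup>2 / 2 \<le> 2 - \<bar>u\<bar>" by (simp add: power2_eq_square algebra_simps abs_mult_self_eq)
    then show ?thesis by simp
  qed
  also have "\<dots> = fact j * exp 2 * exp (- \<bar>u\<bar>)" by (simp add: exp_add[symmetric])
  finally show ?thesis .
qed

text \<open>One integrable function of \<open>y\<close> dominates all kernels with \<open>s\<close> in a compact interval and \<open>x\<close> in a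
ball.\<close>

lemma heat_ker_bound:
  assumes "0 < a" "a \<le> s" "s \<le> b" "\<bar>x - x0\<bar> \<le> 1"
  shows "\<bar>heat_ker j s (y - x)\<bar> \<le> fact j * exp 2 * exp (1 / sqrt b) / sqrt a * exp (- \<bar>y - x0\<bar> / sqrt b)"
proof -
  have pos: "0 < s" "0 < b" using assms by auto
  have "\<bar>y - x0\<bar> / sqrt b - 1 / sqrt b \<le> \<bar>y - x\<bar> / sqrt b"
    using assms pos by (simp add: diff_divide_distrib[symmetric] divide_right_mono)
  also have "\<dots> \<le> \<bar>y - x\<bar> / sqrt s" using assms pos by (intro divide_left_mono) auto
  finally have e: "exp (- \<bar>(y - x) / sqrt s\<bar>) \<le> exp (1 / sqrt b) * exp (- \<bar>y - x0\<bar> / sqrt b)"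
    using pos by (simp add: exp_add[symmetric] abs_divide)
  have "\<bar>heat_ker j s (y - x)\<bar> \<le> fact j * exp 2 * exp (- \<bar>(y - x) / sqrt s\<bar>) / sqrt s"
    using moment_density_bound[of "(y - x) / sqrt s" j] pos
    by (simp add: heat_ker_def abs_divide divide_right_mono)
  also have "\<dots> \<le> fact j * exp 2 * (exp (1 / sqrt b) * exp (- \<bar>y - x0\<bar> / sqrt b)) / sqrt a"
    by (rule frac_le) (use e assms in auto)
  finally show ?thesis by (simp add: mult.assoc)
qed

lemma integrable_exp_neg_abs:
  assumes "0 < c"
  shows "integrable lborel (\<lambda>y. exp (- \<bar>y - x0\<bar> / c :: real))"
proof -
  have "prob_space (density lborel (exponential_density 1))"
    by (rule prob_space_exponential_density) simp
  then interpret E: prob_space "density lborel (exponential_density 1)" .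
  have "integrable (density lborel (exponential_density 1)) (\<lambda>_. 1::real)" by simp
  then have i: "integrable lborel (exponential_density 1)"
    by (subst (asm) integrable_density) (auto simp: exponential_density_nonneg)
  have "integrable lborel (\<lambda>y. exponential_density 1 (0 + (-1) * y))"
    by (rule lborel_integrable_real_affine[OF i]) simp
  with i have "integrable lborel (\<lambda>y. exponential_density 1 y + exponential_density 1 (- y))" by simp
  then have "integrable lborel (\<lambda>y. exp (- \<bar>y\<bar> :: real))"
    by (rule Bochner_Integration.integrable_bound) (auto simp: exponential_density_def)
  then have "integrable lborel (\<lambda>y. exp (- \<bar>- x0 / c + (1 / c) * y\<bar> :: real))"
    by (rule lborel_integrable_real_affine) (use assms in auto)
  also have "(\<lambda>y. exp (- \<bar>- x0 / c + (1 / c) * y\<bar> :: real)) = (\<lambda>y. exp (- \<bar>y - x0\<bar> / c))"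
  proof
    fix y have "- x0 / c + (1 / c) * y = (y - x0) / c" by (simp add: diff_divide_distrib)
    then show "exp (- \<bar>- x0 / c + (1 / c) * y\<bar> :: real) = exp (- \<bar>y - x0\<bar> / c)"
      using assms by (simp add: abs_divide)
  qed
  finally show ?thesis .
qed

lemma std_normal_density_deriv:
  "(std_normal_density has_real_derivative - (u * std_normal_density u)) (at u)"
proof -
  have "((\<lambda>u. exp (- u\<^sup>2 / 2)) has_real_derivative - (u * exp (- u\<^sup>2 / 2))) (at u)"
    by (auto intro!: derivative_eq_intros)
  from DERIV_cmult[OF this, of "1 / sqrt (2 * pi)"] show ?thesis
    unfolding std_normal_density_def by simp
qed

lemma heat_ker_deriv_space:
  assumes "0 < s"
  shows "((\<lambda>x. heat_ker j s (y - x)) has_real_derivative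
     (heat_ker (Suc j) s (y - x) - real j * heat_ker (j - 1) s (y - x)) / sqrt s) (at x)"
proof -
  define v where "v = (y - x) / sqrt s"
  have v: "((\<lambda>x. (y - x) / sqrt s) has_real_derivative - (1 / sqrt s)) (at x)"
  proof -
    have "((\<lambda>x. y - x) has_real_derivative -1) (at x)" by (auto intro!: derivative_eq_intros)
    from DERIV_cdivide[OF this, of "sqrt s"] show ?thesis by simp
  qed
  have "((\<lambda>x. heat_ker j s (y - x)) has_real_derivative
     (real j * (- (1 / sqrt s) * v ^ (j - Suc 0)) * std_normal_density v
      + (- (v * std_normal_density v)) * - (1 / sqrt s) * v ^ j) / sqrt s) (at x)"
    unfolding heat_ker_def v_def
    by (intro DERIV_cdivide DERIV_mult DERIV_power v DERIV_chain2[OF std_normal_density_deriv v])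
  also have "(real j * (- (1 / sqrt s) * v ^ (j - Suc 0)) * std_normal_density v
      + (- (v * std_normal_density v)) * - (1 / sqrt s) * v ^ j) / sqrt s =
     (heat_ker (Suc j) s (y - x) - real j * heat_ker (j - 1) s (y - x)) / sqrt s"
    unfolding heat_ker_def v_def[symmetric] by (simp add: diff_divide_distrib mult_ac)
  finally show ?thesis .
qed

text \<open>The derivative falls on the Gaussian density, so that \<open>f\<close> may be merely measurable.\<close>

lemma heat_mom_deriv_space:
  assumes s: "0 < s" and [measurable]: "f \<in> borel_measurable borel" and K: "\<And>y. \<bar>f y\<bar> \<le> K"
  shows "(heat_mom j s f has_real_derivative
     (heat_mom (Suc j) s f x - real j * heat_mom (j - 1) s f x) / sqrt s) (at x)"
proof -
  define d where "d = (\<lambda>x y. (heat_ker (Suc j) s (y - x) - real j * heat_ker (j - 1) s (y - x)) / sqrt s)"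
  define C where "C = (fact (Suc j) + real j * fact (j - 1)) * (exp 2 * exp (1 / sqrt s) / sqrt s) / sqrt s"
  have "0 \<le> K" using K[of 0] by linarith
  have db: "\<bar>d x' y\<bar> \<le> C * exp (- \<bar>y - x\<bar> / sqrt s)" if "\<bar>x' - x\<bar> < 1" for x' y
  proof -
    let ?E = "exp 2 * exp (1 / sqrt s) / sqrt s * exp (- \<bar>y - x\<bar> / sqrt s)"
    have b: "\<bar>heat_ker i s (y - x')\<bar> \<le> fact i * ?E" for i
      using heat_ker_bound[of s s s x' x i y] s that by (simp add: field_simps)
    have "\<bar>d x' y\<bar> = \<bar>heat_ker (Suc j) s (y - x') - real j * heat_ker (j - 1) s (y - x')\<bar> / sqrt s"
      unfolding d_def using s by (simp add: abs_divide)
    also have "\<dots> \<le> (\<bar>heat_ker (Suc j) s (y - x')\<bar> + \<bar>real j * heat_ker (j - 1) s (y - x')\<bar>) / sqrt s"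
      by (intro divide_right_mono abs_triangle_ineq4) (use s in simp)
    also have "\<dots> = (\<bar>heat_ker (Suc j) s (y - x')\<bar> + real j * \<bar>heat_ker (j - 1) s (y - x')\<bar>) / sqrt s"
      by (simp add: abs_mult)
    also have "\<dots> \<le> (fact (Suc j) * ?E + real j * (fact (j - 1) * ?E)) / sqrt s"
      using b[of "Suc j"] b[of "j - 1"] s by (intro divide_right_mono add_mono mult_left_mono) auto
    also have "\<dots> = C * exp (- \<bar>y - x\<bar> / sqrt s)"
      unfolding C_def by (simp add: algebra_simps add_divide_distrib del: fact_Suc)
    finally show ?thesis .
  qed
  have "((\<lambda>x. \<integral>y. f y * heat_ker j s (y - x) \<partial>lborel) has_real_derivative (\<integral>y. f y * d x y \<partial>lborel)) (at x)"
  proof (rule has_real_derivative_integral_dominated[where r = 1 and g = "\<lambda>y. K * (C * exp (- \<bar>y - x\<bar> / sqrt s))"])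
    show "integrable lborel (\<lambda>y. K * (C * exp (- \<bar>y - x\<bar> / sqrt s)))"
      using integrable_exp_neg_abs[of "sqrt s" x] s by simp
    show "integrable lborel (\<lambda>ya. f ya * heat_ker j s (ya - y))" for y
      by (rule heat_ker_integrable[OF assms])
    show "((\<lambda>x. f y * heat_ker j s (y - x)) has_real_derivative f y * d x' y) (at x')" for x' y
      using DERIV_cmult[OF heat_ker_deriv_space[OF s, of j y x'], of "f y"] by (simp add: d_def)
    show "\<bar>f y * d x' y\<bar> \<le> K * (C * exp (- \<bar>y - x\<bar> / sqrt s))" if "\<bar>x' - x\<bar> < 1" for x' y
      using K[of y] db[OF that, of y] \<open>0 \<le> K\<close> by (auto simp: abs_mult intro: mult_mono)
  qed (auto simp: d_def)
  also have "(\<integral>y. f y * d x y \<partial>lborel) = (heat_mom (Suc j) s f x - real j * heat_mom (j - 1) s f x) / sqrt s"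
  proof -
    have "(\<integral>y. f y * d x y \<partial>lborel) = (\<integral>y. (f y * heat_ker (Suc j) s (y - x) - real j * (f y * heat_ker (j - 1) s (y - x))) / sqrt s \<partial>lborel)"
      by (rule Bochner_Integration.integral_cong) (auto simp: d_def field_simps)
    also have "\<dots> = ((\<integral>y. f y * heat_ker (Suc j) s (y - x) \<partial>lborel) - real j * (\<integral>y. f y * heat_ker (j - 1) s (y - x) \<partial>lborel)) / sqrt s"
      using heat_ker_integrable[OF assms] by (simp add: Bochner_Integration.integral_diff)
    finally show ?thesis using s by (simp add: heat_mom_eq_heat_ker)
  qed
  also have "(\<lambda>x. \<integral>y. f y * heat_ker j s (y - x) \<partial>lborel) = heat_mom j s f"
    using s by (auto simp: heat_mom_eq_heat_ker)
  finally show ?thesis .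
qed

lemma heat_ker_deriv_time:
  assumes "0 < s"
  shows "((\<lambda>s. heat_ker 0 s u) has_real_derivative (heat_ker 2 s u - heat_ker 0 s u) / (2 * s)) (at s)"
proof -
  define v where "v = u / sqrt s"
  have v: "((\<lambda>s. u / sqrt s) has_real_derivative - (v / (2 * s))) (at s)"
    unfolding v_def using assms by (auto intro!: derivative_eq_intros simp: field_simps)
  have q: "((\<lambda>s. 1 / sqrt s) has_real_derivative - (1 / (2 * s * sqrt s))) (at s)"
    using assms by (auto intro!: derivative_eq_intros simp: field_simps)
  have "((\<lambda>s. std_normal_density (u / sqrt s) * (1 / sqrt s)) has_real_derivative
      (- (v * std_normal_density v)) * (- (v / (2 * s))) * (1 / sqrt s)
        + - (1 / (2 * s * sqrt s)) * std_normal_density v) (at s)"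
    unfolding v_def by (intro DERIV_mult q DERIV_chain2[OF std_normal_density_deriv v[unfolded v_def]])
  also have "(- (v * std_normal_density v)) * (- (v / (2 * s))) * (1 / sqrt s)
        + - (1 / (2 * s * sqrt s)) * std_normal_density v = (heat_ker 2 s u - heat_ker 0 s u) / (2 * s)"
    unfolding heat_ker_def v_def[symmetric] using assms by (simp add: field_simps power2_eq_square)
  finally show ?thesis by (simp add: heat_ker_def)
qed

text \<open>Together with the first two space derivatives this is the heat equation: the right-hand side is half
of the second space derivative of \<open>heat_mom 0 s f\<close>.\<close>

lemma heat_mom_deriv_time:
  assumes s: "0 < s" and [measurable]: "f \<in> borel_measurable borel" and K: "\<And>y. \<bar>f y\<bar> \<le> K"
  shows "((\<lambda>s. heat_mom 0 s f x) has_real_derivative (heat_mom 2 s f x - heat_mom 0 s f x) / (2 * s)) (at s)"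
proof -
  define d where "d = (\<lambda>s y. (heat_ker 2 s (y - x) - heat_ker 0 s (y - x)) / (2 * s))"
  define a b where "a = s / 2" and "b = 2 * s"
  define C where "C = 3 * (exp 2 * exp (1 / sqrt b) / sqrt a) / (2 * a)"
  have "0 \<le> K" using K[of 0] by linarith
  have a: "0 < a" "0 < b" using s by (auto simp: a_def b_def)
  have db: "\<bar>d s' y\<bar> \<le> C * exp (- \<bar>y - x\<bar> / sqrt b)" if "\<bar>s' - s\<bar> < a" for s' y
  proof -
    have s': "a \<le> s'" "s' \<le> b" using that s unfolding a_def b_def by linarith+
    let ?E = "exp 2 * exp (1 / sqrt b) / sqrt a * exp (- \<bar>y - x\<bar> / sqrt b)"
    have b: "\<bar>heat_ker i s' (y - x)\<bar> \<le> fact i * ?E" for i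
      using heat_ker_bound[of a s' b x x i y] a s' by (simp add: field_simps)
    have "\<bar>d s' y\<bar> \<le> (\<bar>heat_ker 2 s' (y - x)\<bar> + \<bar>heat_ker 0 s' (y - x)\<bar>) / (2 * s')"
      unfolding d_def using s' a
      by (simp add: abs_divide) (rule divide_right_mono, use abs_triangle_ineq4 in auto)
    also have "\<dots> \<le> (fact 2 * ?E + fact 0 * ?E) / (2 * a)"
      using b[of 2] b[of 0] s' a by (intro frac_le add_mono) auto
    also have "\<dots> = C * exp (- \<bar>y - x\<bar> / sqrt b)" by (simp add: C_def field_simps)
    finally show ?thesis .
  qed
  have "((\<lambda>s. \<integral>y. f y * heat_ker 0 s (y - x) \<partial>lborel) has_real_derivative (\<integral>y. f y * d s y \<partial>lborel)) (at s)"
  proof (rule has_real_derivative_integral_dominated[where r = a and g = "\<lambda>y. K * (C * exp (- \<bar>y - x\<bar> / sqrt b))"])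
    show "integrable lborel (\<lambda>y. K * (C * exp (- \<bar>y - x\<bar> / sqrt b)))"
      using integrable_exp_neg_abs[of "sqrt b" x] a by simp
    show "integrable lborel (\<lambda>y. f y * heat_ker 0 s' (y - x))" if "\<bar>s' - s\<bar> < a" for s'
    proof (rule heat_ker_integrable)
      show "0 < s'" using that s unfolding a_def abs_less_iff by linarith
    qed (use K in auto)
    show "((\<lambda>s. f y * heat_ker 0 s (y - x)) has_real_derivative f y * d s' y) (at s')" if "\<bar>s' - s\<bar> < a" for s' y
    proof -
      have "0 < s'" using that s unfolding a_def abs_less_iff by linarith
      from DERIV_cmult[OF heat_ker_deriv_time[OF this, of "y - x"], of "f y"] show ?thesis by (simp add: d_def)
    qed
    show "\<bar>f y * d s' y\<bar> \<le> K * (C * exp (- \<bar>y - x\<bar> / sqrt b))" if "\<bar>s' - s\<bar> < a" for s' y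
      using K[of y] db[OF that, of y] \<open>0 \<le> K\<close> by (auto simp: abs_mult intro: mult_mono)
  qed (use a in \<open>auto simp: d_def\<close>)
  also have "(\<integral>y. f y * d s y \<partial>lborel) = (heat_mom 2 s f x - heat_mom 0 s f x) / (2 * s)"
  proof -
    have "(\<integral>y. f y * d s y \<partial>lborel) = (\<integral>y. (f y * heat_ker 2 s (y - x) - (f y * heat_ker 0 s (y - x))) / (2 * s) \<partial>lborel)"
      by (rule Bochner_Integration.integral_cong) (auto simp: d_def field_simps)
    also have "\<dots> = ((\<integral>y. f y * heat_ker 2 s (y - x) \<partial>lborel) - (\<integral>y. f y * heat_ker 0 s (y - x) \<partial>lborel)) / (2 * s)"
      using heat_ker_integrable[OF assms] by (simp add: Bochner_Integration.integral_diff)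
    finally show ?thesis using s by (simp add: heat_mom_eq_heat_ker)
  qed
  finally show ?thesis
    by (rule has_field_derivative_transform_within_open[of _ _ _ "{0<..}"]) (use s in \<open>auto simp: heat_mom_eq_heat_ker\<close>)
qed

lemma heat_mom_continuous:
  assumes [measurable]: "f \<in> borel_measurable borel" and K: "\<And>y. \<bar>f y\<bar> \<le> K"
  shows "continuous_on ({0<..} \<times> UNIV) (\<lambda>(s, x). heat_mom j s f x)"
  unfolding continuous_on
proof clarify
  fix s x :: real assume s: "0 < s"
  define a b where "a = s / 2" and "b = 2 * s"
  have a: "0 < a" "0 < b" using s by (auto simp: a_def b_def)
  have "0 \<le> K" using K[of 0] by linarith
  let ?F = "at (s, x) within {0<..} \<times> UNIV"
  have fst: "(fst \<longlongrightarrow> s) ?F" and snd: "(snd \<longlongrightarrow> x) ?F"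
    using tendsto_fst[OF tendsto_ident_at, of "(s,x)"] tendsto_snd[OF tendsto_ident_at, of "(s,x)"] by (simp_all add: eta_contract_eq)
  have near: "\<forall>\<^sub>F p in ?F. a \<le> fst p \<and> fst p \<le> b \<and> \<bar>snd p - x\<bar> \<le> 1 \<and> 0 < fst p"
  proof -
    have "\<forall>\<^sub>F p in ?F. a < fst p" "\<forall>\<^sub>F p in ?F. fst p < b"
      using order_tendstoD(1)[OF fst, of a] order_tendstoD(2)[OF fst, of b] s by (auto simp: a_def b_def)
    moreover have "\<forall>\<^sub>F p in ?F. dist (snd p) x < 1" using tendstoD[OF snd, of 1] by simp
    ultimately show ?thesis by eventually_elim (use a in \<open>auto simp: dist_real_def\<close>)
  qed
  have "((\<lambda>p. \<integral>y. f y * heat_ker j (fst p) (y - snd p) \<partial>lborel) \<longlongrightarrow> (\<integral>y. f y * heat_ker j s (y - x) \<partial>lborel)) ?F"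
  proof (rule tendsto_integral_dominated_at[where g = "\<lambda>y. K * (fact j * exp 2 * exp (1 / sqrt b) / sqrt a * exp (- \<bar>y - x\<bar> / sqrt b))"])
    show "integrable lborel (\<lambda>y. K * (fact j * exp 2 * exp (1 / sqrt b) / sqrt a * exp (- \<bar>y - x\<bar> / sqrt b)))"
      using integrable_exp_neg_abs[of "sqrt b" x] a by simp
    show "\<forall>\<^sub>F p in ?F. AE y in lborel. \<bar>f y * heat_ker j (fst p) (y - snd p)\<bar> \<le> K * (fact j * exp 2 * exp (1 / sqrt b) / sqrt a * exp (- \<bar>y - x\<bar> / sqrt b))"
      using near
    proof eventually_elim
      case (elim p)
      show ?case
      proof (rule AE_I2)
        fix y
        show "\<bar>f y * heat_ker j (fst p) (y - snd p)\<bar> \<le> K * (fact j * exp 2 * exp (1 / sqrt b) / sqrt a * exp (- \<bar>y - x\<bar> / sqrt b))"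
          unfolding abs_mult using K[of y] heat_ker_bound[of a "fst p" b "snd p" x j y] elim a \<open>0 \<le> K\<close>
          by (intro mult_mono) auto
      qed
    qed
    show "AE y in lborel. ((\<lambda>p. f y * heat_ker j (fst p) (y - snd p)) \<longlongrightarrow> f y * heat_ker j s (y - x)) ?F"
      unfolding heat_ker_def std_normal_density_def using s by (intro AE_I2 tendsto_intros fst snd) auto
  qed auto
  then have "((\<lambda>p. heat_mom j (fst p) f (snd p)) \<longlongrightarrow> heat_mom j s f x) ?F"
    unfolding heat_mom_eq_heat_ker[OF s assms(1)]
  proof (rule Lim_transform_eventually)
    show "\<forall>\<^sub>F p in ?F. (\<integral>y. f y * heat_ker j (fst p) (y - snd p) \<partial>lborel) = heat_mom j (fst p) f (snd p)"
      using near by eventually_elim (simp add: heat_mom_eq_heat_ker)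
  qed
  then show "((\<lambda>(s, x). heat_mom j s f x) \<longlongrightarrow> heat_mom j s f x) ?F"
    by (simp add: case_prod_unfold)
qed

lemma (in prob_space) normal_expectation:
  assumes X: "distributed M lborel X (normal_density 0 \<sigma>)" and \<sigma>: "0 < \<sigma>"
    and [measurable]: "(h :: real \<Rightarrow> real) \<in> borel_measurable borel"
  shows "expectation (\<lambda>\<omega>. h (X \<omega>)) = (\<integral>z. h (\<sigma> * z) \<partial>\<gamma>)"
proof -
  have "expectation (\<lambda>\<omega>. h (X \<omega>)) = (\<integral>y. normal_density 0 \<sigma> y * h y \<partial>lborel)"
    by (rule distributed_integral[OF X, symmetric]) (auto simp: normal_density_nonneg)
  also have "\<dots> = \<sigma> * (\<integral>z. normal_density 0 \<sigma> (\<sigma> * z) * h (\<sigma> * z) \<partial>lborel)"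
    using lborel_integral_real_affine[of \<sigma> "\<lambda>y. normal_density 0 \<sigma> y * h y" 0] \<sigma> by simp
  also have "\<dots> = (\<integral>z. std_normal_density z * h (\<sigma> * z) \<partial>lborel)"
    using \<sigma> by (subst integral_mult_right_zero[symmetric])
      (auto intro!: Bochner_Integration.integral_cong simp: normal_density_def power_mult_distrib real_sqrt_mult)
  also have "\<dots> = (\<integral>z. h (\<sigma> * z) \<partial>\<gamma>)"
    by (subst integral_density) (auto simp: normal_density_nonneg)
  finally show ?thesis .
qed

lemma distributed_scaled_normal:
  assumes "0 < \<sigma>"
  shows "distributed \<gamma> lborel (\<lambda>z. \<sigma> * z) (normal_density 0 \<sigma>)"
proof -
  have "distributed \<gamma> lborel (\<lambda>z. z) std_normal_density"
    by (auto simp: distributed_def distr_id2 normal_density_nonneg)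
  from \<gamma>.normal_density_affine[OF this, of \<sigma> 0] show ?thesis using assms by simp
qed

text \<open>The sum of independent centred normal variables of variances \<open>s\<close> and \<open>t\<close> is normal with variance
\<open>s + t\<close>.\<close>

lemma heat_mom_semigroup:
  assumes s: "0 < s" "0 < t" and [measurable]: "f \<in> borel_measurable borel" and K: "\<And>y. \<bar>f y\<bar> \<le> K"
  shows "heat_mom 0 s (heat_mom 0 t f) x = heat_mom 0 (s + t) f x"
proof -
  interpret P: pair_prob_space \<gamma> \<gamma> ..
  have fst: "distr (\<gamma> \<Otimes>\<^sub>M \<gamma>) \<gamma> fst = \<gamma>" and snd: "distr (\<gamma> \<Otimes>\<^sub>M \<gamma>) \<gamma> snd = \<gamma>"
  proof -
    show fst: "distr (\<gamma> \<Otimes>\<^sub>M \<gamma>) \<gamma> fst = \<gamma>" by (rule \<gamma>.distr_pair_fst)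
    have "distr (\<gamma> \<Otimes>\<^sub>M \<gamma>) \<gamma> snd = distr (distr (\<gamma> \<Otimes>\<^sub>M \<gamma>) (\<gamma> \<Otimes>\<^sub>M \<gamma>) (\<lambda>(x, y). (y, x))) \<gamma> snd"
      by (subst P.distr_pair_swap[symmetric]) simp
    also have "\<dots> = distr (\<gamma> \<Otimes>\<^sub>M \<gamma>) \<gamma> fst" by (subst distr_distr) (auto simp: o_def case_prod_unfold)
    finally show "distr (\<gamma> \<Otimes>\<^sub>M \<gamma>) \<gamma> snd = \<gamma>" using fst by simp
  qed
  have ind0: "P.indep_var \<gamma> fst \<gamma> snd"
    unfolding P.indep_var_distribution_eq by (simp add: fst snd distr_id2)
  have dist: "distributed (\<gamma> \<Otimes>\<^sub>M \<gamma>) lborel (\<lambda>p. sqrt a * p' p) (normal_density 0 (sqrt a))"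
    if "distr (\<gamma> \<Otimes>\<^sub>M \<gamma>) \<gamma> p' = \<gamma>" and [measurable]: "p' \<in> \<gamma> \<Otimes>\<^sub>M \<gamma> \<rightarrow>\<^sub>M \<gamma>" and "0 < a" for a p'
  proof -
    have [measurable]: "p' \<in> borel_measurable (\<gamma> \<Otimes>\<^sub>M \<gamma>)"
      using that(2) measurable_cong_sets[OF refl, of \<gamma> borel] by simp
    have "distr (\<gamma> \<Otimes>\<^sub>M \<gamma>) lborel (\<lambda>p. sqrt a * p' p) = distr (distr (\<gamma> \<Otimes>\<^sub>M \<gamma>) \<gamma> p') lborel (\<lambda>z. sqrt a * z)"
      by (subst distr_distr) (auto simp: o_def)
    also have "\<dots> = density lborel (normal_density 0 (sqrt a))"
      using distributed_scaled_normal[of "sqrt a"] that by (simp add: distributed_def)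
    finally show ?thesis by (auto simp: distributed_def normal_density_nonneg)
  qed
  have "P.indep_var borel ((\<lambda>z. sqrt s * z) \<circ> fst) borel ((\<lambda>z. sqrt t * z) \<circ> snd)"
    by (rule P.indep_var_compose[OF ind0]) auto
  then have ind: "P.indep_var borel (\<lambda>p. sqrt s * fst p) borel (\<lambda>p. sqrt t * snd p)"
    by (simp add: o_def)
  have "distributed (\<gamma> \<Otimes>\<^sub>M \<gamma>) lborel (\<lambda>p. sqrt s * fst p + sqrt t * snd p)
      (normal_density (0 + 0) (sqrt ((sqrt s)\<^sup>2 + (sqrt t)\<^sup>2)))"
    by (rule P.add_indep_normal[OF ind]) (use s dist[OF fst] dist[OF snd] in auto)
  then have D: "distributed (\<gamma> \<Otimes>\<^sub>M \<gamma>) lborel (\<lambda>p. sqrt s * fst p + sqrt t * snd p) (normal_density 0 (sqrt (s + t)))"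
    using s by simp
  have "heat_mom 0 s (heat_mom 0 t f) x = (\<integral>z. (\<integral>w. f (x + sqrt s * z + sqrt t * w) \<partial>\<gamma>) \<partial>\<gamma>)"
    by (simp add: heat_mom_def)
  also have "\<dots> = (\<integral>p. f (x + sqrt s * fst p + sqrt t * snd p) \<partial>(\<gamma> \<Otimes>\<^sub>M \<gamma>))"
  proof -
    have "integrable (\<gamma> \<Otimes>\<^sub>M \<gamma>) (\<lambda>p. f (x + sqrt s * fst p + sqrt t * snd p))"
      by (rule P.integrable_const_bound[where B = K]) (use K in auto)
    from P.integral_fst'[OF this] show ?thesis by simp
  qed
  also have "\<dots> = (\<integral>p. f (x + (sqrt s * fst p + sqrt t * snd p)) \<partial>(\<gamma> \<Otimes>\<^sub>M \<gamma>))"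
    by (simp add: add.assoc)
  also have "\<dots> = (\<integral>z. f (x + sqrt (s + t) * z) \<partial>\<gamma>)"
    by (rule P.normal_expectation[OF D, of "\<lambda>y. f (x + y)"]) (use s in auto)
  finally show ?thesis by (simp add: heat_mom_def)
qed

lemma tendsto_jointly_continuous:
  fixes f :: "real \<Rightarrow> real \<Rightarrow> real"
  assumes c: "continuous_on ({0<..} \<times> UNIV) (\<lambda>(t, x). f t x)" and t: "0 < t"
    and a: "(a \<longlongrightarrow> t) F" and b: "(b \<longlongrightarrow> x) F"
  shows "((\<lambda>p. f (a p) (b p)) \<longlongrightarrow> f t x) F"
proof -
  have "open ({0<..} \<times> UNIV :: (real \<times> real) set)" by (intro open_Times) auto
  then have "isCont (\<lambda>(t, x). f t x) (t, x)"
    using c t by (auto simp: continuous_on_eq_continuous_at)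
  from isCont_tendsto_compose[OF this tendsto_Pair[OF a b]] show ?thesis by simp
qed

lemma tendsto_fst_at: "(fst \<longlongrightarrow> t) (at (t, x))" and tendsto_snd_at: "(snd \<longlongrightarrow> x) (at (t, x))"
  using tendsto_fst[OF tendsto_ident_at, of "(t, x)"] tendsto_snd[OF tendsto_ident_at, of "(t, x)"]
  by (simp_all add: eta_contract_eq)

lemma tendsto_indicator_Ioo:
  fixes F :: "real \<times> real \<Rightarrow> real"
  assumes "s \<noteq> t" and F: "0 < s \<Longrightarrow> s < t \<Longrightarrow> (F \<longlongrightarrow> l) (at (t, x))"
  shows "((\<lambda>p. indicator {0<..<fst p} s * F p) \<longlongrightarrow> indicator {0<..<t} s * l) (at (t, x))"
proof (rule Lim_transform_eventually)
  show "((\<lambda>p. indicator {0<..<t} s * F p) \<longlongrightarrow> indicator {0<..<t} s * l) (at (t, x))"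
  proof (cases "0 < s \<and> s < t")
    case True
    then show ?thesis using F by simp
  qed auto
  have "\<forall>\<^sub>F p in at (t, x). s < fst p \<longleftrightarrow> s < t"
  proof (cases "s < t")
    case True
    show ?thesis using order_tendstoD(1)[OF tendsto_fst_at True] by eventually_elim (simp add: True)
  next
    case False
    then have "t < s" using assms(1) by simp
    from order_tendstoD(2)[OF tendsto_fst_at this] show ?thesis by eventually_elim (use False in simp)
  qed
  then show "\<forall>\<^sub>F p in at (t, x). indicator {0<..<t} s * F p = indicator {0<..<fst p} s * F p"
    by eventually_elim (simp add: indicator_def)
qed

lemma integral_FTC_Ioo:
  fixes F f :: "real \<Rightarrow> real"
  assumes T: "0 < T" and F: "\<And>s. 0 < s \<Longrightarrow> (F has_real_derivative f s) (at s)" "\<And>s. 0 < s \<Longrightarrow> isCont f s"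
    and f: "\<And>s. 0 < s \<Longrightarrow> 0 \<le> f s" and lim: "(F \<longlongrightarrow> A) (at_right 0)" "(F \<longlongrightarrow> F T) (at_left T)"
  shows "integrable lborel (\<lambda>s. indicator {0<..<T} s * f s)"
    and "(\<integral>s. indicator {0<..<T} s * f s \<partial>lborel) = F T - A"
proof -
  have "((F \<circ> real_of_ereal) \<longlongrightarrow> A) (at_right (ereal 0))" "((F \<circ> real_of_ereal) \<longlongrightarrow> F T) (at_left (ereal T))"
    using lim by (simp_all add: ereal_tendsto_simps)
  then have "set_integrable lborel (einterval (ereal 0) (ereal T)) f"
    and "(LBINT s=ereal 0..ereal T. f s) = F T - A"
    using interval_integral_FTC_nonneg[of "ereal 0" "ereal T" F f A "F T"] T F f by auto
  then show "integrable lborel (\<lambda>s. indicator {0<..<T} s * f s)"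
    and "(\<integral>s. indicator {0<..<T} s * f s \<partial>lborel) = F T - A"
    using T by (simp_all add: set_integrable_def interval_lebesgue_integral_def set_lebesgue_integral_def)
qed

lemma inverse_sqrt_integral:
  assumes T: "0 < T"
  shows "integrable lborel (\<lambda>s. indicator {0<..<T} s * (1 / sqrt s) :: real)"
    and "(\<integral>s. indicator {0<..<T} s * (1 / sqrt s) \<partial>lborel) = 2 * sqrt T"
proof -
  have d: "((\<lambda>s. 2 * sqrt s) has_real_derivative 1 / sqrt s) (at s)" if "0 < s" for s
    using that by (auto intro!: derivative_eq_intros simp: field_simps)
  have c: "isCont (\<lambda>s. 1 / sqrt s) s" if "0 < s" for s
    using that by (intro continuous_intros) auto
  have l: "((\<lambda>s. 2 * sqrt s) \<longlongrightarrow> 2 * sqrt 0) (at_right 0)" "((\<lambda>s. 2 * sqrt s) \<longlongrightarrow> 2 * sqrt T) (at_left T)"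
    by (intro tendsto_intros)+
  note * = integral_FTC_Ioo[OF T d c _ l]
  show "integrable lborel (\<lambda>s. indicator {0<..<T} s * (1 / sqrt s) :: real)" by (rule *(1)) auto
  show "(\<integral>s. indicator {0<..<T} s * (1 / sqrt s) \<partial>lborel) = 2 * sqrt T" by (subst *(2)) auto
qed

lemma dominated_integral:
  fixes f :: "'a \<Rightarrow> real"
  assumes "integrable M g" "f \<in> borel_measurable M" "\<And>\<omega>. \<omega> \<in> space M \<Longrightarrow> \<bar>f \<omega>\<bar> \<le> g \<omega>"
  shows "integrable M f" and "\<bar>\<integral>\<omega>. f \<omega> \<partial>M\<bar> \<le> (\<integral>\<omega>. g \<omega> \<partial>M)"
proof -
  show i: "integrable M f"
    by (rule Bochner_Integration.integrable_bound[OF assms(1,2)]) (use assms(3) in \<open>fastforce intro: AE_I2\<close>)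
  have "\<bar>\<integral>\<omega>. f \<omega> \<partial>M\<bar> \<le> (\<integral>\<omega>. \<bar>f \<omega>\<bar> \<partial>M)" using integral_norm_bound[of M f] by simp
  also have "\<dots> \<le> (\<integral>\<omega>. g \<omega> \<partial>M)" by (rule integral_mono) (use i assms in auto)
  finally show "\<bar>\<integral>\<omega>. f \<omega> \<partial>M\<bar> \<le> (\<integral>\<omega>. g \<omega> \<partial>M)" .
qed

lemma moment_mult_bound:
  assumes "\<bar>a\<bar> \<le> (K :: real)"
  shows "\<bar>z ^ j * a\<bar> \<le> K * \<bar>z\<bar> ^ j"
proof -
  have "\<bar>z ^ j * a\<bar> = \<bar>a\<bar> * \<bar>z\<bar> ^ j" by (simp add: abs_mult power_abs)
  also have "\<dots> \<le> K * \<bar>z\<bar> ^ j" by (intro mult_right_mono assms) simp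
  finally show ?thesis .
qed

lemma integrable_indicator_Ioo:
  fixes t K :: real
  shows "integrable lborel (\<lambda>s. indicator {0<..<t} s * K :: real)"
proof -
  have "emeasure lborel {0<..<t} < \<infinity>" by (cases "0 \<le> t") auto
  then show ?thesis by (intro integrable_mult_left integrable_real_indicator) auto
qed

section \<open>Duhamel integrals\<close>

text \<open>For \<open>j = 0\<close> this is the integral over \<open>0 < s < t\<close> of \<open>exp (- s) P\<^sub>s (q(t - s))\<close>, and for \<open>j = 1\<close> its space derivative, where
the derivative of the heat kernel gives the weight \<open>Z / \<surd>s\<close>.\<close>

definition duhamel :: "nat \<Rightarrow> (real \<Rightarrow> real \<Rightarrow> real) \<Rightarrow> real \<Rightarrow> real \<Rightarrow> real" where
  "duhamel j q t x =
     (\<integral>s. indicator {0<..<t} s * (exp (- s) / sqrt s ^ j * heat_mom j s (q (t - s)) x) \<partial>lborel)"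

locale bounded_field =
  fixes q :: "real \<Rightarrow> real \<Rightarrow> real" and T K :: real
  assumes q_borel[measurable]: "(\<lambda>(r, y). q r y) \<in> borel_measurable (borel \<Otimes>\<^sub>M borel)"
    and q_bound: "\<And>r y. 0 < r \<Longrightarrow> r < T \<Longrightarrow> \<bar>q r y\<bar> \<le> K"
begin

lemma q_slice[measurable]: "q r \<in> borel_measurable borel"
  by measurable

lemma K_nonneg: "0 < T \<Longrightarrow> 0 \<le> K"
  using q_bound[of "T / 2" 0] by fastforce

lemma duhamel_integrand_borel[measurable]:
  "(\<lambda>(s, x). heat_mom j s (q (t - s)) x) \<in> borel_measurable (borel \<Otimes>\<^sub>M borel)"
  using heat_mom_borel[of "\<lambda>(p, y). q (t - fst p) y" "borel \<Otimes>\<^sub>M borel" fst snd j]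
  by (simp add: case_prod_unfold)

lemma duhamel_integrand_borel1[measurable]:
  "(\<lambda>s. heat_mom j s (q (t - s)) x) \<in> borel_measurable borel"
  using measurable_compose[OF measurable_Pair2'[of x borel borel] duhamel_integrand_borel]
    measurable_compose[OF measurable_Pair1'[of x borel borel] duhamel_integrand_borel] by simp

lemma duhamel_borel[measurable]: "duhamel j q t \<in> borel_measurable borel"
  unfolding duhamel_def by measurable

lemma integrand_bound0:
  assumes "t \<le> T"
  shows "\<bar>indicator {0<..<t} s * (exp (- s) / sqrt s ^ 0 * heat_mom 0 s (q (t - s)) x)\<bar> \<le> indicator {0<..<t} s * K"
proof (cases "0 < s \<and> s < t")
  case True
  have "\<bar>heat_mom 0 s (q (t - s)) x\<bar> \<le> K * abs_moment 0"
    by (rule heat_mom_bound) (use True assms q_bound in auto)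
  then have "exp (- s) * \<bar>heat_mom 0 s (q (t - s)) x\<bar> \<le> 1 * K" using True by (intro mult_mono) auto
  then show ?thesis using True by (simp add: abs_mult)
qed auto

lemma integrand_bound1:
  assumes "t \<le> T"
  shows "\<bar>indicator {0<..<t} s * (exp (- s) / sqrt s ^ 1 * heat_mom 1 s (q (t - s)) x)\<bar>
    \<le> indicator {0<..<T} s * (1 / sqrt s) * (K * abs_moment 1)"
proof (cases "0 < s \<and> s < t")
  case True
  have "\<bar>heat_mom 1 s (q (t - s)) x\<bar> \<le> K * abs_moment 1"
    by (rule heat_mom_bound) (use True assms q_bound in auto)
  then have "exp (- s) / sqrt s * \<bar>heat_mom 1 s (q (t - s)) x\<bar> \<le> 1 / sqrt s * (K * abs_moment 1)"
    using True by (intro mult_mono divide_right_mono) auto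
  then show ?thesis using True assms by (simp add: abs_mult)
next
  case False
  then show ?thesis using K_nonneg abs_moment_nonneg[of 1] by (auto simp: indicator_def)
qed

lemma integrand_integrable0:
  assumes "t \<le> T"
  shows "integrable lborel (\<lambda>s. indicator {0<..<t} s * (exp (- s) / sqrt s ^ 0 * heat_mom 0 s (q (t - s)) x))"
  by (rule dominated_integral(1)[OF integrable_indicator_Ioo _ integrand_bound0[OF assms]]) auto

lemma integrand_integrable1:
  assumes "t \<le> T" "0 < T"
  shows "integrable lborel (\<lambda>s. indicator {0<..<t} s * (exp (- s) / sqrt s ^ 1 * heat_mom 1 s (q (t - s)) x))"
  by (rule dominated_integral(1)[OF _ _ integrand_bound1[OF assms(1)]])
    (intro integrable_mult_left inverse_sqrt_integral assms, measurable)

lemma duhamel_bound0: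
  assumes "0 < t" "t \<le> T"
  shows "\<bar>duhamel 0 q t x\<bar> \<le> t * K"
proof -
  have "\<bar>duhamel 0 q t x\<bar> \<le> (\<integral>s. indicator {0<..<t} s * K \<partial>lborel)"
    unfolding duhamel_def by (rule dominated_integral(2)[OF integrable_indicator_Ioo _ integrand_bound0[OF assms(2)]]) auto
  then show ?thesis using assms by simp
qed

lemma duhamel_bound1:
  assumes "0 < t" "t \<le> T"
  shows "\<bar>duhamel 1 q t x\<bar> \<le> 2 * sqrt T * (K * abs_moment 1)"
proof -
  have T: "0 < T" using assms by simp
  have "\<bar>duhamel 1 q t x\<bar> \<le> (\<integral>s. indicator {0<..<T} s * (1 / sqrt s) * (K * abs_moment 1) \<partial>lborel)"
    unfolding duhamel_def
    by (rule dominated_integral(2)[OF _ _ integrand_bound1[OF assms(2)]])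
      (intro integrable_mult_left inverse_sqrt_integral T, measurable)
  also have "\<dots> = 2 * sqrt T * (K * abs_moment 1)"
    by (simp only: integral_mult_left_zero inverse_sqrt_integral(2)[OF T])
  finally show ?thesis .
qed

text \<open>Differentiation under the integral is possible because \<open>1 / \<surd>s\<close> is integrable at \<open>0\<close>; for the second
derivative the same argument would meet \<open>1 / s\<close> and fail.\<close>

lemma duhamel_deriv:
  assumes "0 < t" "t \<le> T"
  shows "(duhamel 0 q t has_real_derivative duhamel 1 q t x) (at x)"
proof -
  have T: "0 < T" using assms by simp
  have "((\<lambda>x. \<integral>s. indicator {0<..<t} s * (exp (- s) / sqrt s ^ 0 * heat_mom 0 s (q (t - s)) x) \<partial>lborel)
    has_real_derivative (\<integral>s. indicator {0<..<t} s * (exp (- s) / sqrt s ^ 1 * heat_mom 1 s (q (t - s)) x) \<partial>lborel)) (at x)"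
  proof (rule has_real_derivative_integral_dominated[where r = 1])
    show "integrable lborel (\<lambda>s. indicator {0<..<T} s * (1 / sqrt s) * (K * abs_moment 1))"
      by (intro integrable_mult_left inverse_sqrt_integral T)
    show "((\<lambda>x. indicator {0<..<t} s * (exp (- s) / sqrt s ^ 0 * heat_mom 0 s (q (t - s)) x)) has_real_derivative
        indicator {0<..<t} s * (exp (- s) / sqrt s ^ 1 * heat_mom 1 s (q (t - s)) y)) (at y)" for s y
    proof (cases "0 < s \<and> s < t")
      case True
      have "(heat_mom 0 s (q (t - s)) has_real_derivative heat_mom 1 s (q (t - s)) y / sqrt s) (at y)"
        using heat_mom_deriv_space[of s "q (t - s)" K 0 y] q_bound[of "t - s"] True assms by auto
      from DERIV_cmult[OF this, of "exp (- s)"] show ?thesis using True by simp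
    qed auto
  qed (use integrand_bound1 integrand_integrable0 assms in auto)
  then show ?thesis unfolding duhamel_def .
qed

text \<open>If the field is differentiable, the second derivative can be moved onto it, so that the kernel
  still carries only one.\<close>

lemma duhamel1_deriv:
  assumes "0 < t" "t \<le> T" and b: "bounded_field q' T K'"
    and d: "\<And>r y. 0 < r \<Longrightarrow> r < T \<Longrightarrow> (q r has_real_derivative q' r y) (at y)"
  shows "(duhamel 1 q t has_real_derivative duhamel 1 q' t x) (at x)"
proof -
  interpret Q: bounded_field q' T K' by (rule b)
  have T: "0 < T" using assms by simp
  have "((\<lambda>x. \<integral>s. indicator {0<..<t} s * (exp (- s) / sqrt s ^ 1 * heat_mom 1 s (q (t - s)) x) \<partial>lborel)
    has_real_derivative (\<integral>s. indicator {0<..<t} s * (exp (- s) / sqrt s ^ 1 * heat_mom 1 s (q' (t - s)) x) \<partial>lborel)) (at x)"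
  proof (rule has_real_derivative_integral_dominated[where r = 1])
    show "integrable lborel (\<lambda>s. indicator {0<..<T} s * (1 / sqrt s) * (K' * abs_moment 1))"
      by (intro integrable_mult_left inverse_sqrt_integral T)
    show "((\<lambda>x. indicator {0<..<t} s * (exp (- s) / sqrt s ^ 1 * heat_mom 1 s (q (t - s)) x)) has_real_derivative
        indicator {0<..<t} s * (exp (- s) / sqrt s ^ 1 * heat_mom 1 s (q' (t - s)) y)) (at y)" for s y
    proof (cases "0 < s \<and> s < t")
      case True
      then have r: "0 < t - s" "t - s < T" using assms by auto
      have "((\<lambda>x. \<integral>z. z ^ 1 * q (t - s) (x + sqrt s * z) \<partial>\<gamma>) has_real_derivative
          (\<integral>z. z ^ 1 * q' (t - s) (y + sqrt s * z) \<partial>\<gamma>)) (at y)"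
      proof (rule has_real_derivative_integral_dominated[where r = 1])
        show "integrable \<gamma> (\<lambda>z. K' * \<bar>z\<bar> ^ 1)" using integrable_moment[of 1] by simp
        show "integrable \<gamma> (\<lambda>z. z ^ 1 * q (t - s) (y + sqrt s * z))" for y
          by (rule heat_mom_integrable[where K = K]) (use q_bound r in auto)
        show "((\<lambda>x. z ^ 1 * q (t - s) (x + sqrt s * z)) has_real_derivative z ^ 1 * q' (t - s) (y + sqrt s * z)) (at y)" for y z
        proof -
          have "((\<lambda>x. x + sqrt s * z) has_real_derivative 1) (at y)" by (auto intro!: derivative_eq_intros)
          from DERIV_cmult[OF DERIV_chain2[OF d[OF r] this], of "z ^ 1"] show ?thesis by simp
        qed
        show "\<bar>z ^ 1 * q' (t - s) (y + sqrt s * z)\<bar> \<le> K' * \<bar>z\<bar> ^ 1" for y z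
          by (intro moment_mult_bound Q.q_bound r)
      qed auto
      then have "(heat_mom 1 s (q (t - s)) has_real_derivative heat_mom 1 s (q' (t - s)) y) (at y)"
        by (simp only: heat_mom_def[abs_def])
      from DERIV_cmult[OF this, of "exp (- s) / sqrt s"] show ?thesis using True by simp
    qed auto
  qed (use Q.integrand_bound1 integrand_integrable1 assms T in auto)
  then show ?thesis unfolding duhamel_def .
qed

text \<open>After the substitution \<open>r = t - s\<close> only the smooth heat kernel depends on \<open>t\<close> and \<open>x\<close>, so that
  measurability of the field suffices. This is the first regularity gained by a mild solution.\<close>

lemma duhamel0_tendsto:
  assumes t: "0 < t" "t < T"
  shows "((\<lambda>p. duhamel 0 q (fst p) (snd p)) \<longlongrightarrow> duhamel 0 q t x) (at (t, x))"
proof -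
  let ?f = "\<lambda>t x r. indicator {0<..<t} r * (exp (- (t - r)) * heat_mom 0 (t - r) (q r) x)"
  have sub: "duhamel 0 q t x = (\<integral>r. ?f t x r \<partial>lborel)" for t x
    unfolding duhamel_def
    by (subst lborel_integral_real_affine[where c = "-1" and t = t])
       (auto intro!: Bochner_Integration.integral_cong simp: indicator_def)
  have mf: "?f t x \<in> borel_measurable lborel" for t x
  proof -
    have "(\<lambda>r. heat_mom 0 (t - r) (\<lambda>y. (\<lambda>(r, y). q r y) (r, y)) x) \<in> borel_measurable borel"
      by (rule heat_mom_borel) auto
    then have [measurable]: "(\<lambda>r. heat_mom 0 (t - r) (q r) x) \<in> borel_measurable borel" by simp
    show ?thesis by measurable
  qed
  have near: "\<forall>\<^sub>F p in at (t, x). 0 < fst p \<and> fst p < T"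
    by (rule eventually_conj[OF order_tendstoD(1)[OF tendsto_fst_at t(1)] order_tendstoD(2)[OF tendsto_fst_at t(2)]])
  show ?thesis unfolding sub
  proof (rule tendsto_integral_dominated_at[where g = "\<lambda>r. indicator {0<..<T} r * K"])
    show "\<forall>\<^sub>F p in at (t, x). AE r in lborel. \<bar>?f (fst p) (snd p) r\<bar> \<le> indicator {0<..<T} r * K"
      using near
    proof eventually_elim
      case (elim p)
      show ?case
      proof (rule AE_I2)
        fix r
        show "\<bar>?f (fst p) (snd p) r\<bar> \<le> indicator {0<..<T} r * K"
          using integrand_bound0[of "fst p" "fst p - r" "snd p"] elim K_nonneg t
          by (auto simp: indicator_def split: if_splits)
      qed
    qed
    have "AE r in lborel. r \<noteq> t" by (rule AE_lborel_singleton)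
    then show "AE r in lborel. ((\<lambda>p. ?f (fst p) (snd p) r) \<longlongrightarrow> ?f t x r) (at (t, x))"
    proof eventually_elim
      case (elim r)
      then show ?case
      proof (rule tendsto_indicator_Ioo)
        assume r: "0 < r" "r < t"
        have c: "continuous_on ({0<..} \<times> UNIV) (\<lambda>(s, x). heat_mom 0 s (q r) x)"
          by (rule heat_mom_continuous[where K = K]) (use r t q_bound in auto)
        show "((\<lambda>p. exp (- (fst p - r)) * heat_mom 0 (fst p - r) (q r) (snd p)) \<longlongrightarrow> exp (- (t - r)) * heat_mom 0 (t - r) (q r) x) (at (t, x))"
          by (intro tendsto_intros tendsto_jointly_continuous[OF c] tendsto_fst_at tendsto_snd_at) (use r in auto)
      qed
    qed
    show "integrable lborel (\<lambda>r. indicator {0<..<T} r * K)" by (rule integrable_indicator_Ioo)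
  qed (use mf in auto)
qed

text \<open>Here the singular weight forbids the substitution \<open>r = t - s\<close>, since the dominating function would
depend on \<open>t\<close>; instead the field itself is continuous.\<close>

lemma duhamel1_tendsto:
  assumes t: "0 < t" "t < T" and c: "continuous_on ({0<..} \<times> UNIV) (\<lambda>(r, y). q r y)"
  shows "((\<lambda>p. duhamel 1 q (fst p) (snd p)) \<longlongrightarrow> duhamel 1 q t x) (at (t, x))"
proof -
  have T: "0 < T" using t by simp
  let ?f = "\<lambda>t x s. indicator {0<..<t} s * (exp (- s) / sqrt s ^ 1 * heat_mom 1 s (q (t - s)) x)"
  have near: "\<forall>\<^sub>F p in at (t, x). 0 < fst p \<and> fst p < T"
    by (rule eventually_conj[OF order_tendstoD(1)[OF tendsto_fst_at t(1)] order_tendstoD(2)[OF tendsto_fst_at t(2)]])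
  show ?thesis unfolding duhamel_def
  proof (rule tendsto_integral_dominated_at)
    show "integrable lborel (\<lambda>s. indicator {0<..<T} s * (1 / sqrt s) * (K * abs_moment 1))"
      by (intro integrable_mult_left inverse_sqrt_integral T)
    show "\<forall>\<^sub>F p in at (t, x). AE s in lborel. \<bar>?f (fst p) (snd p) s\<bar> \<le> indicator {0<..<T} s * (1 / sqrt s) * (K * abs_moment 1)"
      using near by eventually_elim (intro AE_I2 integrand_bound1, auto)
    have "AE s in lborel. s \<noteq> t" by (rule AE_lborel_singleton)
    then show "AE s in lborel. ((\<lambda>p. ?f (fst p) (snd p) s) \<longlongrightarrow> ?f t x s) (at (t, x))"
    proof eventually_elim
      case (elim s)
      then show ?case
      proof (rule tendsto_indicator_Ioo)
        assume s: "0 < s" "s < t"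
        have "((\<lambda>p. \<integral>z. z ^ 1 * q (fst p - s) (snd p + sqrt s * z) \<partial>\<gamma>) \<longlongrightarrow> (\<integral>z. z ^ 1 * q (t - s) (x + sqrt s * z) \<partial>\<gamma>)) (at (t, x))"
        proof (rule tendsto_integral_dominated_at)
          show "integrable \<gamma> (\<lambda>z. K * \<bar>z\<bar> ^ 1)" using integrable_moment[of 1] by simp
          show "\<forall>\<^sub>F p in at (t, x). AE z in \<gamma>. \<bar>z ^ 1 * q (fst p - s) (snd p + sqrt s * z)\<bar> \<le> K * \<bar>z\<bar> ^ 1"
            using near order_tendstoD(1)[OF tendsto_fst_at s(2)]
          proof eventually_elim
            case (elim p)
            then show ?case
              by (intro AE_I2 moment_mult_bound q_bound) (use s in auto)
          qed
          show "AE z in \<gamma>. ((\<lambda>p. z ^ 1 * q (fst p - s) (snd p + sqrt s * z)) \<longlongrightarrow> z ^ 1 * q (t - s) (x + sqrt s * z)) (at (t, x))"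
            by (intro AE_I2 tendsto_intros tendsto_jointly_continuous[OF c] tendsto_fst_at tendsto_snd_at) (use s in auto)
        qed auto
        then show "((\<lambda>p. exp (- s) / sqrt s ^ 1 * heat_mom 1 s (q (fst p - s)) (snd p)) \<longlongrightarrow> exp (- s) / sqrt s ^ 1 * heat_mom 1 s (q (t - s)) x) (at (t, x))"
          unfolding heat_mom_def by (rule tendsto_mult_left)
      qed
    qed
  qed auto
qed

end

lemma jointly_continuousI:
  fixes f :: "real \<Rightarrow> real \<Rightarrow> real"
  assumes "\<And>t x. 0 < t \<Longrightarrow> ((\<lambda>p. f (fst p) (snd p)) \<longlongrightarrow> f t x) (at (t, x))"
  shows "continuous_on ({0<..} \<times> UNIV) (\<lambda>(t, x). f t x)"
proof (intro continuous_at_imp_continuous_on ballI)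
  fix p :: "real \<times> real" assume "p \<in> {0<..} \<times> UNIV"
  then show "isCont (\<lambda>(t, x). f t x) p"
    using assms[of "fst p" "snd p"] by (auto simp: isCont_def case_prod_unfold)
qed

lemma heat_mom_slice_borel[measurable]:
  assumes [measurable]: "f \<in> borel_measurable borel"
  shows "heat_mom j s f \<in> borel_measurable borel"
proof -
  have "(\<lambda>x. heat_mom j s (\<lambda>y. (\<lambda>p. f (snd p)) (x, y)) x) \<in> borel_measurable borel"
    by (rule heat_mom_borel) measurable
  then show ?thesis by (simp only: snd_conv eta_contract_eq)
qed

lemma eventually_fst_pos: "0 < t \<Longrightarrow> \<forall>\<^sub>F p in at (t, x). 0 < fst p" for t :: real
  by (rule order_tendstoD(1)[OF tendsto_fst_at])

lemma taylor_second_order: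
  fixes f f' f'' :: "real \<Rightarrow> real"
  assumes "\<And>y. (f has_real_derivative f' y) (at y)" "\<And>y. (f' has_real_derivative f'' y) (at y)"
  shows "\<exists>\<xi>. \<bar>\<xi> - x\<bar> \<le> \<bar>h\<bar> \<and> f (x + h) = f x + h * f' x + h\<^sup>2 / 2 * f'' \<xi>"
proof (cases "h = 0")
  case False
  define diff where "diff = (\<lambda>m::nat. if m = 0 then f else if m = 1 then f' else f'')"
  have "\<exists>t. (if x + h < x then x + h < t \<and> t < x else x < t \<and> t < x + h) \<and>
      f (x + h) = (\<Sum>m<2. diff m x / fact m * (x + h - x) ^ m) + diff 2 t / fact 2 * (x + h - x) ^ 2"
    by (rule Taylor[of 2 diff f "x - \<bar>h\<bar>" "x + \<bar>h\<bar>"])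
      (use False assms in \<open>auto simp: diff_def less_Suc_eq numeral_2_eq_2\<close>)
  then obtain t where t: "if x + h < x then x + h < t \<and> t < x else x < t \<and> t < x + h"
    "f (x + h) = (\<Sum>m<2. diff m x / fact m * h ^ m) + diff 2 t / fact 2 * h ^ 2"
    by auto
  from t(1) have "\<bar>t - x\<bar> \<le> \<bar>h\<bar>" by (auto split: if_splits)
  with t(2) show ?thesis by (intro exI[of _ t]) (auto simp: diff_def numeral_2_eq_2 field_simps)
qed auto

section \<open>Mild solutions are classical\<close>

locale mild_solution =
  fixes g :: "real \<Rightarrow> real" and H :: "real \<Rightarrow> real \<Rightarrow> real"
  assumes g_borel[measurable]: "g \<in> borel_measurable borel"
    and g_nonneg: "\<And>y. 0 \<le> g y" and g_le_1: "\<And>y. g y \<le> 1"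
    and H_borel[measurable]: "(\<lambda>(t, x). H t x) \<in> borel_measurable (borel \<Otimes>\<^sub>M borel)"
    and H_nonneg: "\<And>t x. 0 < t \<Longrightarrow> 0 \<le> H t x" and H_le_1: "\<And>t x. 0 < t \<Longrightarrow> H t x \<le> 1"
    and mild: "\<And>t x. 0 < t \<Longrightarrow> H t x = exp (- t) * heat_mom 0 t g x + duhamel 0 (\<lambda>r y. (H r y)\<^sup>2) t x"
begin

lemma g_abs: "\<bar>g y\<bar> \<le> 1"
  using g_nonneg[of y] g_le_1[of y] by simp

lemma H_abs: "0 < t \<Longrightarrow> \<bar>H t x\<bar> \<le> 1"
  using H_nonneg[of t x] H_le_1[of t x] by simp

lemma H_slice[measurable]: "H t \<in> borel_measurable borel"
  by measurable

lemma square_field: "bounded_field (\<lambda>r y. (H r y)\<^sup>2) T 1"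
  by unfold_locales (use H_abs in \<open>auto simp: abs_square_le_1 power2_abs\<close>)

lemma H_continuous: "continuous_on ({0<..} \<times> UNIV) (\<lambda>(t, x). H t x)"
proof (rule jointly_continuousI)
  fix t x :: real assume t: "0 < t"
  interpret F: bounded_field "\<lambda>r y. (H r y)\<^sup>2" "t + 1" 1 by (rule square_field)
  have c: "continuous_on ({0<..} \<times> UNIV) (\<lambda>(s, x). heat_mom 0 s g x)"
    by (rule heat_mom_continuous[OF g_borel g_abs])
  have "((\<lambda>p. exp (- fst p) * heat_mom 0 (fst p) g (snd p) + duhamel 0 (\<lambda>r y. (H r y)\<^sup>2) (fst p) (snd p))
      \<longlongrightarrow> exp (- t) * heat_mom 0 t g x + duhamel 0 (\<lambda>r y. (H r y)\<^sup>2) t x) (at (t, x))"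
    by (intro tendsto_intros tendsto_fst_at tendsto_snd_at tendsto_jointly_continuous[OF c] F.duhamel0_tendsto) (use t in auto)
  then show "((\<lambda>p. H (fst p) (snd p)) \<longlongrightarrow> H t x) (at (t, x))"
    unfolding mild[OF t]
    by (rule Lim_transform_eventually)
      (use eventually_fst_pos[OF t] in \<open>eventually_elim, simp add: mild\<close>)
qed

definition Hx :: "real \<Rightarrow> real \<Rightarrow> real" where
  "Hx t x = exp (- t) * (heat_mom 1 t g x / sqrt t) + duhamel 1 (\<lambda>r y. (H r y)\<^sup>2) t x"

lemma Hx_deriv:
  assumes t: "0 < t"
  shows "(H t has_real_derivative Hx t x) (at x)"
proof -
  interpret F: bounded_field "\<lambda>r y. (H r y)\<^sup>2" t 1 by (rule square_field)
  have "(heat_mom 0 t g has_real_derivative heat_mom 1 t g x / sqrt t) (at x)"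
    using heat_mom_deriv_space[OF t g_borel g_abs, of 0 x] by simp
  then have "((\<lambda>x. exp (- t) * heat_mom 0 t g x + duhamel 0 (\<lambda>r y. (H r y)\<^sup>2) t x) has_real_derivative Hx t x) (at x)"
    unfolding Hx_def by (intro DERIV_add DERIV_cmult F.duhamel_deriv t order.refl)
  also have "(\<lambda>x. exp (- t) * heat_mom 0 t g x + duhamel 0 (\<lambda>r y. (H r y)\<^sup>2) t x) = H t"
    using mild[OF t] by auto
  finally show ?thesis .
qed

lemma Hx_continuous: "continuous_on ({0<..} \<times> UNIV) (\<lambda>(t, x). Hx t x)"
proof (rule jointly_continuousI)
  fix t x :: real assume t: "0 < t"
  interpret F: bounded_field "\<lambda>r y. (H r y)\<^sup>2" "t + 1" 1 by (rule square_field)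
  have c: "continuous_on ({0<..} \<times> UNIV) (\<lambda>(s, x). heat_mom 1 s g x)"
    by (rule heat_mom_continuous[OF g_borel g_abs])
  have "continuous_on ({0<..} \<times> UNIV) (\<lambda>(r, y). (H r y)\<^sup>2)"
    using continuous_on_power[OF H_continuous, of 2] by (simp add: case_prod_unfold)
  then show "((\<lambda>p. Hx (fst p) (snd p)) \<longlongrightarrow> Hx t x) (at (t, x))"
    unfolding Hx_def
    by (intro tendsto_intros tendsto_fst_at tendsto_snd_at tendsto_jointly_continuous[OF c] F.duhamel1_tendsto) (use t in auto)
qed

text \<open>The derivative blows up like \<open>1 / \<surd>t\<close> at \<open>0\<close>, which is why the second derivative is computed after a
restart at a positive time.\<close>

lemma Hx_bound:
  assumes "0 < a" "a \<le> t" "t \<le> b"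
  shows "\<bar>Hx t x\<bar> \<le> abs_moment 1 / sqrt a + 2 * sqrt b * abs_moment 1"
proof -
  interpret F: bounded_field "\<lambda>r y. (H r y)\<^sup>2" b 1 by (rule square_field)
  have t: "0 < t" using assms by simp
  have "\<bar>exp (- t) * (heat_mom 1 t g x / sqrt t)\<bar> = exp (- t) * (\<bar>heat_mom 1 t g x\<bar> / sqrt t)"
    using t by (simp add: abs_mult abs_divide)
  also have "\<dots> \<le> 1 * (abs_moment 1 / sqrt a)"
    using heat_mom_bound[OF g_borel g_abs, of 1 t x] assms t by (intro mult_mono frac_le) auto
  finally have "\<bar>exp (- t) * (heat_mom 1 t g x / sqrt t)\<bar> \<le> abs_moment 1 / sqrt a" by simp
  moreover have "\<bar>duhamel 1 (\<lambda>r y. (H r y)\<^sup>2) t x\<bar> \<le> 2 * sqrt b * (1 * abs_moment 1)"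
    by (rule F.duhamel_bound1) (use assms in auto)
  ultimately show ?thesis unfolding Hx_def by linarith
qed

text \<open>The integral equation can be started from any later time: split the Duhamel integral at the elapsed
time \<open>t\<close> and pull the heat semigroup \<open>P\<^sub>t\<close> out of the older part.\<close>

lemma restart:
  assumes a: "0 < a"
  shows "mild_solution (H a) (\<lambda>t. H (a + t))"
proof
  fix t x :: real assume t: "0 < t"
  let ?q = "\<lambda>r y. (H r y)\<^sup>2"
  interpret F: bounded_field ?q "a + t" 1 by (rule square_field)
  interpret P: pair_sigma_finite "lborel :: real measure" \<gamma> by unfold_locales
  let ?D = "\<lambda>s z. indicator {0<..<a} s * (exp (- s) * heat_mom 0 s (?q (a - s)) (x + sqrt t * z))"
  have g1: "integrable \<gamma> (\<lambda>z. heat_mom 0 a g (x + sqrt t * z))"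
    using heat_mom_integrable[of "heat_mom 0 a g" 1 0 x t] heat_mom_bound[OF g_borel g_abs, of 0 a]
    by (simp add: heat_mom_def)
  have d: "duhamel 0 ?q a y = (\<integral>s. indicator {0<..<a} s * (exp (- s) * heat_mom 0 s (?q (a - s)) y) \<partial>lborel)" for y
    by (simp add: duhamel_def)
  have d1: "integrable \<gamma> (\<lambda>z. duhamel 0 ?q a (x + sqrt t * z))"
    using heat_mom_integrable[of "duhamel 0 ?q a" a 0 x t] F.duhamel_borel[of 0 a] F.duhamel_bound0[OF a, of ] t by auto
  have int: "integrable (lborel \<Otimes>\<^sub>M \<gamma>) (\<lambda>(s, z). ?D s z)"
  proof (rule dominated_integral(1))
    have "emeasure (lborel \<Otimes>\<^sub>M \<gamma>) ({0<..<a} \<times> UNIV) < \<infinity>"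
      using a \<gamma>.emeasure_space_1 by (subst \<gamma>.emeasure_pair_measure_Times) auto
    moreover have "{0<..<a} \<times> UNIV \<in> sets (lborel \<Otimes>\<^sub>M \<gamma>)" by auto
    ultimately have "integrable (lborel \<Otimes>\<^sub>M \<gamma>) (indicator ({0<..<a} \<times> UNIV) :: real \<times> real \<Rightarrow> real)"
      by (rule integrable_real_indicator[rotated])
    moreover have "(indicator ({0<..<a} \<times> UNIV) :: real \<times> real \<Rightarrow> real) = (\<lambda>p. indicator {0<..<a} (fst p) * 1)"
      by (auto simp: indicator_def fun_eq_iff)
    ultimately show "integrable (lborel \<Otimes>\<^sub>M \<gamma>) (\<lambda>p. indicator {0<..<a} (fst p) * (1::real))"
      by simp
    show "\<bar>case p of (s, z) \<Rightarrow> ?D s z\<bar> \<le> indicator {0<..<a} (fst p) * 1" for p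
      using F.integrand_bound0[of a "fst p" "x + sqrt t * snd p"] t by (simp add: case_prod_unfold)
    have [measurable]: "(\<lambda>(s, x). heat_mom 0 s (?q (a - s)) x) \<in> borel_measurable (borel \<Otimes>\<^sub>M borel)"
      by (rule F.duhamel_integrand_borel)
    have "(\<lambda>p. ?D (fst p) (snd p)) \<in> borel_measurable (borel \<Otimes>\<^sub>M borel)"
      by measurable
    then show "(\<lambda>(s, z). ?D s z) \<in> borel_measurable (lborel \<Otimes>\<^sub>M \<gamma>)"
      by (simp add: case_prod_unfold cong: measurable_cong_sets)
  qed
  have "heat_mom 0 t (duhamel 0 ?q a) x = (\<integral>z. (\<integral>s. ?D s z \<partial>lborel) \<partial>\<gamma>)"
    by (simp add: heat_mom_def[of 0 t] d)
  also have "\<dots> = (\<integral>s. (\<integral>z. ?D s z \<partial>\<gamma>) \<partial>lborel)"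
    using P.Fubini_integral[OF int] by simp
  also have "\<dots> = (\<integral>s. indicator {0<..<a} s * (exp (- s) * heat_mom 0 (t + s) (?q (a - s)) x) \<partial>lborel)"
  proof (rule Bochner_Integration.integral_cong[OF refl])
    fix s
    have "(\<integral>z. ?D s z \<partial>\<gamma>) = indicator {0<..<a} s * (exp (- s) * heat_mom 0 t (heat_mom 0 s (?q (a - s))) x)"
      by (simp add: heat_mom_def[of 0 t])
    also have "\<dots> = indicator {0<..<a} s * (exp (- s) * heat_mom 0 (t + s) (?q (a - s)) x)"
    proof (cases "0 < s \<and> s < a")
      case True
      then show ?thesis
        using heat_mom_semigroup[OF t, of s "?q (a - s)" 1 x] F.q_bound[of "a - s"] t by simp
    qed auto
    finally show "(\<integral>z. ?D s z \<partial>\<gamma>) = indicator {0<..<a} s * (exp (- s) * heat_mom 0 (t + s) (?q (a - s)) x)" .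
  qed
  finally have P1: "heat_mom 0 t (duhamel 0 ?q a) x =
    (\<integral>s. indicator {0<..<a} s * (exp (- s) * heat_mom 0 (t + s) (?q (a - s)) x) \<partial>lborel)" .
  let ?I = "\<lambda>A u. indicator A u * (exp (- u) * heat_mom 0 u (?q (a + t - u)) x)"
  have "exp (- t) * heat_mom 0 t (duhamel 0 ?q a) x =
    (\<integral>s. indicator {0<..<a} s * (exp (- (t + s)) * heat_mom 0 (t + s) (?q (a - s)) x) \<partial>lborel)"
    unfolding P1 by (subst integral_mult_right_zero[symmetric])
      (auto intro!: Bochner_Integration.integral_cong simp: exp_add exp_diff exp_minus field_simps)
  also have "\<dots> = (\<integral>s. ?I {t<..<a+t} (t + 1 * s) \<partial>lborel)"
    by (intro Bochner_Integration.integral_cong) (auto simp: indicator_def add.commute)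
  also have "\<dots> = (\<integral>u. ?I {t<..<a+t} u \<partial>lborel)"
    using lborel_integral_real_affine[of 1 "?I {t<..<a+t}" t] by simp
  finally have P2: "exp (- t) * heat_mom 0 t (duhamel 0 ?q a) x = (\<integral>u. ?I {t<..<a+t} u \<partial>lborel)" .
  have bI: "\<bar>?I A u\<bar> \<le> indicator {0<..<a+t} u * 1" if "A \<subseteq> {0<..<a+t}" for A u
    using F.integrand_bound0[of "a + t" u x] that by (auto simp: indicator_def split: if_splits)
  have iI: "integrable lborel (?I A)" if A: "A \<subseteq> {0<..<a+t}" and [measurable]: "A \<in> sets borel" for A
  proof -
    have [measurable]: "(\<lambda>s. heat_mom 0 s (?q (a + t - s)) x) \<in> borel_measurable borel"
      by (rule F.duhamel_integrand_borel1)
    show ?thesis by (rule dominated_integral(1)[OF integrable_indicator_Ioo _ bI[OF A]]) measurable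
  qed
  have "duhamel 0 ?q (a + t) x = (\<integral>u. ?I {0<..<a+t} u \<partial>lborel)"
    by (simp add: duhamel_def)
  also have "\<dots> = (\<integral>u. ?I {0<..<t} u + ?I {t<..<a+t} u \<partial>lborel)"
  proof (rule integral_cong_AE)
    have "AE u in lborel. u \<noteq> t" by (rule AE_lborel_singleton)
    then show "AE u in lborel. ?I {0<..<a+t} u = ?I {0<..<t} u + ?I {t<..<a+t} u"
      by eventually_elim (use a t in \<open>auto simp: indicator_def\<close>)
  qed (use iI[of "{0<..<a+t}"] iI[of "{0<..<t}"] iI[of "{t<..<a+t}"] a t in \<open>auto intro!: borel_measurable_integrable\<close>)
  also have "\<dots> = (\<integral>u. ?I {0<..<t} u \<partial>lborel) + (\<integral>u. ?I {t<..<a+t} u \<partial>lborel)"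
    by (intro Bochner_Integration.integral_add iI) (use a t in auto)
  also have "(\<integral>u. ?I {0<..<t} u \<partial>lborel) = duhamel 0 (\<lambda>r y. (H (a + r) y)\<^sup>2) t x"
    by (simp add: duhamel_def add_diff_eq)
  finally have D: "duhamel 0 ?q (a + t) x = duhamel 0 (\<lambda>r y. (H (a + r) y)\<^sup>2) t x + exp (- t) * heat_mom 0 t (duhamel 0 ?q a) x"
    unfolding P2 by simp
  have "heat_mom 0 t (H a) x = (\<integral>z. exp (- a) * heat_mom 0 a g (x + sqrt t * z) + duhamel 0 ?q a (x + sqrt t * z) \<partial>\<gamma>)"
    by (simp add: heat_mom_def[of 0 t] mild[OF a])
  also have "\<dots> = exp (- a) * heat_mom 0 t (heat_mom 0 a g) x + heat_mom 0 t (duhamel 0 ?q a) x"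
    using g1 d1 by (simp add: heat_mom_def[of 0 t])
  also have "heat_mom 0 t (heat_mom 0 a g) x = heat_mom 0 (a + t) g x"
    using heat_mom_semigroup[OF t a g_borel g_abs] by (simp add: add.commute)
  finally have G: "heat_mom 0 t (H a) x = exp (- a) * heat_mom 0 (a + t) g x + heat_mom 0 t (duhamel 0 ?q a) x" .
  show "H (a + t) x = exp (- t) * heat_mom 0 t (H a) x + duhamel 0 (\<lambda>r y. (H (a + r) y)\<^sup>2) t x"
    using mild[of "a + t" x] a t unfolding D G by (simp add: algebra_simps exp_add[symmetric] mult.assoc[symmetric])
next
  have "(\<lambda>p. (\<lambda>(t, x). H t x) (a + fst p, snd p)) \<in> borel_measurable (borel \<Otimes>\<^sub>M borel)"
    by measurable
  then show "(\<lambda>(t, x). H (a + t) x) \<in> borel_measurable (borel \<Otimes>\<^sub>M borel)"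
    by (simp add: case_prod_unfold)
qed (simp_all add: H_nonneg H_le_1 a add_pos_pos)


lemma restart_Hx:
  assumes "0 < a" "0 < t"
  shows "mild_solution.Hx (H a) (\<lambda>t. H (a + t)) t x = Hx (a + t) x"
proof -
  interpret R: mild_solution "H a" "\<lambda>t. H (a + t)" by (rule restart) fact
  show ?thesis
    by (rule DERIV_unique[OF R.Hx_deriv Hx_deriv]) (use assms in simp_all)
qed

definition Hxx :: "real \<Rightarrow> real \<Rightarrow> real" where
  "Hxx t x = deriv (Hx t) x"

text \<open>The space derivative of the nonlinearity \<open>H\<^sup>2\<close> after the restart at \<open>a\<close>. It is cut off at nonpositive
times, where nothing is known about it, so that it is measurable on the whole plane.\<close>

definition source_x :: "real \<Rightarrow> real \<Rightarrow> real \<Rightarrow> real" where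
  "source_x a r y = indicator ({0<..} \<times> UNIV) (r, y) * (2 * H (a + r) y * Hx (a + r) y)"

text \<open>The second space derivative at time \<open>a + t\<close> for the equation restarted at \<open>a\<close>: both derivatives fall
on the kernel in the initial term, and only one of them in the Duhamel integral.\<close>

definition Hxx_formula :: "real \<Rightarrow> real \<Rightarrow> real \<Rightarrow> real" where
  "Hxx_formula a t x = exp (- t) * ((heat_mom 2 t (H a) x - heat_mom 0 t (H a) x) / t) + duhamel 1 (source_x a) t x"

lemma shifted_continuous:
  fixes f :: "real \<Rightarrow> real \<Rightarrow> real" and a :: real
  assumes "continuous_on ({0<..} \<times> UNIV) (\<lambda>(t, x). f t x)" and "0 < a"
  shows "continuous_on ({0<..} \<times> UNIV) (\<lambda>(t, x). f (a + t) x)"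
proof (rule jointly_continuousI)
  fix t x :: real assume "0 < t"
  then show "((\<lambda>p. f (a + fst p) (snd p)) \<longlongrightarrow> f (a + t) x) (at (t, x))"
    using assms(2) by (intro tendsto_jointly_continuous[OF assms(1)] tendsto_intros tendsto_fst_at tendsto_snd_at) auto
qed

lemma source_x_continuous:
  assumes a: "0 < a"
  shows "continuous_on ({0<..} \<times> UNIV) (\<lambda>(r, y). 2 * H (a + r) y * Hx (a + r) y)"
    and "continuous_on ({0<..} \<times> UNIV) (\<lambda>(r, y). source_x a r y)"
proof -
  show c: "continuous_on ({0<..} \<times> UNIV) (\<lambda>(r, y). 2 * H (a + r) y * Hx (a + r) y)"
    using shifted_continuous[OF H_continuous a] shifted_continuous[OF Hx_continuous a]
    unfolding case_prod_unfold by (intro continuous_intros)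
  show "continuous_on ({0<..} \<times> UNIV) (\<lambda>(r, y). source_x a r y)"
    by (rule continuous_on_eq[OF c]) (auto simp: source_x_def)
qed

lemma source_x_field:
  assumes a: "0 < a"
  shows "bounded_field (source_x a) T (2 * (abs_moment 1 / sqrt a + 2 * sqrt (a + T) * abs_moment 1))"
proof
  have "(\<lambda>p. indicator ({0<..} \<times> UNIV) p *\<^sub>R (case p of (r, y) \<Rightarrow> 2 * H (a + r) y * Hx (a + r) y))
      \<in> borel_measurable (borel :: (real \<times> real) measure)"
    by (rule borel_measurable_continuous_on_indicator[OF _ source_x_continuous(1)[OF a]])
      (auto intro!: borel_open open_Times)
  then show "(\<lambda>(r, y). source_x a r y) \<in> borel_measurable (borel \<Otimes>\<^sub>M borel)"
    unfolding borel_prod by (simp add: source_x_def case_prod_unfold)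
  fix r y :: real assume r: "0 < r" "r < T"
  have "\<bar>source_x a r y\<bar> = 2 * (\<bar>H (a + r) y\<bar> * \<bar>Hx (a + r) y\<bar>)"
    using r by (simp add: source_x_def abs_mult)
  also have "\<dots> \<le> 2 * (1 * (abs_moment 1 / sqrt a + 2 * sqrt (a + T) * abs_moment 1))"
    using H_abs[of "a + r" y] Hx_bound[of a "a + r" "a + T" y] a r by (intro mult_left_mono mult_mono) auto
  finally show "\<bar>source_x a r y\<bar> \<le> 2 * (abs_moment 1 / sqrt a + 2 * sqrt (a + T) * abs_moment 1)" by simp
qed

lemma Hx_deriv_formula:
  assumes a: "0 < a" and t: "0 < t"
  shows "(Hx (a + t) has_real_derivative Hxx_formula a t x) (at x)"
proof -
  interpret R: mild_solution "H a" "\<lambda>t. H (a + t)" by (rule restart[OF a])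
  interpret F: bounded_field "\<lambda>r y. (H (a + r) y)\<^sup>2" t 1 by (rule R.square_field)
  have d1: "(heat_mom 1 t (H a) has_real_derivative (heat_mom 2 t (H a) x - heat_mom 0 t (H a) x) / sqrt t) (at x)"
    using heat_mom_deriv_space[OF t, of "H a" 1 1 x] H_abs[OF a] by (simp add: numeral_2_eq_2)
  have d2: "(duhamel 1 (\<lambda>r y. (H (a + r) y)\<^sup>2) t has_real_derivative duhamel 1 (source_x a) t x) (at x)"
  proof (rule F.duhamel1_deriv[OF t order.refl source_x_field[OF a]])
    fix r y :: real assume r: "0 < r"
    have "((\<lambda>y. (H (a + r) y)\<^sup>2) has_real_derivative of_nat 2 * (Hx (a + r) y * H (a + r) y ^ (2 - Suc 0))) (at y)"
      by (rule DERIV_power[OF Hx_deriv]) (use a r in auto)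
    then show "((\<lambda>y. (H (a + r) y)\<^sup>2) has_real_derivative source_x a r y) (at y)"
      using r by (simp add: source_x_def mult_ac)
  qed
  have "((\<lambda>x. exp (- t) * (heat_mom 1 t (H a) x / sqrt t) + duhamel 1 (\<lambda>r y. (H (a + r) y)\<^sup>2) t x)
      has_real_derivative exp (- t) * ((heat_mom 2 t (H a) x - heat_mom 0 t (H a) x) / sqrt t / sqrt t) + duhamel 1 (source_x a) t x) (at x)"
    by (intro DERIV_add DERIV_cmult DERIV_cdivide d1 d2)
  moreover have "(\<lambda>x. exp (- t) * (heat_mom 1 t (H a) x / sqrt t) + duhamel 1 (\<lambda>r y. (H (a + r) y)\<^sup>2) t x) = Hx (a + t)"
    using restart_Hx[OF a t] by (auto simp: R.Hx_def)
  ultimately show ?thesis using t by (simp add: Hxx_formula_def)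
qed

lemma Hxx_eq: "0 < a \<Longrightarrow> 0 < t \<Longrightarrow> Hxx (a + t) x = Hxx_formula a t x"
  unfolding Hxx_def by (rule DERIV_imp_deriv[OF Hx_deriv_formula])

lemma Hxx_deriv:
  assumes "0 < t"
  shows "(Hx t has_real_derivative Hxx t x) (at x)"
  using Hx_deriv_formula[of "t / 2" "t / 2" x] Hxx_eq[of "t / 2" "t / 2" x] assms by simp

lemma Hxx_continuous: "continuous_on ({0<..} \<times> UNIV) (\<lambda>(t, x). Hxx t x)"
proof (rule jointly_continuousI)
  fix t x :: real assume t: "0 < t"
  define a where "a = t / 2"
  have a: "0 < a" "a < t" using t by (auto simp: a_def)
  interpret F: bounded_field "source_x a" t "2 * (abs_moment 1 / sqrt a + 2 * sqrt (a + t) * abs_moment 1)"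
    by (rule source_x_field[OF a(1)])
  have c: "continuous_on ({0<..} \<times> UNIV) (\<lambda>(s, x). heat_mom j s (H a) x)" for j
    by (rule heat_mom_continuous[of _ 1]) (use a H_abs in auto)
  have "isCont (\<lambda>p. duhamel 1 (source_x a) (fst p) (snd p)) (t - a, x)"
    unfolding isCont_def
    using F.duhamel1_tendsto[OF _ _ source_x_continuous(2)[OF a(1)], of "t - a" x] a by simp
  moreover have "((\<lambda>p. (fst p - a, snd p)) \<longlongrightarrow> (t - a, x)) (at (t, x))"
    by (intro tendsto_intros tendsto_fst_at tendsto_snd_at)
  ultimately have "((\<lambda>p. duhamel 1 (source_x a) (fst (fst p - a, snd p)) (snd (fst p - a, snd p)))
      \<longlongrightarrow> duhamel 1 (source_x a) (fst (t - a, x)) (snd (t - a, x))) (at (t, x))"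
    by (rule isCont_tendsto_compose)
  then have d: "((\<lambda>p. duhamel 1 (source_x a) (fst p - a) (snd p)) \<longlongrightarrow> duhamel 1 (source_x a) (t - a) x) (at (t, x))"
    by (simp only: fst_conv snd_conv)
  have "((\<lambda>p. Hxx_formula a (fst p - a) (snd p)) \<longlongrightarrow> Hxx_formula a (t - a) x) (at (t, x))"
    unfolding Hxx_formula_def
    by (intro tendsto_intros tendsto_fst_at tendsto_snd_at tendsto_jointly_continuous[OF c] d) (use a in auto)
  then have "((\<lambda>p. Hxx (fst p) (snd p)) \<longlongrightarrow> Hxx_formula a (t - a) x) (at (t, x))"
  proof (rule Lim_transform_eventually)
    show "\<forall>\<^sub>F p in at (t, x). Hxx_formula a (fst p - a) (snd p) = Hxx (fst p) (snd p)"
      using order_tendstoD(1)[OF tendsto_fst_at a(2)]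
    proof eventually_elim
      case (elim p)
      then show ?case using Hxx_eq[of a "fst p - a" "snd p"] a by simp
    qed
  qed
  then show "((\<lambda>p. Hxx (fst p) (snd p)) \<longlongrightarrow> Hxx t x) (at (t, x))"
    using Hxx_eq[of a "t - a" x] a by simp
qed

lemma Hxx_bound:
  assumes "0 < a" "a < b"
  obtains K where "\<And>t x. a \<le> t \<Longrightarrow> t \<le> b \<Longrightarrow> \<bar>Hxx t x\<bar> \<le> K"
proof -
  define c where "c = a / 2"
  have c: "0 < c" using assms by (simp add: c_def)
  let ?S = "2 * (abs_moment 1 / sqrt c + 2 * sqrt (c + b) * abs_moment 1)"
  interpret F: bounded_field "source_x c" b ?S
    by (rule source_x_field[OF c])
  have "\<bar>Hxx t x\<bar> \<le> (abs_moment 2 + abs_moment 0) / c + 2 * sqrt b * (?S * abs_moment 1)"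
    if t: "a \<le> t" "t \<le> b" for t x
  proof -
    define r where "r = t - c"
    have r: "c \<le> r" "0 < r" "r \<le> b" using t c by (auto simp: r_def c_def)
    have m: "\<bar>heat_mom j r (H c) x\<bar> \<le> abs_moment j" for j
      using heat_mom_bound[of "H c" 1 j r x] H_abs[OF c] by simp
    have "\<bar>exp (- r) * ((heat_mom 2 r (H c) x - heat_mom 0 r (H c) x) / r)\<bar>
        = exp (- r) * (\<bar>heat_mom 2 r (H c) x - heat_mom 0 r (H c) x\<bar> / r)"
      using r by (simp add: abs_mult abs_divide)
    also have "\<dots> \<le> 1 * ((abs_moment 2 + abs_moment 0) / c)"
    proof (intro mult_mono frac_le)
      show "\<bar>heat_mom 2 r (H c) x - heat_mom 0 r (H c) x\<bar> \<le> abs_moment 2 + abs_moment 0"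
        using m[of 2] m[of 0] by linarith
    qed (use r c abs_moment_nonneg in auto)
    finally have "\<bar>exp (- r) * ((heat_mom 2 r (H c) x - heat_mom 0 r (H c) x) / r)\<bar> \<le> (abs_moment 2 + abs_moment 0) / c"
      by simp
    moreover have "\<bar>duhamel 1 (source_x c) r x\<bar> \<le> 2 * sqrt b * (?S * abs_moment 1)"
      by (rule F.duhamel_bound1) (use r in auto)
    ultimately have "\<bar>Hxx_formula c r x\<bar> \<le> (abs_moment 2 + abs_moment 0) / c + 2 * sqrt b * (?S * abs_moment 1)"
      unfolding Hxx_formula_def by linarith
    then show ?thesis using Hxx_eq[of c r x] r c by (simp add: r_def)
  qed
  then show thesis by (rule that)
qed


text \<open>The generator of the heat semigroup: the first-order Taylor term has Gaussian mean zero and the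
second-order term gives half of the second derivative. The base time \<open>b\<close> may move, which is what a
two-sided time derivative needs; joint continuity of \<open>Hxx\<close> absorbs this.\<close>

lemma gaussian_second_order_limit:
  assumes t: "0 < t" and b: "(b \<longlongrightarrow> t) F" and e: "(e \<longlongrightarrow> 0) F" "\<forall>\<^sub>F d in F. 0 < e d"
    and F: "F = at (0 :: real)"
  shows "((\<lambda>d. (heat_mom 0 (e d) (H (b d)) x - H (b d) x) / e d) \<longlongrightarrow> 1 / 2 * Hxx t x) F"
proof -
  define R where "R = (\<lambda>d z. (H (b d) (x + sqrt (e d) * z) - H (b d) x - sqrt (e d) * z * Hx (b d) x) / e d)"
  obtain K where K: "\<And>s y. t / 2 \<le> s \<Longrightarrow> s \<le> 2 * t \<Longrightarrow> \<bar>Hxx s y\<bar> \<le> K"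
    using Hxx_bound[of "t / 2" "2 * t"] t by auto
  have near: "\<forall>\<^sub>F d in F. t / 2 < b d \<and> b d < 2 * t \<and> 0 < e d"
    using order_tendstoD(1)[OF b, of "t / 2"] order_tendstoD(2)[OF b, of "2 * t"] e(2) t
    by (auto intro: eventually_conj)
  have "\<forall>d z. \<exists>\<xi>. 0 < b d \<longrightarrow> 0 < e d \<longrightarrow> \<bar>\<xi> - x\<bar> \<le> \<bar>sqrt (e d) * z\<bar> \<and> R d z = z ^ 2 / 2 * Hxx (b d) \<xi>"
  proof (intro allI)
    fix d z
    show "\<exists>\<xi>. 0 < b d \<longrightarrow> 0 < e d \<longrightarrow> \<bar>\<xi> - x\<bar> \<le> \<bar>sqrt (e d) * z\<bar> \<and> R d z = z ^ 2 / 2 * Hxx (b d) \<xi>"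
    proof (cases "0 < b d \<and> 0 < e d")
      case True
      obtain \<xi> where \<xi>: "\<bar>\<xi> - x\<bar> \<le> \<bar>sqrt (e d) * z\<bar>"
        "H (b d) (x + sqrt (e d) * z) = H (b d) x + sqrt (e d) * z * Hx (b d) x + (sqrt (e d) * z)\<^sup>2 / 2 * Hxx (b d) \<xi>"
        using taylor_second_order[of "H (b d)" "Hx (b d)" "Hxx (b d)" x "sqrt (e d) * z"]
          Hx_deriv Hxx_deriv True by blast
      have "R d z = z ^ 2 / 2 * Hxx (b d) \<xi>"
        unfolding R_def \<xi>(2) using True by (simp add: power_mult_distrib)
      then show ?thesis using \<xi>(1) by blast
    qed auto
  qed
  then obtain \<xi> where \<xi>: "\<And>d z. 0 < b d \<Longrightarrow> 0 < e d \<Longrightarrow> \<bar>\<xi> d z - x\<bar> \<le> \<bar>sqrt (e d) * z\<bar>"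
    "\<And>d z. 0 < b d \<Longrightarrow> 0 < e d \<Longrightarrow> R d z = z ^ 2 / 2 * Hxx (b d) (\<xi> d z)"
    by metis
  have lim: "((\<lambda>d. \<integral>z. R d z \<partial>\<gamma>) \<longlongrightarrow> (\<integral>z. z ^ 2 / 2 * Hxx t x \<partial>\<gamma>)) (at 0)"
  proof (rule tendsto_integral_dominated_at)
    show "integrable \<gamma> (\<lambda>z. K / 2 * \<bar>z\<bar> ^ 2)" using integrable_moment[of 2] by simp
    show "\<forall>\<^sub>F d in at 0. AE z in \<gamma>. \<bar>R d z\<bar> \<le> K / 2 * \<bar>z\<bar> ^ 2"
      using near unfolding F
    proof eventually_elim
      case (elim d)
      show ?case
      proof (rule AE_I2)
        fix z
        have "\<bar>R d z\<bar> = z\<^sup>2 / 2 * \<bar>Hxx (b d) (\<xi> d z)\<bar>"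
        proof -
          have eq: "R d z = z\<^sup>2 / 2 * Hxx (b d) (\<xi> d z)" by (rule \<xi>(2)) (use elim t in auto)
          show ?thesis unfolding eq by (simp add: abs_mult)
        qed
        also have "\<dots> \<le> z\<^sup>2 / 2 * K" using K[of "b d"] elim by (intro mult_left_mono) auto
        finally show "\<bar>R d z\<bar> \<le> K / 2 * \<bar>z\<bar> ^ 2" by (simp add: mult.commute)
      qed
    qed
    show "AE z in \<gamma>. ((\<lambda>d. R d z) \<longlongrightarrow> z ^ 2 / 2 * Hxx t x) (at 0)"
    proof (rule AE_I2)
      fix z :: real
      have "((\<lambda>d. \<xi> d z - x) \<longlongrightarrow> 0) F"
      proof (rule Lim_null_comparison)
        show "\<forall>\<^sub>F d in F. norm (\<xi> d z - x) \<le> \<bar>sqrt (e d) * z\<bar>"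
          using near by eventually_elim (use \<xi>(1) t in auto)
        have "((\<lambda>d. \<bar>sqrt (e d) * z\<bar>) \<longlongrightarrow> \<bar>sqrt 0 * z\<bar>) F" by (intro tendsto_intros e)
        then show "((\<lambda>d. \<bar>sqrt (e d) * z\<bar>) \<longlongrightarrow> 0) F" by simp
      qed
      then have "((\<lambda>d. \<xi> d z) \<longlongrightarrow> x) F" by (rule LIM_zero_cancel)
      then have "((\<lambda>d. z ^ 2 / 2 * Hxx (b d) (\<xi> d z)) \<longlongrightarrow> z ^ 2 / 2 * Hxx t x) F"
        by (intro tendsto_intros tendsto_jointly_continuous[OF Hxx_continuous t b])
      then show "((\<lambda>d. R d z) \<longlongrightarrow> z ^ 2 / 2 * Hxx t x) (at 0)"
        unfolding F
        by (rule Lim_transform_eventually)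
          (use near[unfolded F] in \<open>eventually_elim, use \<xi>(2) t in auto\<close>)
    qed
  qed (auto simp: R_def)
  have val: "(\<integral>z. z ^ 2 / 2 * Hxx t x \<partial>\<gamma>) = 1 / 2 * Hxx t x"
    using std_normal_distribution_even_moments(1)[of 1] by simp
  have ev: "\<forall>\<^sub>F d in at 0. (\<integral>z. R d z \<partial>\<gamma>) = (heat_mom 0 (e d) (H (b d)) x - H (b d) x) / e d"
    using near unfolding F
  proof eventually_elim
    case (elim d)
    have i: "integrable \<gamma> (\<lambda>z. H (b d) (x + sqrt (e d) * z))"
      using heat_mom_integrable[of "H (b d)" 1 0 x "e d"] H_abs[of "b d"] elim t by auto
    have i1: "integrable \<gamma> (\<lambda>z. z)" and z1: "(\<integral>z. z \<partial>\<gamma>) = 0"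
      using integrable_std_normal_distribution_moment[of 1] integral_std_normal_distribution_moment_odd[of 1] by auto
    have "(\<integral>z. R d z \<partial>\<gamma>) = (\<integral>z. (H (b d) (x + sqrt (e d) * z) - H (b d) x - sqrt (e d) * Hx (b d) x * z) \<partial>\<gamma>) / e d"
      unfolding R_def by (simp add: mult_ac)
    also have "(\<integral>z. (H (b d) (x + sqrt (e d) * z) - H (b d) x - sqrt (e d) * Hx (b d) x * z) \<partial>\<gamma>)
        = heat_mom 0 (e d) (H (b d)) x - H (b d) x"
      using i i1 z1 \<gamma>.prob_space by (simp add: heat_mom_def)
    finally show ?case .
  qed
  from Lim_transform_eventually[OF lim ev] show ?thesis unfolding F val .
qed

text \<open>The average of the source over a short time interval tends to its value at the end point. The
substitution \<open>s = e \<theta>\<close> fixes the domain of integration.\<close>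

lemma short_time_source_limit:
  assumes t: "0 < t" and b: "(b \<longlongrightarrow> t) F" and e: "(e \<longlongrightarrow> 0) F" "\<forall>\<^sub>F d in F. 0 < e d"
    and F: "F = at (0 :: real)"
  shows "((\<lambda>d. duhamel 0 (\<lambda>r y. (H (b d + r) y)\<^sup>2) (e d) x / e d) \<longlongrightarrow> (H t x)\<^sup>2) F"
proof -
  let ?f = "\<lambda>d \<theta>. indicator {0<..<1} \<theta> * (exp (- (e d * \<theta>)) * heat_mom 0 (e d * \<theta>) (\<lambda>y. (H (b d + (e d - e d * \<theta>)) y)\<^sup>2) x)"
  have near: "\<forall>\<^sub>F d in F. 0 < b d \<and> 0 < e d"
    using order_tendstoD(1)[OF b t] e(2) by (rule eventually_conj)
  have sub: "duhamel 0 (\<lambda>r y. (H (b d + r) y)\<^sup>2) (e d) x / e d = (\<integral>\<theta>. ?f d \<theta> \<partial>lborel)" if "0 < e d" for d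
  proof -
    have "duhamel 0 (\<lambda>r y. (H (b d + r) y)\<^sup>2) (e d) x =
      e d * (\<integral>\<theta>. indicator {0<..<e d} (e d * \<theta>) * (exp (- (e d * \<theta>)) * heat_mom 0 (e d * \<theta>) (\<lambda>y. (H (b d + (e d - e d * \<theta>)) y)\<^sup>2) x) \<partial>lborel)"
      unfolding duhamel_def using that
      by (subst lborel_integral_real_affine[where c = "e d" and t = 0]) auto
    also have "\<dots> = e d * (\<integral>\<theta>. ?f d \<theta> \<partial>lborel)"
      using that by (intro arg_cong2[where f = "(*)"] refl Bochner_Integration.integral_cong)
        (auto simp: indicator_def zero_less_mult_iff)
    finally show ?thesis using that by simp
  qed
  have lim: "((\<lambda>d. heat_mom 0 (e d * \<theta>) (\<lambda>y. (H (b d + (e d - e d * \<theta>)) y)\<^sup>2) x) \<longlongrightarrow> (H t x)\<^sup>2) (at 0)"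
    if \<theta>: "0 < \<theta>" "\<theta> < 1" for \<theta>
  proof -
    have pos: "0 < b d + (e d - e d * \<theta>)" if "0 < b d" "0 < e d" for d
    proof -
      have "e d * \<theta> \<le> e d * 1" using that \<theta> by (intro mult_left_mono) auto
      with that show ?thesis by linarith
    qed
    have "((\<lambda>d. \<integral>z. (H (b d + (e d - e d * \<theta>)) (x + sqrt (e d * \<theta>) * z))\<^sup>2 \<partial>\<gamma>) \<longlongrightarrow> (\<integral>z. (H t x)\<^sup>2 \<partial>\<gamma>)) (at 0)"
    proof (rule tendsto_integral_dominated_at)
      show "integrable \<gamma> (\<lambda>z. 1 :: real)" by simp
      show "\<forall>\<^sub>F d in at 0. AE z in \<gamma>. \<bar>(H (b d + (e d - e d * \<theta>)) (x + sqrt (e d * \<theta>) * z))\<^sup>2\<bar> \<le> 1"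
        using near unfolding F
      proof eventually_elim
        case (elim d)
        then show ?case using H_abs[OF pos[of d]] by (auto simp: abs_square_le_1)
      qed
      show "AE z in \<gamma>. ((\<lambda>d. (H (b d + (e d - e d * \<theta>)) (x + sqrt (e d * \<theta>) * z))\<^sup>2) \<longlongrightarrow> (H t x)\<^sup>2) (at 0)"
      proof (rule AE_I2)
        fix z :: real
        have "((\<lambda>d. b d + (e d - e d * \<theta>)) \<longlongrightarrow> t + (0 - 0 * \<theta>)) F"
          "((\<lambda>d. x + sqrt (e d * \<theta>) * z) \<longlongrightarrow> x + sqrt (0 * \<theta>) * z) F"
          by (intro tendsto_intros e b)+
        then show "((\<lambda>d. (H (b d + (e d - e d * \<theta>)) (x + sqrt (e d * \<theta>) * z))\<^sup>2) \<longlongrightarrow> (H t x)\<^sup>2) (at 0)"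
          unfolding F by (intro tendsto_power tendsto_jointly_continuous[OF H_continuous t]) auto
      qed
    qed auto
    then show ?thesis using \<gamma>.prob_space by (simp add: heat_mom_def)
  qed
  have gb: "\<bar>heat_mom 0 (e d * \<theta>) (\<lambda>y. (H (b d + (e d - e d * \<theta>)) y)\<^sup>2) x\<bar> \<le> 1"
    if "0 < b d" "0 < e d" "0 < \<theta>" "\<theta> < 1" for d \<theta>
  proof -
    have "e d * \<theta> \<le> e d * 1" using that by (intro mult_left_mono) auto
    with that have "0 < b d + (e d - e d * \<theta>)" by linarith
    then show ?thesis
      using heat_mom_bound[of "\<lambda>y. (H (b d + (e d - e d * \<theta>)) y)\<^sup>2" 1 0 "e d * \<theta>" x] H_abs
      by (simp add: abs_square_le_1)
  qed
  have "((\<lambda>d. \<integral>\<theta>. ?f d \<theta> \<partial>lborel) \<longlongrightarrow> (\<integral>\<theta>. indicator {0<..<1::real} \<theta> * (H t x)\<^sup>2 \<partial>lborel)) (at 0)"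
  proof (rule tendsto_integral_dominated_at)
    show "integrable lborel (\<lambda>\<theta>. indicator {0<..<1::real} \<theta> * 1 :: real)" by (rule integrable_indicator_Ioo)
    have [measurable]: "(\<lambda>\<theta>. heat_mom 0 (e d * \<theta>) (\<lambda>y. (H (b d + (e d - e d * \<theta>)) y)\<^sup>2) x) \<in> borel_measurable borel" for d
    proof -
      have "(\<lambda>\<theta>. heat_mom 0 (e d * \<theta>) (\<lambda>y. (\<lambda>(\<theta>, y). ((\<lambda>(t, x). H t x) (b d + (e d - e d * \<theta>), y))\<^sup>2) (\<theta>, y)) x) \<in> borel_measurable borel"
        by (rule heat_mom_borel) measurable
      then show ?thesis by simp
    qed
    show "\<forall>\<^sub>F d in at 0. ?f d \<in> borel_measurable lborel"
      by (rule always_eventually) (intro allI, measurable)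
    show "\<forall>\<^sub>F d in at 0. AE \<theta> in lborel. \<bar>?f d \<theta>\<bar> \<le> indicator {0<..<1} \<theta> * 1"
      using near unfolding F
    proof eventually_elim
      case (elim d)
      show ?case
      proof (rule AE_I2)
        fix \<theta> :: real
        show "\<bar>?f d \<theta>\<bar> \<le> indicator {0<..<1} \<theta> * 1"
        proof (cases "0 < \<theta> \<and> \<theta> < 1")
          case True
          then have "exp (- (e d * \<theta>)) * \<bar>heat_mom 0 (e d * \<theta>) (\<lambda>y. (H (b d + (e d - e d * \<theta>)) y)\<^sup>2) x\<bar> \<le> 1 * 1"
            using gb[of d \<theta>] elim by (intro mult_mono) auto
          then show ?thesis using True by (simp add: abs_mult)
        qed auto
      qed
    qed
    show "AE \<theta> in lborel. ((\<lambda>d. ?f d \<theta>) \<longlongrightarrow> indicator {0<..<1} \<theta> * (H t x)\<^sup>2) (at 0)"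
    proof (rule AE_I2)
      fix \<theta> :: real
      show "((\<lambda>d. ?f d \<theta>) \<longlongrightarrow> indicator {0<..<1} \<theta> * (H t x)\<^sup>2) (at 0)"
      proof (cases "0 < \<theta> \<and> \<theta> < 1")
        case True
        have "((\<lambda>d. ?f d \<theta>) \<longlongrightarrow> indicator {0<..<1} \<theta> * (exp (- (0 * \<theta>)) * (H t x)\<^sup>2)) (at 0)"
          by (intro tendsto_intros lim) (use True e F in auto)
        then show ?thesis by simp
      qed auto
    qed
  qed auto
  then have "((\<lambda>d. \<integral>\<theta>. ?f d \<theta> \<partial>lborel) \<longlongrightarrow> (H t x)\<^sup>2) F" by (simp add: F)
  then show ?thesis
    by (rule Lim_transform_eventually) (use near in \<open>eventually_elim, simp add: sub\<close>)
qed

text \<open>Both one-sided derivatives are treated at once: the increment over \<open>[t, t + d]\<close> or \<open>[t + d, t]\<close> is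
computed by restarting at the left end point \<open>b\<close> and running for the time \<open>e = \<bar>d\<bar>\<close>.\<close>

lemma H_deriv_time:
  assumes t: "0 < t"
  shows "((\<lambda>t. H t x) has_real_derivative 1 / 2 * Hxx t x - H t x + (H t x)\<^sup>2) (at t)"
proof -
  define b e where "b = (\<lambda>d. min t (t + d))" and "e = (\<lambda>d :: real. \<bar>d\<bar>)"
  have "((\<lambda>d. min t (t + d)) \<longlongrightarrow> min t (t + 0)) (at 0)" by (intro tendsto_intros)
  then have b: "(b \<longlongrightarrow> t) (at 0)" by (simp add: b_def)
  have "((\<lambda>d :: real. \<bar>d\<bar>) \<longlongrightarrow> \<bar>0\<bar>) (at 0)" by (intro tendsto_intros)
  then have e: "(e \<longlongrightarrow> 0) (at 0)" by (simp add: e_def)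
  have ep: "\<forall>\<^sub>F d in at 0. 0 < e d" by (auto simp: e_def eventually_at intro!: exI[of _ 1])
  have near: "\<forall>\<^sub>F d in at 0. 0 < b d \<and> 0 < e d"
    using order_tendstoD(1)[OF b t] ep by (rule eventually_conj)
  have "((\<lambda>u :: real. exp (- u)) has_real_derivative - 1) (at 0)" by (auto intro!: derivative_eq_intros)
  then have "((\<lambda>h :: real. (exp (- h) - 1) / h) \<longlongrightarrow> - 1) (at 0)" by (simp add: DERIV_def)
  moreover have "filterlim e (at 0) (at 0)"
    using e ep by (auto simp: filterlim_at elim: eventually_mono)
  ultimately have expq: "((\<lambda>d. (exp (- e d) - 1) / e d) \<longlongrightarrow> - 1) (at 0)"
    by (rule filterlim_compose)
  have "((\<lambda>d. exp (- e d) * ((heat_mom 0 (e d) (H (b d)) x - H (b d) x) / e d)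
      + (exp (- e d) - 1) / e d * H (b d) x + duhamel 0 (\<lambda>r y. (H (b d + r) y)\<^sup>2) (e d) x / e d)
      \<longlongrightarrow> exp (- 0) * (1 / 2 * Hxx t x) + (- 1) * H t x + (H t x)\<^sup>2) (at 0)"
    by (intro tendsto_intros e expq gaussian_second_order_limit[OF t b e ep refl]
        short_time_source_limit[OF t b e ep refl] tendsto_jointly_continuous[OF H_continuous t b])
  then have "((\<lambda>d. (H (t + d) x - H t x) / d)
      \<longlongrightarrow> exp (- 0) * (1 / 2 * Hxx t x) + (- 1) * H t x + (H t x)\<^sup>2) (at 0)"
  proof (rule Lim_transform_eventually)
    show "\<forall>\<^sub>F d in at 0. exp (- e d) * ((heat_mom 0 (e d) (H (b d)) x - H (b d) x) / e d)
      + (exp (- e d) - 1) / e d * H (b d) x + duhamel 0 (\<lambda>r y. (H (b d + r) y)\<^sup>2) (e d) x / e d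
      = (H (t + d) x - H t x) / d"
      using near
    proof eventually_elim
      case (elim d)
      interpret R: mild_solution "H (b d)" "\<lambda>r. H (b d + r)" by (rule restart) (use elim in simp)
      have "(H (t + d) x - H t x) / d = (H (b d + e d) x - H (b d) x) / e d"
        using elim by (cases "0 < d") (auto simp: b_def e_def field_simps)
      also have "H (b d + e d) x = exp (- e d) * heat_mom 0 (e d) (H (b d)) x + duhamel 0 (\<lambda>r y. (H (b d + r) y)\<^sup>2) (e d) x"
        by (rule R.mild) (use elim in simp)
      also have "(exp (- e d) * heat_mom 0 (e d) (H (b d)) x + duhamel 0 (\<lambda>r y. (H (b d + r) y)\<^sup>2) (e d) x - H (b d) x) / e d
          = exp (- e d) * ((heat_mom 0 (e d) (H (b d)) x - H (b d) x) / e d)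
            + (exp (- e d) - 1) / e d * H (b d) x + duhamel 0 (\<lambda>r y. (H (b d + r) y)\<^sup>2) (e d) x / e d"
        by (simp add: diff_divide_distrib add_divide_distrib algebra_simps)
      finally show ?case by (rule sym)
    qed
  qed
  then show ?thesis by (simp add: DERIV_def)
qed

lemma initial_value:
  assumes "isCont g x"
  shows "((\<lambda>t. H t x) \<longlongrightarrow> g x) (at_right 0)"
proof -
  have id: "((\<lambda>t. t) \<longlongrightarrow> 0) (at_right (0 :: real))" by (rule tendsto_ident_at)
  have pos: "\<forall>\<^sub>F t in at_right 0. 0 < (t :: real)" by (auto simp: eventually_at_filter)
  have "((\<lambda>t. \<integral>z. z ^ 0 * g (x + sqrt t * z) \<partial>\<gamma>) \<longlongrightarrow> (\<integral>z. g x \<partial>\<gamma>)) (at_right 0)"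
  proof (rule tendsto_integral_dominated_at)
    show "integrable \<gamma> (\<lambda>z. 1 :: real)" by simp
    show "\<forall>\<^sub>F t in at_right 0. AE z in \<gamma>. \<bar>z ^ 0 * g (x + sqrt t * z)\<bar> \<le> 1"
      using g_abs by simp
    show "AE z in \<gamma>. ((\<lambda>t. z ^ 0 * g (x + sqrt t * z)) \<longlongrightarrow> g x) (at_right 0)"
    proof (rule AE_I2)
      fix z
      have "((\<lambda>t. x + sqrt t * z) \<longlongrightarrow> x + sqrt 0 * z) (at_right 0)" by (intro tendsto_intros id)
      then have "((\<lambda>t. x + sqrt t * z) \<longlongrightarrow> x) (at_right 0)" by simp
      from isCont_tendsto_compose[OF assms this]
      show "((\<lambda>t. z ^ 0 * g (x + sqrt t * z)) \<longlongrightarrow> g x) (at_right 0)" by simp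
    qed
  qed auto
  then have G: "((\<lambda>t. heat_mom 0 t g x) \<longlongrightarrow> g x) (at_right 0)"
    using \<gamma>.prob_space by (simp add: heat_mom_def)
  have D: "((\<lambda>t. duhamel 0 (\<lambda>r y. (H r y)\<^sup>2) t x) \<longlongrightarrow> 0) (at_right 0)"
  proof (rule Lim_null_comparison[OF _ id])
    show "\<forall>\<^sub>F t in at_right 0. norm (duhamel 0 (\<lambda>r y. (H r y)\<^sup>2) t x) \<le> t"
      using pos
    proof eventually_elim
      case (elim t)
      interpret F: bounded_field "\<lambda>r y. (H r y)\<^sup>2" t 1 by (rule square_field)
      show ?case using F.duhamel_bound0[OF elim order.refl, of x] by simp
    qed
  qed
  have "((\<lambda>t. exp (- t) * heat_mom 0 t g x + duhamel 0 (\<lambda>r y. (H r y)\<^sup>2) t x) \<longlongrightarrow> exp (- 0) * g x + 0) (at_right 0)"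
    by (intro tendsto_intros id G D)
  then have "((\<lambda>t. H t x) \<longlongrightarrow> exp (- 0) * g x + 0) (at_right 0)"
    by (rule Lim_transform_eventually) (use pos in \<open>eventually_elim, simp add: mild\<close>)
  then show ?thesis by simp
qed

end

section \<open>Uniqueness for the FKPP equation\<close>

text \<open>At a negative minimum over the rectangle, which cannot lie on the parabolic boundary, the time
derivative is at most zero and the second space derivative is at least zero, contrary to the strict
inequality. That inequality is only required where \<open>z\<close> is negative, which is how a
zeroth-order term is accommodated.\<close>

lemma parabolic_minimum_principle:
  fixes z :: "real \<Rightarrow> real \<Rightarrow> real"
  assumes cont: "continuous_on ({s..T} \<times> {-R..R}) (\<lambda>(t, x). z t x)"
    and init: "\<And>x. \<bar>x\<bar> \<le> R \<Longrightarrow> 0 \<le> z s x"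
    and bdry: "\<And>t. s \<le> t \<Longrightarrow> t \<le> T \<Longrightarrow> 0 \<le> z t (- R) \<and> 0 \<le> z t R"
    and zt: "\<And>t x. s < t \<Longrightarrow> t \<le> T \<Longrightarrow> ((\<lambda>t. z t x) has_real_derivative zt t x) (at t)"
    and zx: "\<And>t x. s < t \<Longrightarrow> t \<le> T \<Longrightarrow> (z t has_real_derivative zx t x) (at x)"
    and zxx: "\<And>t x. s < t \<Longrightarrow> t \<le> T \<Longrightarrow> (zx t has_real_derivative zxx t x) (at x)"
    and super: "\<And>t x. s < t \<Longrightarrow> t \<le> T \<Longrightarrow> z t x < 0 \<Longrightarrow> 1 / 2 * zxx t x < zt t x"
    and t: "s \<le> t" "t \<le> T" and x: "\<bar>x\<bar> \<le> R"
  shows "0 \<le> z t x"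
proof (rule ccontr)
  assume neg: "\<not> 0 \<le> z t x"
  have "compact ({s..T} \<times> {-R..R})" by (intro compact_Times) auto
  moreover have "{s..T} \<times> {-R..R} \<noteq> {}" using t x by auto
  ultimately obtain p where p: "p \<in> {s..T} \<times> {-R..R}"
    "\<And>q. q \<in> {s..T} \<times> {-R..R} \<Longrightarrow> (\<lambda>(t, x). z t x) p \<le> (\<lambda>(t, x). z t x) q"
    using continuous_attains_inf[OF _ _ cont] by metis
  obtain t0 x0 where p_eq: "p = (t0, x0)" by (cases p)
  have t0: "s \<le> t0" "t0 \<le> T" and x0: "\<bar>x0\<bar> \<le> R" using p(1) by (auto simp: p_eq)
  have min: "z t0 x0 \<le> z t' x'" if "s \<le> t'" "t' \<le> T" "\<bar>x'\<bar> \<le> R" for t' x'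
    using p(2)[of "(t', x')"] that by (simp add: p_eq abs_le_iff)
  have z0: "z t0 x0 < 0" using min[OF t x] neg by simp
  have "t0 \<noteq> s" using init[OF x0] z0 by auto
  then have st: "s < t0" using t0 by simp
  have "x0 \<noteq> R" "x0 \<noteq> - R" using bdry[OF t0] z0 by auto
  then have xR: "\<bar>x0\<bar> < R" using x0 by auto
  have "zt t0 x0 \<le> 0"
  proof (rule ccontr)
    assume "\<not> zt t0 x0 \<le> 0"
    then obtain d where d: "0 < d" "\<And>h. 0 < h \<Longrightarrow> h < d \<Longrightarrow> z (t0 - h) x0 < z t0 x0"
      using DERIV_pos_inc_left[OF zt[OF st t0(2), of x0]] by auto
    define h where "h = min (d / 2) (t0 - s)"
    have "0 < h" "h < d" "h \<le> t0 - s" using d st by (auto simp: h_def min_def)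
    then show False using d(2)[of h] min[of "t0 - h" x0] t0 x0 by auto
  qed
  moreover have "0 \<le> zxx t0 x0"
  proof (rule ccontr)
    assume "\<not> 0 \<le> zxx t0 x0"
    then obtain d where d: "0 < d" "\<And>h. 0 < h \<Longrightarrow> h < d \<Longrightarrow> zx t0 (x0 + h) < zx t0 x0"
      using DERIV_neg_dec_right[OF zxx[OF st t0(2), of x0]] by auto
    have "zx t0 x0 = 0"
    proof (rule DERIV_local_min[OF zx[OF st t0(2)], of "R - \<bar>x0\<bar>"])
      show "\<forall>y. \<bar>x0 - y\<bar> < R - \<bar>x0\<bar> \<longrightarrow> z t0 x0 \<le> z t0 y"
        by (intro allI impI min) (use t0 in auto)
    qed (use xR in auto)
    define h where "h = min (d / 2) (R - \<bar>x0\<bar>)"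
    have h: "0 < h" "h < d" "h \<le> R - \<bar>x0\<bar>" using d xR by (auto simp: h_def min_def)
    obtain \<xi> where \<xi>: "x0 < \<xi>" "\<xi> < x0 + h" "z t0 (x0 + h) - z t0 x0 = (x0 + h - x0) * zx t0 \<xi>"
      using MVT2[of x0 "x0 + h" "z t0" "zx t0"] zx[OF st t0(2)] h by auto
    have "zx t0 \<xi> < 0" using d(2)[of "\<xi> - x0"] \<xi> h \<open>zx t0 x0 = 0\<close> by auto
    then have "h * zx t0 \<xi> < 0" using h by (intro mult_pos_neg)
    then have "z t0 (x0 + h) < z t0 x0" using \<xi>(3) by simp
    moreover have "\<bar>x0 + h\<bar> \<le> R" using h by linarith
    ultimately show False using min[OF t0, of "x0 + h"] by simp
  qed
  ultimately show False using super[OF st t0(2) z0] by simp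
qed

lemma heat_flow_continuous:
  assumes f: "continuous_on UNIV f" and K: "\<And>y. \<bar>f y\<bar> \<le> K"
  shows "continuous_on ({s..} \<times> UNIV) (\<lambda>(t, x). heat_mom 0 (t - s) f x)"
  unfolding continuous_on
proof clarify
  fix t x :: real assume "s \<le> t"
  let ?F = "at (t, x) within {s..} \<times> UNIV"
  have [measurable]: "f \<in> borel_measurable borel" using f by (rule borel_measurable_continuous_onI)
  have fs: "(fst \<longlongrightarrow> t) ?F" "(snd \<longlongrightarrow> x) ?F"
    using tendsto_fst[OF tendsto_ident_at, of "(t,x)"] tendsto_snd[OF tendsto_ident_at, of "(t,x)"] by (simp_all add: eta_contract_eq)
  have "((\<lambda>p. \<integral>z. z ^ 0 * f (snd p + sqrt (fst p - s) * z) \<partial>\<gamma>) \<longlongrightarrow> (\<integral>z. z ^ 0 * f (x + sqrt (t - s) * z) \<partial>\<gamma>)) ?F"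
  proof (rule tendsto_integral_dominated_at)
    show "integrable \<gamma> (\<lambda>z. K)" by simp
    show "\<forall>\<^sub>F p in ?F. AE z in \<gamma>. \<bar>z ^ 0 * f (snd p + sqrt (fst p - s) * z)\<bar> \<le> K"
      using K by simp
    show "AE z in \<gamma>. ((\<lambda>p. z ^ 0 * f (snd p + sqrt (fst p - s) * z)) \<longlongrightarrow> z ^ 0 * f (x + sqrt (t - s) * z)) ?F"
    proof (rule AE_I2)
      fix z
      have "isCont f (x + sqrt (t - s) * z)" using f by (simp add: continuous_on_eq_continuous_at)
      moreover have "((\<lambda>p. snd p + sqrt (fst p - s) * z) \<longlongrightarrow> x + sqrt (t - s) * z) ?F"
        by (intro tendsto_intros fs)
      ultimately have "((\<lambda>p. f (snd p + sqrt (fst p - s) * z)) \<longlongrightarrow> f (x + sqrt (t - s) * z)) ?F"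
        by (rule isCont_tendsto_compose)
      then show "((\<lambda>p. z ^ 0 * f (snd p + sqrt (fst p - s) * z)) \<longlongrightarrow> z ^ 0 * f (x + sqrt (t - s) * z)) ?F"
        by simp
    qed
  qed auto
  then show "((\<lambda>(t, x). heat_mom 0 (t - s) f x) \<longlongrightarrow> heat_mom 0 (t - s) f x) ?F"
    by (simp add: heat_mom_def case_prod_unfold)
qed

lemma nonneg_of_eps:
  fixes a b :: real
  assumes "\<And>e. 0 < e \<Longrightarrow> 0 \<le> a + e * b"
  shows "0 \<le> a"
proof (rule tendsto_lowerbound)
  have "((\<lambda>e. a + e * b) \<longlongrightarrow> a + 0 * b) (at_right 0)" by (intro tendsto_intros)
  then show "((\<lambda>e. a + e * b) \<longlongrightarrow> a) (at_right 0)" by simp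
  show "\<forall>\<^sub>F e in at_right 0. 0 \<le> a + e * b" using assms by (auto simp: eventually_at_filter)
qed simp

locale bounded_linear_parabolic =
  fixes d dt dx dxx c :: "real \<Rightarrow> real \<Rightarrow> real" and K C :: real
  assumes d_cont: "continuous_on ({0<..} \<times> UNIV) (\<lambda>(t, x). d t x)"
    and d_bound: "\<And>t x. 0 < t \<Longrightarrow> \<bar>d t x\<bar> \<le> K"
    and c_bound: "\<And>t x. 0 < t \<Longrightarrow> \<bar>c t x\<bar> \<le> C"
    and d_t: "\<And>t x. 0 < t \<Longrightarrow> ((\<lambda>t. d t x) has_real_derivative dt t x) (at t)"
    and d_x: "\<And>t x. 0 < t \<Longrightarrow> (d t has_real_derivative dx t x) (at x)"
    and d_xx: "\<And>t x. 0 < t \<Longrightarrow> (dx t has_real_derivative dxx t x) (at x)"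
    and pde: "\<And>t x. 0 < t \<Longrightarrow> dt t x = 1 / 2 * dxx t x + c t x * d t x"
begin

lemma slice_continuous: "0 < s \<Longrightarrow> continuous_on UNIV (d s)"
  using d_x by (meson DERIV_continuous continuous_at_imp_continuous_on)

lemma slice_borel: "0 < s \<Longrightarrow> d s \<in> borel_measurable borel"
  using slice_continuous by (rule borel_measurable_continuous_onI)

lemma K_nonneg: "0 \<le> K"
  using d_bound[of 1 0] by simp

text \<open>The heat flow of \<open>\<bar>d(s)\<bar>\<close> is compared with \<open>exp (- C (\<tau> - s)) d(\<tau>)\<close>. The exponential factor gives the
zeroth-order coefficient a sign, and the term \<open>e (y\<^sup>2 + 2 (\<tau> - s))\<close>, a strict supersolution of the heat
equation, takes care of the unbounded domain.\<close>

lemma heat_comparison: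
  assumes s: "0 < s" "s < t"
  shows "d t x \<le> exp (C * (t - s)) * heat_mom 0 (t - s) (\<lambda>y. \<bar>d s y\<bar>) x"
proof -
  define f where "f = (\<lambda>y. \<bar>d s y\<bar>)"
  have fc: "continuous_on UNIV f" unfolding f_def using slice_continuous[OF s(1)] by (rule continuous_on_rabs)
  have fm: "f \<in> borel_measurable borel" using fc by (rule borel_measurable_continuous_onI)
  have fK: "\<bar>f y\<bar> \<le> K" for y using d_bound[OF s(1)] by (simp add: f_def)
  define E where "E = (\<lambda>\<tau>. exp (- (C * (\<tau> - s))))"
  have "0 \<le> (heat_mom 0 (t - s) f x - E t * d t x) + e * (x\<^sup>2 + 2 * (t - s))" if e: "0 < e" for e
  proof -
    \<comment> \<open>so large that \<open>e y\<^sup>2\<close> dominates the bound \<open>K\<close> of \<open>d\<close> on the lateral boundary\<close>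
    define R where "R = \<bar>x\<bar> + sqrt (K / e)"
    have R: "0 \<le> R" "\<bar>x\<bar> \<le> R" using e K_nonneg by (auto simp: R_def)
    have "(sqrt (K / e))\<^sup>2 \<le> R\<^sup>2" unfolding R_def using e K_nonneg by (intro power_mono) auto
    then have eR: "K \<le> e * R\<^sup>2" using e K_nonneg by (simp add: field_simps)
    have C: "0 \<le> C" using c_bound[of 1 0] by simp
    have E1: "E \<tau> \<le> 1" if "s \<le> \<tau>" for \<tau> using that C by (simp add: E_def)
    have E0: "0 < E \<tau>" for \<tau> by (simp add: E_def)
    have g0: "0 \<le> heat_mom 0 r f y" for r y unfolding heat_mom_def by (simp add: f_def)
    let ?z = "\<lambda>\<tau> y. (heat_mom 0 (\<tau> - s) f y - E \<tau> * d \<tau> y) + e * (y\<^sup>2 + 2 * (\<tau> - s))"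
    let ?zt = "\<lambda>\<tau> y. ((heat_mom 2 (\<tau> - s) f y - heat_mom 0 (\<tau> - s) f y) / (2 * (\<tau> - s)) - (- C * E \<tau> * d \<tau> y + dt \<tau> y * E \<tau>)) + e * 2"
    let ?zx = "\<lambda>\<tau> y. (heat_mom 1 (\<tau> - s) f y / sqrt (\<tau> - s) - E \<tau> * dx \<tau> y) + e * (2 * y)"
    let ?zxx = "\<lambda>\<tau> y. ((heat_mom 2 (\<tau> - s) f y - heat_mom 0 (\<tau> - s) f y) / (\<tau> - s) - E \<tau> * dxx \<tau> y) + e * 2"
    show ?thesis
    proof (rule parabolic_minimum_principle[of s t R ?z ?zt ?zx ?zxx t x])
      have "continuous_on ({s..t} \<times> {-R..R}) (\<lambda>(t, x). heat_mom 0 (t - s) f x)"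
        by (rule continuous_on_subset[OF heat_flow_continuous[OF fc fK]]) auto
      moreover have "continuous_on ({s..t} \<times> {-R..R}) (\<lambda>(t, x). d t x)"
        by (rule continuous_on_subset[OF d_cont]) (use s in auto)
      ultimately show "continuous_on ({s..t} \<times> {-R..R}) (\<lambda>(t, x). ?z t x)"
        unfolding case_prod_unfold E_def by (intro continuous_intros)
      show "0 \<le> ?z s y" for y
      proof -
        have "heat_mom 0 0 f y = \<bar>d s y\<bar>" using \<gamma>.prob_space by (simp add: heat_mom_def f_def)
        then show ?thesis using e by (simp add: E_def)
      qed
      fix \<tau> assume "s \<le> \<tau>" "\<tau> \<le> t"
      have "0 \<le> ?z \<tau> y" if "y\<^sup>2 = R\<^sup>2" for y
      proof -
        have "E \<tau> * d \<tau> y \<le> 1 * K"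
          using E0[of \<tau>] E1[of \<tau>] d_bound[of \<tau> y] \<open>s \<le> \<tau>\<close> s K_nonneg
          by (intro order.trans[OF mult_left_mono[of "d \<tau> y" K] mult_right_mono]) auto
        moreover have "0 \<le> e * (2 * (\<tau> - s))" using e \<open>s \<le> \<tau>\<close> by simp
        ultimately show ?thesis using g0[of "\<tau> - s" y] eR that by (simp add: distrib_left)
      qed
      then show "0 \<le> ?z \<tau> (- R) \<and> 0 \<le> ?z \<tau> R" by simp
    next
      fix \<tau> y assume \<tau>: "s < \<tau>" "\<tau> \<le> t"
      then have pos: "0 < \<tau>" "0 < \<tau> - s" using s by auto
      have "((\<lambda>\<tau>. \<tau> - s) has_real_derivative 1) (at \<tau>)" by (auto intro!: derivative_eq_intros)
      from DERIV_chain2[OF heat_mom_deriv_time[OF pos(2) fm fK, of y] this]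
      have 1: "((\<lambda>\<tau>. heat_mom 0 (\<tau> - s) f y) has_real_derivative (heat_mom 2 (\<tau> - s) f y - heat_mom 0 (\<tau> - s) f y) / (2 * (\<tau> - s))) (at \<tau>)"
        by simp
      have 2: "(E has_real_derivative - C * E \<tau>) (at \<tau>)"
        unfolding E_def by (auto intro!: derivative_eq_intros)
      have 3: "((\<lambda>\<tau>. y\<^sup>2 + 2 * (\<tau> - s)) has_real_derivative 2) (at \<tau>)"
        by (auto intro!: derivative_eq_intros)
      show "((\<lambda>\<tau>. ?z \<tau> y) has_real_derivative ?zt \<tau> y) (at \<tau>)"
        by (intro DERIV_add DERIV_diff DERIV_mult[OF 2 d_t[OF pos(1)]] DERIV_cmult 1 3)
      have 4: "(heat_mom 0 (\<tau> - s) f has_real_derivative heat_mom 1 (\<tau> - s) f y / sqrt (\<tau> - s)) (at y)" for y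
        using heat_mom_deriv_space[OF pos(2) fm fK, of 0 y] by simp
      have 5: "((\<lambda>y. y\<^sup>2 + 2 * (\<tau> - s)) has_real_derivative 2 * y) (at y)"
        by (auto intro!: derivative_eq_intros)
      show "(?z \<tau> has_real_derivative ?zx \<tau> y) (at y)"
        by (intro DERIV_add DERIV_diff DERIV_cmult d_x[OF pos(1)] 4 5)
      have 6: "(heat_mom 1 (\<tau> - s) f has_real_derivative (heat_mom 2 (\<tau> - s) f y - heat_mom 0 (\<tau> - s) f y) / sqrt (\<tau> - s)) (at y)"
        using heat_mom_deriv_space[OF pos(2) fm fK, of 1 y] by (simp add: numeral_2_eq_2)
      have 7: "((\<lambda>y. 2 * y) has_real_derivative 2) (at y)"
        by (auto intro!: derivative_eq_intros)
      have "(?zx \<tau> has_real_derivative ((heat_mom 2 (\<tau> - s) f y - heat_mom 0 (\<tau> - s) f y) / sqrt (\<tau> - s) / sqrt (\<tau> - s) - E \<tau> * dxx \<tau> y) + e * 2) (at y)"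
        by (intro DERIV_add DERIV_diff DERIV_cmult DERIV_cdivide d_xx[OF pos(1)] 6 7)
      then show "(?zx \<tau> has_real_derivative ?zxx \<tau> y) (at y)" using pos by simp
      assume neg: "?z \<tau> y < 0"
      have "0 \<le> e * (y\<^sup>2 + 2 * (\<tau> - s))" using e pos by simp
      then have "0 < E \<tau> * d \<tau> y" using neg g0[of "\<tau> - s" y] by linarith
      moreover have "0 \<le> C - c \<tau> y" using c_bound[OF pos(1), of y] by simp
      ultimately have "0 \<le> (C - c \<tau> y) * (E \<tau> * d \<tau> y)" by (metis less_imp_le mult_nonneg_nonneg)
      then have "c \<tau> y * d \<tau> y * E \<tau> \<le> C * E \<tau> * d \<tau> y" by (simp add: algebra_simps)
      moreover have "dt \<tau> y * E \<tau> = E \<tau> * dxx \<tau> y / 2 + c \<tau> y * d \<tau> y * E \<tau>"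
        unfolding pde[OF pos(1)] by (simp add: algebra_simps)
      moreover have "(heat_mom 2 (\<tau> - s) f y - heat_mom 0 (\<tau> - s) f y) / (2 * (\<tau> - s)) = (heat_mom 2 (\<tau> - s) f y - heat_mom 0 (\<tau> - s) f y) / (\<tau> - s) / 2"
        by simp
      moreover have "- C * E \<tau> * d \<tau> y = - (C * E \<tau> * d \<tau> y)" by simp
      moreover have "1 / 2 * ((h - X) + e * 2) < r - (m + D) + e * 2"
        if "a \<le> b" "D = X / 2 + a" "r = h / 2" "m = - b" for h X r m D a b :: real
      proof -
        have "1 / 2 * ((h - X) + e * 2) = h / 2 - X / 2 + e" by (simp add: field_simps)
        then show ?thesis using that e by simp
      qed
      ultimately show "1 / 2 * ?zxx \<tau> y < ?zt \<tau> y" by blast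
    qed (use s R in auto)
  qed
  from nonneg_of_eps[OF this] have "E t * d t x \<le> heat_mom 0 (t - s) f x" by simp
  then have "exp (C * (t - s)) * (E t * d t x) \<le> exp (C * (t - s)) * heat_mom 0 (t - s) f x"
    by (rule mult_left_mono) simp
  then show ?thesis by (simp add: E_def f_def mult.assoc[symmetric] exp_add[symmetric])
qed

text \<open>The initial values vanish only off a single point, and not uniformly there; the
  heat kernel average of them still tends to zero.\<close>

lemma nonpositive:
  assumes init: "\<And>y. y \<noteq> 0 \<Longrightarrow> ((\<lambda>s. d s y) \<longlongrightarrow> 0) (at_right 0)" and t: "0 < t"
  shows "d t x \<le> 0"
proof -
  let ?b = "fact 0 * exp 2 * exp (1 / sqrt t) / sqrt (t / 2)"
  have near: "\<forall>\<^sub>F s in at_right 0. 0 < s \<and> s < t / 2"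
    using t by (auto simp: eventually_at_right intro!: exI[of _ "t / 2"])
  have "((\<lambda>s. \<integral>y. \<bar>d s y\<bar> * heat_ker 0 (t - s) (y - x) \<partial>lborel) \<longlongrightarrow> (\<integral>y. 0 \<partial>(lborel :: real measure))) (at_right 0)"
  proof (rule tendsto_integral_dominated_at)
    show "integrable lborel (\<lambda>y. K * (?b * exp (- \<bar>y - x\<bar> / sqrt t)))"
      using integrable_exp_neg_abs[of "sqrt t" x] t by simp
    show "\<forall>\<^sub>F s in at_right 0. (\<lambda>y. \<bar>d s y\<bar> * heat_ker 0 (t - s) (y - x)) \<in> borel_measurable lborel"
      using near
    proof eventually_elim
      case (elim s)
      then have [measurable]: "d s \<in> borel_measurable borel" using slice_borel by simp
      show ?case by measurable
    qed
    have gb: "\<bar>heat_ker 0 (t - s) (y - x)\<bar> \<le> ?b * exp (- \<bar>y - x\<bar> / sqrt t)" if "0 < s \<and> s < t / 2" for s y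
      using heat_ker_bound[of "t / 2" "t - s" t x x 0 y] that t by simp
    show "\<forall>\<^sub>F s in at_right 0. AE y in lborel. \<bar>\<bar>d s y\<bar> * heat_ker 0 (t - s) (y - x)\<bar> \<le> K * (?b * exp (- \<bar>y - x\<bar> / sqrt t))"
      using near
    proof eventually_elim
      case (elim s)
      then show ?case
        unfolding abs_mult using d_bound[of s] gb[OF elim] K_nonneg by (intro AE_I2 mult_mono) auto
    qed
    have "AE y in lborel. y \<noteq> (0 :: real)" by (rule AE_lborel_singleton)
    then show "AE y in lborel. ((\<lambda>s. \<bar>d s y\<bar> * heat_ker 0 (t - s) (y - x)) \<longlongrightarrow> 0) (at_right 0)"
    proof eventually_elim
      case (elim y)
      show ?case
      proof (rule Lim_null_comparison)
        show "\<forall>\<^sub>F s in at_right 0. norm (\<bar>d s y\<bar> * heat_ker 0 (t - s) (y - x)) \<le> \<bar>d s y\<bar> * (?b * exp (- \<bar>y - x\<bar> / sqrt t))"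
          using near
        proof eventually_elim
          case (elim s)
          show ?case
            unfolding real_norm_def abs_mult abs_idempotent by (intro mult_left_mono gb[OF elim]) simp
        qed
        have "((\<lambda>s. \<bar>d s y\<bar> * (?b * exp (- \<bar>y - x\<bar> / sqrt t))) \<longlongrightarrow> \<bar>0\<bar> * (?b * exp (- \<bar>y - x\<bar> / sqrt t))) (at_right 0)"
          by (intro tendsto_intros init elim)
        then show "((\<lambda>s. \<bar>d s y\<bar> * (?b * exp (- \<bar>y - x\<bar> / sqrt t))) \<longlongrightarrow> 0) (at_right 0)" by simp
      qed
    qed
  qed auto
  then have I: "((\<lambda>s. \<integral>y. \<bar>d s y\<bar> * heat_ker 0 (t - s) (y - x) \<partial>lborel) \<longlongrightarrow> 0) (at_right 0)" by simp
  have "((\<lambda>s. exp (C * (t - s)) * (\<integral>y. \<bar>d s y\<bar> * heat_ker 0 (t - s) (y - x) \<partial>lborel)) \<longlongrightarrow> exp (C * (t - 0)) * 0) (at_right 0)"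
    by (intro tendsto_intros I)
  then have lim: "((\<lambda>s. exp (C * (t - s)) * (\<integral>y. \<bar>d s y\<bar> * heat_ker 0 (t - s) (y - x) \<partial>lborel)) \<longlongrightarrow> 0) (at_right 0)" by simp
  show ?thesis
  proof (rule tendsto_lowerbound[OF lim])
    show "\<forall>\<^sub>F s in at_right 0. d t x \<le> exp (C * (t - s)) * (\<integral>y. \<bar>d s y\<bar> * heat_ker 0 (t - s) (y - x) \<partial>lborel)"
      using near
    proof eventually_elim
      case (elim s)
      then have [measurable]: "d s \<in> borel_measurable borel" using slice_borel by simp
      show ?case using heat_comparison[of s t x] elim t by (simp add: heat_mom_eq_heat_ker)
    qed
  qed simp
qed

end

lemma FKPP_solution_bounded:
  assumes "FKPP_solution k f w"
  obtains K where "\<And>t x. 0 < t \<Longrightarrow> \<bar>w t x\<bar> \<le> K"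
proof -
  have "bounded ((\<lambda>(t, x). w t x) ` ({0<..} \<times> UNIV))" using assms by (simp add: FKPP_solution_def)
  then obtain K where K: "\<And>y. y \<in> (\<lambda>(t, x). w t x) ` ({0<..} \<times> UNIV) \<Longrightarrow> norm y \<le> K"
    unfolding bounded_iff by blast
  have "\<bar>w t x\<bar> \<le> K" if "0 < t" for t x
    using K[OF imageI, of "(t, x)"] that by simp
  then show thesis by (rule that)
qed

lemma FKPP_solution_derivatives:
  assumes "FKPP_solution k f w"
  obtains wt wx wxx where
    "\<And>t x. 0 < t \<Longrightarrow> ((\<lambda>s. w s x) has_real_derivative wt t x) (at t)"
    "\<And>t x. 0 < t \<Longrightarrow> (w t has_real_derivative wx t x) (at x)"
    "\<And>t x. 0 < t \<Longrightarrow> (wx t has_real_derivative wxx t x) (at x)"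
    "\<And>t x. 0 < t \<Longrightarrow> wt t x = 1 / 2 * wxx t x + w t x * (1 - w t x) * k t"
    "continuous_on ({0<..} \<times> UNIV) (\<lambda>(t, x). w t x)"
proof -
  obtain wt wx wxx where *: "\<forall>t>0. \<forall>x.
           ((\<lambda>s. w s x) has_real_derivative wt t x) (at t) \<and>
           ((\<lambda>y. w t y) has_real_derivative wx t x) (at x) \<and>
           ((\<lambda>y. wx t y) has_real_derivative wxx t x) (at x) \<and>
           wt t x = 1 / 2 * wxx t x + w t x * (1 - w t x) * k t"
    "\<forall>g\<in>{w, wt, wx, wxx}. continuous_on ({0<..} \<times> UNIV) (\<lambda>(t, x). g t x)"
    using assms unfolding FKPP_solution_def by blast
  show thesis by (rule that[of wt wx wxx]; use * in blast)
qed

lemma FKPP_difference_nonpositive: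
  assumes w1: "FKPP_solution k f w1" and w2: "FKPP_solution k f w2"
    and k: "\<And>t. 0 < t \<Longrightarrow> \<bar>k t\<bar> \<le> 1" and f: "\<And>x. x \<noteq> 0 \<Longrightarrow> isCont f x" and t: "0 < t"
  shows "w1 t x - w2 t x \<le> 0"
proof -
  obtain K1 where K1: "\<And>t x. 0 < t \<Longrightarrow> \<bar>w1 t x\<bar> \<le> K1" by (rule FKPP_solution_bounded[OF w1]) blast
  obtain K2 where K2: "\<And>t x. 0 < t \<Longrightarrow> \<bar>w2 t x\<bar> \<le> K2" by (rule FKPP_solution_bounded[OF w2]) blast
  obtain t1 x1 xx1 where d1:
    "\<And>t x. 0 < t \<Longrightarrow> ((\<lambda>s. w1 s x) has_real_derivative t1 t x) (at t)"
    "\<And>t x. 0 < t \<Longrightarrow> (w1 t has_real_derivative x1 t x) (at x)"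
    "\<And>t x. 0 < t \<Longrightarrow> (x1 t has_real_derivative xx1 t x) (at x)"
    "\<And>t x. 0 < t \<Longrightarrow> t1 t x = 1 / 2 * xx1 t x + w1 t x * (1 - w1 t x) * k t"
    and c1: "continuous_on ({0<..} \<times> UNIV) (\<lambda>(t, x). w1 t x)"
    by (rule FKPP_solution_derivatives[OF w1]) blast
  obtain t2 x2 xx2 where d2:
    "\<And>t x. 0 < t \<Longrightarrow> ((\<lambda>s. w2 s x) has_real_derivative t2 t x) (at t)"
    "\<And>t x. 0 < t \<Longrightarrow> (w2 t has_real_derivative x2 t x) (at x)"
    "\<And>t x. 0 < t \<Longrightarrow> (x2 t has_real_derivative xx2 t x) (at x)"
    "\<And>t x. 0 < t \<Longrightarrow> t2 t x = 1 / 2 * xx2 t x + w2 t x * (1 - w2 t x) * k t"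
    and c2: "continuous_on ({0<..} \<times> UNIV) (\<lambda>(t, x). w2 t x)"
    by (rule FKPP_solution_derivatives[OF w2]) blast
  interpret D: bounded_linear_parabolic "\<lambda>t x. w1 t x - w2 t x" "\<lambda>t x. t1 t x - t2 t x"
    "\<lambda>t x. x1 t x - x2 t x" "\<lambda>t x. xx1 t x - xx2 t x" "\<lambda>t x. k t * (1 - w1 t x - w2 t x)"
    "K1 + K2" "1 + K1 + K2"
  proof
    show "continuous_on ({0<..} \<times> UNIV) (\<lambda>(t, x). w1 t x - w2 t x)"
      using c1 c2 unfolding case_prod_unfold by (rule continuous_on_diff)
    fix t x :: real assume t: "0 < t"
    show "\<bar>w1 t x - w2 t x\<bar> \<le> K1 + K2" using K1[OF t, of x] K2[OF t, of x] by linarith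
    have "\<bar>k t\<bar> * \<bar>1 - w1 t x - w2 t x\<bar> \<le> 1 * (1 + K1 + K2)"
      using K1[OF t, of x] K2[OF t, of x] k[OF t] by (intro mult_mono) linarith+
    then show "\<bar>k t * (1 - w1 t x - w2 t x)\<bar> \<le> 1 + K1 + K2" by (simp add: abs_mult)
    show "t1 t x - t2 t x = 1 / 2 * (xx1 t x - xx2 t x) + k t * (1 - w1 t x - w2 t x) * (w1 t x - w2 t x)"
      unfolding d1(4)[OF t] d2(4)[OF t] by (simp add: algebra_simps)
    show "((\<lambda>t. w1 t x - w2 t x) has_real_derivative t1 t x - t2 t x) (at t)"
      "((\<lambda>x. w1 t x - w2 t x) has_real_derivative x1 t x - x2 t x) (at x)"
      "((\<lambda>x. x1 t x - x2 t x) has_real_derivative xx1 t x - xx2 t x) (at x)"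
      by (intro DERIV_diff d1 d2 t)+
  qed
  show ?thesis
  proof (rule D.nonpositive[OF _ t])
    fix y :: real assume "y \<noteq> 0"
    then have "((\<lambda>s. w1 s y - w2 s y) \<longlongrightarrow> f y - f y) (at_right 0)"
      using w1 w2 f unfolding FKPP_solution_def by (intro tendsto_diff) auto
    then show "((\<lambda>s. w1 s y - w2 s y) \<longlongrightarrow> 0) (at_right 0)" by simp
  qed
qed

theorem FKPP_solution_unique:
  assumes "FKPP_solution k f w1" "FKPP_solution k f w2"
    and "\<And>t. 0 < t \<Longrightarrow> \<bar>k t\<bar> \<le> 1" "\<And>x. x \<noteq> 0 \<Longrightarrow> isCont f x" "0 < t"
  shows "w1 t x = w2 t x"
  using FKPP_difference_nonpositive[of k f w1 w2 t x] FKPP_difference_nonpositive[of k f w2 w1 t x] assms by auto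

section \<open>Independence and measurability\<close>

text \<open>Independence of two sub-sigma-algebras says that the diagonal map into the product of the two
coarser measurable spaces has a product law, so that Fubini's theorem applies to a functional that depends on one and the same
\<open>\<omega>\<close> through both sub-sigma-algebras.\<close>

lemma (in prob_space) expectation_indep_pair:
  assumes N1: "space N1 = space M" "sets N1 \<subseteq> events" and N2: "space N2 = space M" "sets N2 \<subseteq> events"
    and ind: "indep_set (sets N1) (sets N2)"
    and F[measurable]: "F \<in> borel_measurable (N1 \<Otimes>\<^sub>M N2)" and K: "\<And>p. \<bar>F p\<bar> \<le> (K :: real)"
  shows "expectation (\<lambda>\<omega>. F (\<omega>, \<omega>)) = expectation (\<lambda>\<omega>. expectation (\<lambda>\<omega>'. F (\<omega>, \<omega>')))"
proof -
  have id_eq: "(\<lambda>\<omega>. \<omega>) -` A \<inter> space M = A" if "space N = space M" "A \<in> sets N" for N :: "'a measure" and A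
    using sets.sets_into_space[OF that(2)] that(1) by auto
  have id_meas: "(\<lambda>\<omega>. \<omega>) \<in> M \<rightarrow>\<^sub>M N" if N: "space N = space M" "sets N \<subseteq> events" for N
  proof (rule measurableI)
    fix A assume "A \<in> sets N"
    then show "(\<lambda>\<omega>. \<omega>) -` A \<inter> space M \<in> events" using id_eq[OF N(1)] N(2) by auto
  qed (simp add: N)
  note m1[measurable] = id_meas[OF N1] and m2[measurable] = id_meas[OF N2]
  have gen: "sigma_sets (space M) {(\<lambda>\<omega>. \<omega>) -` A \<inter> space M |A. A \<in> sets N} = sets N"
    if N: "space N = space M" for N :: "'a measure"
  proof -
    have "{(\<lambda>\<omega>. \<omega>) -` A \<inter> space M |A. A \<in> sets N} = sets N"
    proof -
      have "{(\<lambda>\<omega>. \<omega>) -` A \<inter> space M |A. A \<in> sets N} = (\<lambda>A. (\<lambda>\<omega>. \<omega>) -` A \<inter> space M) ` sets N"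
        by (rule Setcompr_eq_image)
      also have "\<dots> = (\<lambda>A. A) ` sets N" by (rule image_cong[OF refl id_eq[OF N]])
      finally show ?thesis by simp
    qed
    then show ?thesis using sets.sigma_sets_eq[of N] N by simp
  qed
  have "indep_var N1 (\<lambda>\<omega>. \<omega>) N2 (\<lambda>\<omega>. \<omega>)"
    unfolding indep_var_eq using m1 m2 ind gen[OF N1(1)] gen[OF N2(1)] by simp
  then have eq: "distr M N1 (\<lambda>\<omega>. \<omega>) \<Otimes>\<^sub>M distr M N2 (\<lambda>\<omega>. \<omega>) = distr M (N1 \<Otimes>\<^sub>M N2) (\<lambda>\<omega>. (\<omega>, \<omega>))"
    unfolding indep_var_distribution_eq by simp
  interpret D1: prob_space "distr M N1 (\<lambda>\<omega>. \<omega>)" by (rule prob_space_distr[OF m1])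
  interpret D2: prob_space "distr M N2 (\<lambda>\<omega>. \<omega>)" by (rule prob_space_distr[OF m2])
  interpret P: pair_prob_space "distr M N1 (\<lambda>\<omega>. \<omega>)" "distr M N2 (\<lambda>\<omega>. \<omega>)" ..
  have Fm: "F \<in> borel_measurable (distr M N1 (\<lambda>\<omega>. \<omega>) \<Otimes>\<^sub>M distr M N2 (\<lambda>\<omega>. \<omega>))"
    using F by (simp cong: measurable_cong_sets)
  have int: "integrable (distr M N1 (\<lambda>\<omega>. \<omega>) \<Otimes>\<^sub>M distr M N2 (\<lambda>\<omega>. \<omega>)) F"
    by (rule P.integrable_const_bound[where B = K]) (use K Fm in auto)
  have "expectation (\<lambda>\<omega>. F (\<omega>, \<omega>)) = (\<integral>p. F p \<partial>distr M (N1 \<Otimes>\<^sub>M N2) (\<lambda>\<omega>. (\<omega>, \<omega>)))"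
    by (subst integral_distr) auto
  also have "\<dots> = (\<integral>a. (\<integral>b. F (a, b) \<partial>distr M N2 (\<lambda>\<omega>. \<omega>)) \<partial>distr M N1 (\<lambda>\<omega>. \<omega>))"
    unfolding eq[symmetric] using P.integral_fst'[OF int] by simp
  also have "\<dots> = (\<integral>a. expectation (\<lambda>b. F (a, b)) \<partial>distr M N1 (\<lambda>\<omega>. \<omega>))"
  proof (rule Bochner_Integration.integral_cong[OF refl])
    fix a assume "a \<in> space (distr M N1 (\<lambda>\<omega>. \<omega>))"
    then have a: "a \<in> space N1" by simp
    have [measurable]: "(\<lambda>b. F (a, b)) \<in> borel_measurable N2"
      using measurable_compose[OF measurable_Pair1'[OF a] F] .
    show "(\<integral>b. F (a, b) \<partial>distr M N2 (\<lambda>\<omega>. \<omega>)) = expectation (\<lambda>b. F (a, b))"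
      by (subst integral_distr) auto
  qed
  also have "\<dots> = expectation (\<lambda>\<omega>. expectation (\<lambda>\<omega>'. F (\<omega>, \<omega>')))"
  proof (subst integral_distr)
    have "(\<lambda>a. \<integral>b. F (a, b) \<partial>distr M N2 (\<lambda>\<omega>. \<omega>)) \<in> borel_measurable N1"
      using D2.borel_measurable_lebesgue_integral[of "\<lambda>a b. F (a, b)" N1] F
      by (simp add: case_prod_unfold cong: measurable_cong_sets)
    moreover have "(\<integral>b. F (a, b) \<partial>distr M N2 (\<lambda>\<omega>. \<omega>)) = expectation (\<lambda>b. F (a, b))" if a: "a \<in> space N1" for a
    proof -
      have [measurable]: "(\<lambda>b. F (a, b)) \<in> borel_measurable N2"
        using measurable_compose[OF measurable_Pair1'[OF a] F] .
      show ?thesis by (subst integral_distr) auto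
    qed
    ultimately show "(\<lambda>a. expectation (\<lambda>b. F (a, b))) \<in> borel_measurable N1"
      by (simp cong: measurable_cong)
  qed auto
  finally show ?thesis .
qed

lemma (in prob_space) indep_sets_reindex:
  assumes ind: "indep_sets F (f ` I)" and inj: "inj_on f I"
  shows "indep_sets (\<lambda>i. F (f i)) I"
  unfolding indep_sets_def
proof (intro conjI ballI allI impI)
  fix i assume "i \<in> I" then show "F (f i) \<subseteq> events" using ind by (auto simp: indep_sets_def)
next
  fix J A assume J: "J \<subseteq> I" "J \<noteq> {}" "finite J" and A: "A \<in> (\<Pi> i\<in>J. F (f i))"
  have injJ: "inj_on f J" using inj J(1) by (rule inj_on_subset)
  define A' where "A' = (\<lambda>k. A (the_inv_into J f k))"
  have A': "A' (f j) = A j" if "j \<in> J" for j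
    using the_inv_into_f_f[OF injJ that] by (simp add: A'_def)
  have "A' \<in> Pi (f ` J) F" using A A' by (auto simp: Pi_iff)
  then have "prob (\<Inter>k\<in>f ` J. A' k) = (\<Prod>k\<in>f ` J. prob (A' k))"
    using ind J unfolding indep_sets_def by (metis (no_types, lifting) finite_imageI image_is_empty image_mono)
  then show "prob (\<Inter>j\<in>J. A j) = (\<Prod>j\<in>J. prob (A j))"
    using A' by (simp add: prod.reindex[OF injJ])
qed

text \<open>The path is approximated by its values at the grid points \<open>k / (n + 1)\<close> to the left of \<open>t\<close>. The
maximum with \<open>0\<close> extends the process to negative times, where nothing is assumed about it.\<close>

lemma continuous_process_measurable:
  fixes X :: "real \<Rightarrow> 'a \<Rightarrow> real"
  assumes X: "\<And>t. 0 \<le> t \<Longrightarrow> X t \<in> borel_measurable N"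
    and c: "\<And>\<omega>. \<omega> \<in> space N \<Longrightarrow> continuous_on {0..} (\<lambda>t. X t \<omega>)"
  shows "(\<lambda>(t, \<omega>). X (max 0 t) \<omega>) \<in> borel_measurable (borel \<Otimes>\<^sub>M N)"
proof (rule borel_measurable_LIMSEQ_real)
  let ?a = "\<lambda>n t. real (nat \<lfloor>real (Suc n) * max 0 t\<rfloor>) / real (Suc n)"
  show "(\<lambda>p. X (?a n (fst p)) (snd p)) \<in> borel_measurable (borel \<Otimes>\<^sub>M N)" for n
  proof (rule measurable_compose_countable[where f = "\<lambda>k p. X (real k / real (Suc n)) (snd p)" and g = "\<lambda>p. nat \<lfloor>real (Suc n) * max 0 (fst p)\<rfloor>"])
    fix k :: nat
    have [measurable]: "X (real k / real (Suc n)) \<in> borel_measurable N" by (rule X) simp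
    show "(\<lambda>p. X (real k / real (Suc n)) (snd p)) \<in> borel_measurable (borel \<Otimes>\<^sub>M N)" by measurable
  qed measurable
  fix p :: "real \<times> 'a" assume p: "p \<in> space (borel \<Otimes>\<^sub>M N)"
  have a: "(\<lambda>n. ?a n t) \<longlonglongrightarrow> max 0 t" for t :: real
  proof (rule real_tendsto_sandwich)
    show "\<forall>\<^sub>F n in sequentially. max 0 t - 1 / real (Suc n) \<le> ?a n t"
    proof (rule always_eventually, rule allI)
      fix n
      have "real (Suc n) * max 0 t - 1 \<le> real (nat \<lfloor>real (Suc n) * max 0 t\<rfloor>)" by linarith
      then have "(real (Suc n) * max 0 t - 1) / real (Suc n) \<le> ?a n t" by (rule divide_right_mono) simp
      then show "max 0 t - 1 / real (Suc n) \<le> ?a n t" by (simp add: diff_divide_distrib)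
    qed
    show "\<forall>\<^sub>F n in sequentially. ?a n t \<le> max 0 t"
    proof (rule always_eventually, rule allI)
      fix n
      have "0 \<le> real (Suc n) * max 0 t" by simp
      then have "real (nat \<lfloor>real (Suc n) * max 0 t\<rfloor>) \<le> real (Suc n) * max 0 t" by linarith
      then have "?a n t \<le> (real (Suc n) * max 0 t) / real (Suc n)" by (rule divide_right_mono) simp
      then show "?a n t \<le> max 0 t" by simp
    qed
    show "(\<lambda>n. max 0 t - 1 / real (Suc n)) \<longlonglongrightarrow> max 0 t"
      using tendsto_diff[OF tendsto_const LIMSEQ_inverse_real_of_nat, of "max 0 t"]
      by (simp add: inverse_eq_divide)
  qed simp
  have "continuous_on {0..} (\<lambda>t. X t (snd p))" using p by (intro c) (auto simp: space_pair_measure)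
  then have "(\<lambda>n. X (?a n (fst p)) (snd p)) \<longlonglongrightarrow> X (max 0 (fst p)) (snd p)"
    by (rule continuous_on_tendsto_compose[OF _ a]) auto
  then show "(\<lambda>n. X (?a n (fst p)) (snd p)) \<longlonglongrightarrow> (case p of (t, \<omega>) \<Rightarrow> X (max 0 t) \<omega>)"
    by (simp add: case_prod_unfold)
qed

section \<open>Products over the particles of a branching tree\<close>

abbreviation subtree :: "bool \<Rightarrow> (bool list \<Rightarrow> 'b) \<Rightarrow> bool list \<Rightarrow> 'b" where
  "subtree b f \<equiv> \<lambda>u. f (b # u)"

text \<open>The product of \<open>g (x - X\<^sub>u)\<close> over the particles \<open>u\<close> alive at time \<open>t\<close>, unfolded at the first branching and with every
particle of generation \<open>n\<close> that is born by time \<open>t\<close> contributing the factor \<open>c\<close>. The recursion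
makes measurability and the expectation accessible to induction on \<open>n\<close>.\<close>

fun tree_product ::
  "(real \<Rightarrow> real) \<Rightarrow> real \<Rightarrow> nat \<Rightarrow> (bool list \<Rightarrow> 'a \<Rightarrow> real) \<Rightarrow> (bool list \<Rightarrow> real \<Rightarrow> 'a \<Rightarrow> real) \<Rightarrow>
     real \<Rightarrow> real \<Rightarrow> 'a \<Rightarrow> real" where
  "tree_product g c 0 \<tau> B t x \<omega> = c"
| "tree_product g c (Suc n) \<tau> B t x \<omega> =
     (if t < \<tau> [] \<omega> then g (x - B [] t \<omega>)
      else tree_product g c n (subtree False \<tau>) (subtree False B) (t - \<tau> [] \<omega>) (x - B [] (\<tau> [] \<omega>) \<omega>) \<omega>
         * tree_product g c n (subtree True \<tau>) (subtree True B) (t - \<tau> [] \<omega>) (x - B [] (\<tau> [] \<omega>) \<omega>) \<omega>)"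

lemma tree_product_range:
  assumes "\<And>y. 0 \<le> g y" "\<And>y. g y \<le> 1" "0 \<le> c" "c \<le> 1"
  shows "0 \<le> tree_product g c n \<tau> B t x \<omega> \<and> tree_product g c n \<tau> B t x \<omega> \<le> 1"
proof (induction n arbitrary: \<tau> B t x)
  case (Suc n)
  then show ?case using assms by (auto intro!: mult_nonneg_nonneg mult_le_one)
qed (use assms in auto)

lemma tree_product_measurable:
  fixes \<tau> :: "bool list \<Rightarrow> 'a \<Rightarrow> real"
  assumes \<tau>: "\<And>u. \<tau> u \<in> borel_measurable N" "\<And>u \<omega>. \<omega> \<in> space N \<Longrightarrow> 0 < \<tau> u \<omega>"
    and B: "\<And>u t. 0 \<le> t \<Longrightarrow> B u t \<in> borel_measurable N"
      "\<And>u \<omega>. \<omega> \<in> space N \<Longrightarrow> continuous_on {0..} (\<lambda>t. B u t \<omega>)"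
    and g[measurable]: "g \<in> borel_measurable borel"
  shows "(\<lambda>p. tree_product g c n \<tau> B (max 0 (fst (fst p))) (snd (fst p)) (snd p))
    \<in> borel_measurable ((borel \<Otimes>\<^sub>M borel) \<Otimes>\<^sub>M N)"
  using \<tau> B
proof (induction n arbitrary: \<tau> B)
  case (Suc n)
  note [measurable] = Suc.prems(1)
  let ?M = "(borel \<Otimes>\<^sub>M borel) \<Otimes>\<^sub>M N :: ((real \<times> real) \<times> 'a) measure"
  have jm: "(\<lambda>p. B [] (max 0 (a p)) (snd p)) \<in> borel_measurable ?M" if [measurable]: "a \<in> borel_measurable ?M" for a
  proof -
    have "(\<lambda>p. (a p, snd p)) \<in> ?M \<rightarrow>\<^sub>M borel \<Otimes>\<^sub>M N" by measurable
    from measurable_compose[OF this continuous_process_measurable[of "B []" N]] show ?thesis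
      using Suc.prems by simp
  qed
  let ?T = "\<lambda>p :: (real \<times> real) \<times> 'a. max 0 (fst (fst p))"
  have m1[measurable]: "(\<lambda>p. B [] (max 0 (fst (fst p))) (snd p)) \<in> borel_measurable ?M"
    by (rule jm) measurable
  have m2[measurable]: "(\<lambda>p. B [] (max 0 (\<tau> [] (snd p))) (snd p)) \<in> borel_measurable ?M"
    by (rule jm) measurable
  have sub[measurable]: "(\<lambda>p. tree_product g c n (subtree b \<tau>) (subtree b B) (max 0 (?T p - \<tau> [] (snd p)))
      (snd (fst p) - B [] (max 0 (\<tau> [] (snd p))) (snd p)) (snd p)) \<in> borel_measurable ?M" for b
  proof -
    have IH: "(\<lambda>p. tree_product g c n (subtree b \<tau>) (subtree b B) (max 0 (fst (fst p))) (snd (fst p)) (snd p))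
        \<in> borel_measurable ?M"
      by (rule Suc.IH) (use Suc.prems in auto)
    have "(\<lambda>p. ((?T p - \<tau> [] (snd p), snd (fst p) - B [] (max 0 (\<tau> [] (snd p))) (snd p)), snd p)) \<in> ?M \<rightarrow>\<^sub>M ?M"
      by measurable
    from measurable_compose[OF this IH] show ?thesis by simp
  qed
  let ?sub = "\<lambda>b p. tree_product g c n (subtree b \<tau>) (subtree b B) (max 0 (?T p - \<tau> [] (snd p)))
      (snd (fst p) - B [] (max 0 (\<tau> [] (snd p))) (snd p)) (snd p)"
  have "(\<lambda>p. if ?T p < \<tau> [] (snd p) then g (snd (fst p) - B [] (max 0 (fst (fst p))) (snd p)) else ?sub False p * ?sub True p)
      \<in> borel_measurable ?M"
    by measurable
  also have "?this \<longleftrightarrow> ?case"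
  proof (rule measurable_cong)
    fix p assume "p \<in> space ?M"
    then have "0 < \<tau> [] (snd p)" using Suc.prems(2) by (auto simp: space_pair_measure)
    then show "(if ?T p < \<tau> [] (snd p) then g (snd (fst p) - B [] (max 0 (fst (fst p))) (snd p)) else ?sub False p * ?sub True p)
      = tree_product g c (Suc n) \<tau> B (max 0 (fst (fst p))) (snd (fst p)) (snd p)"
      by (auto simp: max_absorb2)
  qed
  finally show ?case .
qed simp

lemma birth_time_Cons: "birth_time \<tau> (b # u) \<omega> = \<tau> [] \<omega> + birth_time (subtree b \<tau>) u \<omega>"
  unfolding birth_time_def by (simp add: sum.lessThan_Suc_shift del: sum.lessThan_Suc)

lemma birth_time_Nil[simp]: "birth_time \<tau> [] \<omega> = 0"
  by (simp add: birth_time_def)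

lemma birth_time_nonneg: "(\<And>u. 0 < \<tau> u \<omega>) \<Longrightarrow> 0 \<le> birth_time \<tau> u \<omega>"
  unfolding birth_time_def by (intro sum_nonneg less_imp_le)

lemma position_Cons:
  "position \<tau> B (b # u) t \<omega> =
     B [] (\<tau> [] \<omega>) \<omega> + position (subtree b \<tau>) (subtree b B) u (t - \<tau> [] \<omega>) \<omega>"
proof -
  have "birth_place \<tau> B (b # u) \<omega> = B [] (\<tau> [] \<omega>) \<omega> + birth_place (subtree b \<tau>) (subtree b B) u \<omega>"
    unfolding birth_place_def by (simp add: sum.lessThan_Suc_shift del: sum.lessThan_Suc)
  then show ?thesis by (simp add: position_def birth_time_Cons diff_diff_eq)
qed

lemma alive_before:
  assumes "\<And>u. 0 < \<tau> u \<omega>" "0 \<le> t" "t < \<tau> [] \<omega>"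
  shows "alive \<tau> t \<omega> = {[]}"
proof -
  have "u = []" if "birth_time \<tau> u \<omega> \<le> t" for u
  proof (cases u)
    case (Cons b v)
    have "0 \<le> birth_time (subtree b \<tau>) v \<omega>" by (rule birth_time_nonneg) (rule assms(1))
    then show ?thesis using that assms by (simp add: Cons birth_time_Cons)
  qed
  then show ?thesis using assms by (auto simp: alive_def)
qed

lemma alive_after:
  assumes "\<tau> [] \<omega> \<le> t"
  shows "alive \<tau> t \<omega> = (#) False ` alive (subtree False \<tau>) (t - \<tau> [] \<omega>) \<omega>
    \<union> (#) True ` alive (subtree True \<tau>) (t - \<tau> [] \<omega>) \<omega>"
proof (intro equalityI subsetI)
  fix u assume u: "u \<in> alive \<tau> t \<omega>"
  then obtain b v where "u = b # v" using assms by (cases u) (auto simp: alive_def)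
  then show "u \<in> (#) False ` alive (subtree False \<tau>) (t - \<tau> [] \<omega>) \<omega>
    \<union> (#) True ` alive (subtree True \<tau>) (t - \<tau> [] \<omega>) \<omega>"
    using u by (cases b) (auto simp: alive_def birth_time_Cons)
qed (auto simp: alive_def birth_time_Cons)

lemma tree_product_eq_prod:
  assumes "\<And>u. 0 < \<tau> u \<omega>" "0 \<le> t" "\<And>u. birth_time \<tau> u \<omega> \<le> t \<Longrightarrow> length u < n"
  shows "finite (alive \<tau> t \<omega>) \<and> alive \<tau> t \<omega> \<noteq> {} \<and>
    tree_product g c n \<tau> B t x \<omega> = (\<Prod>u\<in>alive \<tau> t \<omega>. g (x - position \<tau> B u t \<omega>))"
  using assms
proof (induction n arbitrary: \<tau> B t x)
  case 0
  then show ?case using 0(3)[of "[]"] by simp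
next
  case (Suc n)
  show ?case
  proof (cases "t < \<tau> [] \<omega>")
    case True
    then show ?thesis using alive_before[of \<tau> \<omega> t] Suc.prems by (simp add: position_def birth_place_def)
  next
    case False
    let ?t = "t - \<tau> [] \<omega>" and ?x = "x - B [] (\<tau> [] \<omega>) \<omega>"
    have IH: "finite (alive (subtree b \<tau>) ?t \<omega>) \<and> alive (subtree b \<tau>) ?t \<omega> \<noteq> {} \<and>
      tree_product g c n (subtree b \<tau>) (subtree b B) ?t ?x \<omega>
        = (\<Prod>u\<in>alive (subtree b \<tau>) ?t \<omega>. g (?x - position (subtree b \<tau>) (subtree b B) u ?t \<omega>))" for b
    proof (rule Suc.IH)
      show "length u < n" if "birth_time (subtree b \<tau>) u \<omega> \<le> ?t" for u
        using Suc.prems(3)[of "b # u"] that by (simp add: birth_time_Cons)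
    qed (use Suc.prems False in auto)
    have al: "alive \<tau> t \<omega> = (#) False ` alive (subtree False \<tau>) ?t \<omega> \<union> (#) True ` alive (subtree True \<tau>) ?t \<omega>"
      by (rule alive_after) (use False in simp)
    have pr: "(\<Prod>u\<in>(#) b ` alive (subtree b \<tau>) ?t \<omega>. g (x - position \<tau> B u t \<omega>))
      = tree_product g c n (subtree b \<tau>) (subtree b B) ?t ?x \<omega>" for b
      using IH[of b] by (subst prod.reindex) (auto simp: position_Cons diff_diff_eq inj_on_def)
    have "(\<Prod>u\<in>alive \<tau> t \<omega>. g (x - position \<tau> B u t \<omega>)) =
      (\<Prod>u\<in>(#) False ` alive (subtree False \<tau>) ?t \<omega>. g (x - position \<tau> B u t \<omega>)) *
      (\<Prod>u\<in>(#) True ` alive (subtree True \<tau>) ?t \<omega>. g (x - position \<tau> B u t \<omega>))"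
      unfolding al by (rule prod.union_disjoint) (use IH in auto)
    then show ?thesis using IH False by (simp add: al pr)
  qed
qed

text \<open>With the weight \<open>1\<close> and the cut-off value \<open>0\<close> the product indicates that generation \<open>n\<close> has not been
reached, so that nonexplosion can be read off the general recursion for expectations.\<close>

lemma tree_product_generation:
  assumes "\<And>u. 0 < \<tau> u \<omega>" "0 \<le> t"
  shows "tree_product (\<lambda>_. 1) 0 n \<tau> B t x \<omega> = of_bool (\<forall>u. birth_time \<tau> u \<omega> \<le> t \<longrightarrow> length u < n)"
  using assms
proof (induction n arbitrary: \<tau> B t x)
  case 0
  then show ?case by (auto intro: exI[of _ "[]"])
next
  case (Suc n)
  show ?case
  proof (cases "t < \<tau> [] \<omega>")
    case True
    have "u = []" if "birth_time \<tau> u \<omega> \<le> t" for u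
    proof (cases u)
      case (Cons b v)
      have "0 \<le> birth_time (subtree b \<tau>) v \<omega>" by (rule birth_time_nonneg) (rule Suc.prems(1))
      then show ?thesis using that True by (simp add: Cons birth_time_Cons)
    qed
    then have "\<forall>u. birth_time \<tau> u \<omega> \<le> t \<longrightarrow> length u < Suc n" by (metis list.size(3) zero_less_Suc)
    then show ?thesis using True by simp
  next
    case False
    have "(\<forall>u. birth_time \<tau> u \<omega> \<le> t \<longrightarrow> length u < Suc n) \<longleftrightarrow>
      (\<forall>b u. birth_time (subtree b \<tau>) u \<omega> \<le> t - \<tau> [] \<omega> \<longrightarrow> length u < n)"
    proof (intro iffI allI impI)
      fix b u assume "\<forall>u. birth_time \<tau> u \<omega> \<le> t \<longrightarrow> length u < Suc n" "birth_time (subtree b \<tau>) u \<omega> \<le> t - \<tau> [] \<omega>"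
      then show "length u < n" by (auto simp: birth_time_Cons dest!: spec[of _ "b # u"])
    next
      fix u assume a: "\<forall>b u. birth_time (subtree b \<tau>) u \<omega> \<le> t - \<tau> [] \<omega> \<longrightarrow> length u < n" "birth_time \<tau> u \<omega> \<le> t"
      show "length u < Suc n"
      proof (cases u)
        case (Cons b v)
        then show ?thesis using a(1)[rule_format, of b v] a(2) by (simp add: birth_time_Cons)
      qed simp
    qed
    then have eq: "(\<forall>u. birth_time \<tau> u \<omega> \<le> t \<longrightarrow> length u < Suc n) \<longleftrightarrow>
      (\<forall>u. birth_time (subtree False \<tau>) u \<omega> \<le> t - \<tau> [] \<omega> \<longrightarrow> length u < n) \<and>
      (\<forall>u. birth_time (subtree True \<tau>) u \<omega> \<le> t - \<tau> [] \<omega> \<longrightarrow> length u < n)"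
      unfolding all_bool_eq by blast
    have IH: "tree_product (\<lambda>_. 1) 0 n (subtree b \<tau>) (subtree b B) (t - \<tau> [] \<omega>) (x - B [] (\<tau> [] \<omega>) \<omega>) \<omega>
        = of_bool (\<forall>u. birth_time (subtree b \<tau>) u \<omega> \<le> t - \<tau> [] \<omega> \<longrightarrow> length u < n)" for b
      by (rule Suc.IH) (use Suc.prems False in auto)
    show ?thesis unfolding tree_product.simps IH eq using False by simp
  qed
qed

lemma gaussian_reflect:
  assumes [measurable]: "f \<in> borel_measurable borel"
  shows "(\<integral>z. f (- z) \<partial>\<gamma>) = (\<integral>z. f z \<partial>\<gamma> :: real)"
proof -
  have "(\<integral>z. f (- z) \<partial>\<gamma>) = (\<integral>z. std_normal_density z * f (- z) \<partial>lborel)"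
    by (subst integral_density) (auto simp: normal_density_nonneg)
  also have "\<dots> = (\<integral>z. std_normal_density (0 + - 1 * z) * f (- (0 + - 1 * z)) \<partial>lborel)"
    by (subst lborel_integral_real_affine[where c = "- 1" and t = 0]) auto
  also have "\<dots> = (\<integral>z. std_normal_density z * f z \<partial>lborel)"
    by (simp add: std_normal_density_def)
  also have "\<dots> = (\<integral>z. f z \<partial>\<gamma>)"
    by (subst integral_density) (auto simp: normal_density_nonneg)
  finally show ?thesis .
qed

text \<open>Needed to keep the iterates of the integral equation jointly measurable.\<close>

lemma duhamel_joint_borel:
  assumes q: "(\<lambda>(r, y). q r y) \<in> borel_measurable (borel \<Otimes>\<^sub>M borel)"
  shows "(\<lambda>(t, x). duhamel j q t x) \<in> borel_measurable (borel \<Otimes>\<^sub>M borel)"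
proof -
  let ?N = "(borel \<Otimes>\<^sub>M borel) \<Otimes>\<^sub>M borel :: ((real \<times> real) \<times> real) measure"
  have [measurable]: "(\<lambda>p. heat_mom j (snd p) (q (fst (fst p) - snd p)) (snd (fst p))) \<in> borel_measurable ?N"
  proof -
    have "(\<lambda>(p, y). (\<lambda>(r, y). q r y) (fst (fst p) - snd p, y)) \<in> borel_measurable (?N \<Otimes>\<^sub>M borel)"
      using q by measurable
    then have "(\<lambda>p. heat_mom j (snd p) (\<lambda>y. (\<lambda>(p, y). (\<lambda>(r, y). q r y) (fst (fst p) - snd p, y)) (p, y)) (snd (fst p))) \<in> borel_measurable ?N"
      by (rule heat_mom_borel) measurable
    then show ?thesis by (simp add: eta_contract_eq)
  qed
  have "(\<lambda>p. \<integral>s. (if 0 < s \<and> s < fst p then 1 else 0) * (exp (- s) / sqrt s ^ j * heat_mom j s (q (fst p - s)) (snd p)) \<partial>lborel)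
      \<in> borel_measurable (borel \<Otimes>\<^sub>M borel)"
  proof (rule lborel.borel_measurable_lebesgue_integral)
    have "(\<lambda>p. (if 0 < snd p \<and> snd p < fst (fst p) then 1 else 0) *
        (exp (- snd p) / sqrt (snd p) ^ j * heat_mom j (snd p) (q (fst (fst p) - snd p)) (snd (fst p)))) \<in> borel_measurable ?N"
      by measurable
    then show "(\<lambda>(p, s). (if 0 < s \<and> s < fst p then 1 else 0) *
        (exp (- s) / sqrt s ^ j * heat_mom j s (q (fst p - s)) (snd p))) \<in> borel_measurable ((borel \<Otimes>\<^sub>M borel) \<Otimes>\<^sub>M lborel)"
      by (simp add: case_prod_unfold cong: measurable_cong_sets)
  qed
  also have "(\<lambda>p. \<integral>s. (if 0 < s \<and> s < fst p then 1 else 0) * (exp (- s) / sqrt s ^ j * heat_mom j s (q (fst p - s)) (snd p)) \<partial>lborel)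
    = (\<lambda>(t, x). duhamel j q t x)"
    unfolding duhamel_def case_prod_unfold
    by (intro ext Bochner_Integration.integral_cong) (auto simp: indicator_def)
  finally show ?thesis .
qed

section \<open>The law of the product: decomposition at the first branching\<close>

text \<open>The iterates of the integral equation, started from the constant \<open>c\<close>. They do not refer to the
branching process, which is why the expected product turns out to be the same for all subtrees.\<close>

fun tree_mean :: "(real \<Rightarrow> real) \<Rightarrow> real \<Rightarrow> nat \<Rightarrow> real \<Rightarrow> real \<Rightarrow> real" where
  "tree_mean g c 0 t x = c"
| "tree_mean g c (Suc n) t x =
     exp (- t) * heat_mom 0 t g x + duhamel 0 (\<lambda>r y. (tree_mean g c n r y)\<^sup>2) t x"

lemma tree_mean_borel:
  assumes [measurable]: "g \<in> borel_measurable borel"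
  shows "(\<lambda>(t, x). tree_mean g c n t x) \<in> borel_measurable (borel \<Otimes>\<^sub>M borel)"
proof (induction n)
  case (Suc n)
  have "(\<lambda>(r, y). (tree_mean g c n r y)\<^sup>2) \<in> borel_measurable (borel \<Otimes>\<^sub>M borel)"
    using borel_measurable_power[OF Suc.IH, of 2] by (simp add: case_prod_unfold)
  note [measurable] = duhamel_joint_borel[OF this, of 0]
  have "(\<lambda>p. heat_mom 0 (fst p) (\<lambda>y. (\<lambda>p. g (snd p)) (p, y)) (snd p)) \<in> borel_measurable (borel \<Otimes>\<^sub>M borel)"
    by (rule heat_mom_borel) measurable
  then have [measurable]: "(\<lambda>p. heat_mom 0 (fst p) g (snd p)) \<in> borel_measurable (borel \<Otimes>\<^sub>M borel)"
    by (simp add: eta_contract_eq)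
  have "(\<lambda>p. exp (- fst p) * heat_mom 0 (fst p) g (snd p) + (\<lambda>(t, x). duhamel 0 (\<lambda>r y. (tree_mean g c n r y)\<^sup>2) t x) p)
      \<in> borel_measurable (borel \<Otimes>\<^sub>M borel)"
    by measurable
  then show ?case by (simp add: case_prod_unfold)
qed simp

lemma measurable_ident_coarser:
  assumes "space N = space M" "sets N \<subseteq> sets M"
  shows "(\<lambda>\<omega>. \<omega>) \<in> M \<rightarrow>\<^sub>M N"
proof (rule measurableI)
  fix A assume A: "A \<in> sets N"
  then have "(\<lambda>\<omega>. \<omega>) -` A \<inter> space M = A" using sets.sets_into_space[OF A] assms(1) by auto
  then show "(\<lambda>\<omega>. \<omega>) -` A \<inter> space M \<in> sets M" using A assms(2) by auto
qed (simp add: assms)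

context binary_BBM
begin

definition node_events :: "bool list + bool list \<Rightarrow> 'a set set" where
  "node_events i = (case i of
     Inl u \<Rightarrow> sigma_sets (space M) {\<tau> u -` A \<inter> space M | A. A \<in> sets borel}
   | Inr u \<Rightarrow> sigma_sets (space M) {B u t -` A \<inter> space M | t A. 0 \<le> t \<and> A \<in> sets borel})"

text \<open>The sigma-algebra generated by the lifetimes (left summands) and the motions (right summands) of the
labels in \<open>I\<close>.\<close>

definition info :: "(bool list + bool list) set \<Rightarrow> 'a measure" where
  "info I = sigma (space M) (\<Union>i\<in>I. node_events i)"

lemma indep_nodes: "indep_sets node_events UNIV"
  using independent by (simp add: node_events_def[abs_def])

lemma node_events_subset: "node_events i \<subseteq> events"
  using indep_nodes by (auto simp: indep_sets_def)

lemma space_info[simp]: "space (info I) = space M"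
  by (simp add: info_def space_measure_of_conv)

lemma sets_info: "sets (info I) = sigma_sets (space M) (\<Union>i\<in>I. node_events i)"
  unfolding info_def using node_events_subset sets.sets_into_space by (intro sets_measure_of) blast

lemma sets_info_events: "sets (info I) \<subseteq> events"
  unfolding sets_info using node_events_subset by (intro sets.sigma_sets_subset) blast

lemma node_events_info: "i \<in> I \<Longrightarrow> node_events i \<subseteq> sets (info I)"
  unfolding sets_info by (auto intro: sigma_sets.Basic)

lemma info_indep:
  assumes "I \<inter> J = {}"
  shows "indep_set (sets (info I)) (sets (info J))"
proof -
  have "indep_sets (\<lambda>b. sigma_sets (space M) (\<Union>i\<in>case_bool I J b. node_events i)) UNIV"
  proof (rule indep_sets_collect_sigma)
    show "indep_sets node_events (\<Union>b\<in>UNIV. case_bool I J b)"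
      using indep_nodes by (rule indep_sets_mono_index[rotated]) simp
    show "Int_stable (node_events i)" for i
    proof -
      have "sigma_algebra (space M) (node_events i)"
        unfolding node_events_def by (cases i) (auto intro!: sigma_algebra_sigma_sets)
      then interpret S: sigma_algebra "space M" "node_events i" .
      show ?thesis by (auto simp: Int_stable_def)
    qed
    show "disjoint_family_on (case_bool I J) UNIV"
      using assms by (auto simp: disjoint_family_on_def split: bool.split)
  qed
  then show ?thesis
    unfolding indep_set_def
    by (rule indep_sets_cong[THEN iffD1, rotated 2]) (auto simp: sets_info split: bool.split)
qed

lemma lifetime_info: "Inl u \<in> I \<Longrightarrow> \<tau> u \<in> borel_measurable (info I)"
proof (rule measurableI)
  fix A :: "real set" assume "Inl u \<in> I" "A \<in> sets borel"
  then show "\<tau> u -` A \<inter> space (info I) \<in> sets (info I)"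
    using node_events_info[of "Inl u" I] by (auto simp: node_events_def intro!: sigma_sets.Basic)
qed simp

lemma motion_info: "Inr u \<in> I \<Longrightarrow> 0 \<le> t \<Longrightarrow> B u t \<in> borel_measurable (info I)"
proof (rule measurableI)
  fix A :: "real set" assume "Inr u \<in> I" "0 \<le> t" "A \<in> sets borel"
  then have "B u t -` A \<inter> space M \<in> node_events (Inr u)"
    unfolding node_events_def by (auto intro!: sigma_sets.Basic)
  then show "B u t -` A \<inter> space (info I) \<in> sets (info I)"
    using node_events_info[of "Inr u" I] \<open>Inr u \<in> I\<close> by auto
qed simp

lemma motion_continuous: "\<omega> \<in> space M \<Longrightarrow> continuous_on {0..} (\<lambda>t. B u t \<omega>)"
  and motion_start: "\<omega> \<in> space M \<Longrightarrow> B u 0 \<omega> = 0"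
  using motion_BM[of u] by (auto simp: standard_BM_def)

lemma motion_expectation:
  assumes t: "0 < t" and [measurable]: "h \<in> borel_measurable borel"
  shows "expectation (\<lambda>\<omega>. h (x - B u t \<omega>)) = heat_mom 0 t h x"
proof -
  have "distributed M lborel (\<lambda>\<omega>. B u t \<omega> - B u 0 \<omega>) (normal_density 0 (sqrt (t - 0)))"
    using motion_BM[of u] t unfolding standard_BM_def by blast
  then have D: "distributed M lborel (\<lambda>\<omega>. B u t \<omega> - B u 0 \<omega>) (normal_density 0 (sqrt t))" by simp
  have "expectation (\<lambda>\<omega>. h (x - B u t \<omega>)) = expectation (\<lambda>\<omega>. h (x - (B u t \<omega> - B u 0 \<omega>)))"
    by (rule Bochner_Integration.integral_cong) (simp_all add: motion_start)
  also have "\<dots> = (\<integral>z. h (x - sqrt t * z) \<partial>\<gamma>)"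
    by (rule normal_expectation[OF D, of "\<lambda>y. h (x - y)"]) (use t in auto)
  also have "\<dots> = (\<integral>z. h (x + sqrt t * z) \<partial>\<gamma>)"
    using gaussian_reflect[of "\<lambda>z. h (x + sqrt t * z)"] by simp
  finally show ?thesis by (simp add: heat_mom_def)
qed

lemma shifted: "binary_BBM M (subtree b \<tau>) (subtree b B)"
proof
  let ?f = "map_sum ((#) b) ((#) b)"
  have "inj ?f" by (rule sum.inj_map) (auto simp: inj_def)
  then have "indep_sets (\<lambda>i. node_events (?f i)) UNIV"
    by (rule indep_sets_reindex[OF indep_sets_mono_index[OF subset_UNIV indep_nodes]])
  also have "(\<lambda>i. node_events (?f i)) = (\<lambda>i. case i of
            Inl u \<Rightarrow> sigma_sets (space M) {\<tau> (b # u) -` A \<inter> space M | A. A \<in> sets borel}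
          | Inr u \<Rightarrow> sigma_sets (space M) {B (b # u) t -` A \<inter> space M | t A. 0 \<le> t \<and> A \<in> sets borel})"
  proof (rule ext)
    fix i show "node_events (?f i) = (case i of
            Inl u \<Rightarrow> sigma_sets (space M) {\<tau> (b # u) -` A \<inter> space M | A. A \<in> sets borel}
          | Inr u \<Rightarrow> sigma_sets (space M) {B (b # u) t -` A \<inter> space M | t A. 0 \<le> t \<and> A \<in> sets borel})"
      by (cases i) (simp_all add: node_events_def)
  qed
  finally show "indep_sets (\<lambda>i. case i of
            Inl u \<Rightarrow> sigma_sets (space M) {\<tau> (b # u) -` A \<inter> space M | A. A \<in> sets borel}
          | Inr u \<Rightarrow> sigma_sets (space M) {B (b # u) t -` A \<inter> space M | t A. 0 \<le> t \<and> A \<in> sets borel}) UNIV" .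
qed (simp_all add: lifetime_pos lifetime_exponential motion_BM)

lemma lifetime_tail: "0 \<le> t \<Longrightarrow> (\<integral>s. exponential_density 1 s * indicator {t<..} s \<partial>lborel) = exp (- t)"
proof -
  assume t: "0 \<le> t"
  have "(\<integral>s. exponential_density 1 s * indicator {t<..} s \<partial>lborel) = expectation (\<lambda>\<omega>. indicator {t<..} (\<tau> [] \<omega>))"
    by (rule distributed_integral[OF lifetime_exponential]) (auto simp: exponential_density_nonneg)
  also have "\<dots> = expectation (indicator {\<omega> \<in> space M. t < \<tau> [] \<omega>})"
    by (rule Bochner_Integration.integral_cong) (auto simp: indicator_def)
  also have "\<dots> = prob {\<omega> \<in> space M. t < \<tau> [] \<omega>}"
    by (subst Bochner_Integration.integral_indicator) (simp add: Int_absorb2)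
  also have "\<dots> = exp (- t * 1)"
    by (rule exponential_distributedD_gt[OF lifetime_exponential t]) simp
  finally show ?thesis by simp
qed

lemma motion_eval_measurable:
  assumes "Inr u \<in> I" "a \<in> borel_measurable Q" "w \<in> Q \<rightarrow>\<^sub>M info I"
  shows "(\<lambda>p. B u (max 0 (a p)) (w p)) \<in> borel_measurable Q"
proof -
  have "(\<lambda>(t, \<omega>). B u (max 0 t) \<omega>) \<in> borel_measurable (borel \<Otimes>\<^sub>M info I)"
    by (rule continuous_process_measurable) (simp_all add: assms motion_info motion_continuous)
  from measurable_compose[OF measurable_Pair[OF assms(2,3)] this] show ?thesis by simp
qed

lemma tree_product_info:
  assumes [measurable]: "g \<in> borel_measurable borel"
    and I: "\<And>u. Inl (b # u) \<in> I" "\<And>u. Inr (b # u) \<in> I"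
  shows "(\<lambda>p. tree_product g c n (subtree b \<tau>) (subtree b B) (max 0 (fst (fst p))) (snd (fst p)) (snd p))
    \<in> borel_measurable ((borel \<Otimes>\<^sub>M borel) \<Otimes>\<^sub>M info I)"
  by (rule tree_product_measurable)
    (simp_all add: I lifetime_info motion_info motion_continuous lifetime_pos)

text \<open>Three applications of independence: the two subtrees against each other, both subtrees against the
initial particle, and the lifetime of the initial particle against its motion.\<close>

lemma expectation_first_branching:
  assumes g[measurable]: "g \<in> borel_measurable borel" and g01: "\<And>y. 0 \<le> g y" "\<And>y. g y \<le> 1"
    and c01: "0 \<le> c" "c \<le> 1" and t: "0 < t"
    and m[measurable]: "(\<lambda>(r, y). m r y) \<in> borel_measurable (borel \<Otimes>\<^sub>M borel)"
    and IH: "\<And>b r y. 0 < r \<Longrightarrow>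
      expectation (tree_product g c n (subtree b \<tau>) (subtree b B) r y) = m r y"
  shows "expectation (tree_product g c (Suc n) \<tau> B t x) =
    exp (- t) * heat_mom 0 t g x + duhamel 0 (\<lambda>r y. (m r y)\<^sup>2) t x"
proof -
  define Y where "Y = (\<lambda>b r y. tree_product g c n (subtree b \<tau>) (subtree b B) (max 0 r) y)"
  define S where "S = (\<lambda>b. range (\<lambda>u. Inl (b # u)) \<union> range (\<lambda>u. Inr (b # u)) :: (bool list + bool list) set)"
  have Y01: "0 \<le> Y b r y \<omega>" "Y b r y \<omega> \<le> 1" for b r y \<omega>
    unfolding Y_def by (simp_all add: tree_product_range[of g c] g01 c01)
  have Ym: "(\<lambda>p. Y b (fst (fst p)) (snd (fst p)) (snd p)) \<in> borel_measurable ((borel \<Otimes>\<^sub>M borel) \<Otimes>\<^sub>M info I)"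
    if "S b \<subseteq> I" for b I
    unfolding Y_def by (rule tree_product_info) (use that in \<open>auto simp: S_def\<close>)
  have Yslice: "Y b r y \<in> borel_measurable (info I)" if "S b \<subseteq> I" for b r y I
    using measurable_compose[OF measurable_Pair1'[of "(r, y)" "borel \<Otimes>\<^sub>M borel" "info I"] Ym[OF that]]
    by (simp add: space_pair_measure)
  define mm where "mm = (\<lambda>r y. expectation (Y False r y) * expectation (Y True r y))"
  have YM: "(\<lambda>p. Y b (fst (fst p)) (snd (fst p)) (snd p)) \<in> borel_measurable ((borel \<Otimes>\<^sub>M borel) \<Otimes>\<^sub>M M)" for b
  proof -
    have "(\<lambda>\<omega>. \<omega>) \<in> M \<rightarrow>\<^sub>M info (S b)"
      by (rule measurable_ident_coarser) (use sets_info_events in auto)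
    then have "(\<lambda>p. (fst p, snd p)) \<in> (borel \<Otimes>\<^sub>M borel) \<Otimes>\<^sub>M M \<rightarrow>\<^sub>M (borel \<Otimes>\<^sub>M borel) \<Otimes>\<^sub>M info (S b)"
      by (intro measurable_Pair measurable_compose[OF measurable_snd]) auto
    from measurable_compose[OF this Ym[of b "S b"]] show ?thesis by simp
  qed
  have EY[measurable]: "(\<lambda>p. expectation (Y b (fst p) (snd p))) \<in> borel_measurable (borel \<Otimes>\<^sub>M borel)" for b
    by (rule borel_measurable_lebesgue_integral) (use YM[of b] in \<open>simp add: case_prod_unfold\<close>)
  have mm_borel: "(\<lambda>p. mm (fst p) (snd p)) \<in> borel_measurable (borel \<Otimes>\<^sub>M borel)"
    unfolding mm_def by measurable
  have YiM: "Y b r y \<in> borel_measurable M" for b r y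
    using measurable_compose[OF measurable_Pair1'[of "(r, y)" "borel \<Otimes>\<^sub>M borel" M] YM[of b]]
    by (simp add: space_pair_measure)
  have EY01: "0 \<le> expectation (Y b r y)" "expectation (Y b r y) \<le> 1" for b r y
  proof -
    show "0 \<le> expectation (Y b r y)" by (rule Bochner_Integration.integral_nonneg) (rule Y01)
    have "expectation (Y b r y) \<le> expectation (\<lambda>_. 1)"
      by (rule integral_mono) (auto intro!: integrable_const_bound[where B = 1] YiM simp: Y01)
    then show "expectation (Y b r y) \<le> 1" by (simp add: prob_space)
  qed
  have mm01: "0 \<le> mm r y" "mm r y \<le> 1" for r y
    unfolding mm_def using EY01 by (auto intro: mult_le_one)
  have mm_m: "mm r y = (m r y)\<^sup>2" if "0 < r" for r y
    using IH[OF that] that by (simp add: mm_def Y_def power2_eq_square max_absorb2)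
  have prodY: "expectation (\<lambda>\<omega>. Y False r y \<omega> * Y True r y \<omega>) = mm r y" for r y
  proof -
    have [measurable]: "Y b r y \<in> borel_measurable (info (S b))" for b by (rule Yslice) simp
    have "expectation (\<lambda>\<omega>. (\<lambda>p. Y False r y (fst p) * Y True r y (snd p)) (\<omega>, \<omega>)) =
      expectation (\<lambda>\<omega>. expectation (\<lambda>\<omega>'. (\<lambda>p. Y False r y (fst p) * Y True r y (snd p)) (\<omega>, \<omega>')))"
    proof (rule expectation_indep_pair[where K = 1 and ?N1.0 = "info (S False)" and ?N2.0 = "info (S True)"])
      show "indep_set (sets (info (S False))) (sets (info (S True)))"
        by (rule info_indep) (auto simp: S_def)
      show "\<bar>Y False r y (fst p) * Y True r y (snd p)\<bar> \<le> 1" for p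
        using Y01 by (auto simp: abs_mult intro!: mult_le_one)
    qed (auto simp: sets_info_events[THEN subsetD])
    then show ?thesis by (simp add: mm_def)
  qed
  let ?b = "\<lambda>s \<omega>. B [] (max 0 s) \<omega>"
  define G where "G = (\<lambda>s \<omega>. if t < s then g (x - ?b t \<omega>) else mm (t - s) (x - ?b s \<omega>))"
  have G01: "\<bar>G s \<omega>\<bar> \<le> 1" for s \<omega> using g01 mm01 by (auto simp: G_def abs_le_iff intro: order.trans[of _ 0])
  have EGm: "(\<lambda>s. expectation (G s)) \<in> borel_measurable borel"
  proof -
    have [measurable]: "(\<lambda>\<omega>. \<omega>) \<in> M \<rightarrow>\<^sub>M info UNIV"
      by (rule measurable_ident_coarser) (use sets_info_events in auto)
    have [measurable]: "(\<lambda>p. ?b t (snd p)) \<in> borel_measurable (borel \<Otimes>\<^sub>M M)"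
      by (rule motion_eval_measurable[where I = UNIV]) auto
    have [measurable]: "(\<lambda>p. ?b (fst p) (snd p)) \<in> borel_measurable (borel \<Otimes>\<^sub>M M)"
      by (rule motion_eval_measurable[where I = UNIV]) auto
    have [measurable]: "(\<lambda>p. mm (t - fst p) (x - ?b (fst p) (snd p))) \<in> borel_measurable (borel \<Otimes>\<^sub>M M)"
    proof -
      have "(\<lambda>p. (t - fst p, x - ?b (fst p) (snd p))) \<in> borel \<Otimes>\<^sub>M M \<rightarrow>\<^sub>M borel \<Otimes>\<^sub>M borel"
        by measurable
      from measurable_compose[OF this mm_borel] show ?thesis by simp
    qed
    have "(\<lambda>p. G (fst p) (snd p)) \<in> borel_measurable (borel \<Otimes>\<^sub>M M)" unfolding G_def by measurable
    then show ?thesis by (intro borel_measurable_lebesgue_integral) (simp add: case_prod_unfold)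
  qed
  interpret F: bounded_field mm t 1
    by unfold_locales (use mm_borel mm01 in \<open>auto simp: case_prod_unfold\<close>)
  \<comment> \<open>Given the initial particle, both subtrees start at a fixed time and place, and they are independent.\<close>
  have "expectation (tree_product g c (Suc n) \<tau> B t x) = expectation (\<lambda>\<omega>. G (\<tau> [] \<omega>) \<omega>)"
  proof -
    let ?A = "{Inl [], Inr []} :: (bool list + bool list) set" and ?S = "S False \<union> S True"
    let ?F = "\<lambda>p. if t < \<tau> [] (fst p) then g (x - ?b t (fst p))
        else Y False (t - \<tau> [] (fst p)) (x - ?b (\<tau> [] (fst p)) (fst p)) (snd p)
           * Y True (t - \<tau> [] (fst p)) (x - ?b (\<tau> [] (fst p)) (fst p)) (snd p)"
    have [measurable]: "\<tau> [] \<in> borel_measurable (info ?A)" by (rule lifetime_info) simp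
    have [measurable]: "(\<lambda>p. ?b t (fst p)) \<in> borel_measurable (info ?A \<Otimes>\<^sub>M info ?S)"
      by (rule motion_eval_measurable[where I = ?A]) auto
    have [measurable]: "(\<lambda>p. ?b (\<tau> [] (fst p)) (fst p)) \<in> borel_measurable (info ?A \<Otimes>\<^sub>M info ?S)"
      by (rule motion_eval_measurable[where I = ?A]) auto
    have [measurable]: "(\<lambda>p. Y b (t - \<tau> [] (fst p)) (x - ?b (\<tau> [] (fst p)) (fst p)) (snd p)) \<in> borel_measurable (info ?A \<Otimes>\<^sub>M info ?S)" for b
    proof -
      have "(\<lambda>p. ((t - \<tau> [] (fst p), x - ?b (\<tau> [] (fst p)) (fst p)), snd p)) \<in> info ?A \<Otimes>\<^sub>M info ?S \<rightarrow>\<^sub>M (borel \<Otimes>\<^sub>M borel) \<Otimes>\<^sub>M info ?S"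
        by measurable
      from measurable_compose[OF this Ym[of b ?S]] show ?thesis by (cases b) auto
    qed
    have "expectation (tree_product g c (Suc n) \<tau> B t x) = expectation (\<lambda>\<omega>. ?F (\<omega>, \<omega>))"
      using t by (intro Bochner_Integration.integral_cong) (auto simp: Y_def max_absorb2 lifetime_pos less_imp_le)
    also have "\<dots> = expectation (\<lambda>\<omega>. expectation (\<lambda>\<omega>'. ?F (\<omega>, \<omega>')))"
    proof (rule expectation_indep_pair[where K = 1 and ?N1.0 = "info ?A" and ?N2.0 = "info ?S"])
      show "indep_set (sets (info ?A)) (sets (info ?S))" by (rule info_indep) (auto simp: S_def)
      show "?F \<in> borel_measurable (info ?A \<Otimes>\<^sub>M info ?S)" by measurable
      show "\<bar>?F p\<bar> \<le> 1" for p
        using Y01 g01 by (auto simp: abs_mult abs_le_iff intro!: mult_le_one intro: order.trans[of _ 0])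
    qed (auto simp: sets_info_events[THEN subsetD])
    also have "\<dots> = expectation (\<lambda>\<omega>. G (\<tau> [] \<omega>) \<omega>)"
      by (intro Bochner_Integration.integral_cong) (auto simp: G_def prodY prob_space)
    finally show ?thesis .
  qed
  \<comment> \<open>The branching time is independent of the motion, so it may be frozen while the motion is averaged.\<close>
  also have "\<dots> = expectation (\<lambda>\<omega>. expectation (\<lambda>\<omega>'. G (\<tau> [] \<omega>) \<omega>'))"
  proof -
    let ?A = "{Inl []} :: (bool list + bool list) set" and ?C = "{Inr []} :: (bool list + bool list) set"
    have [measurable]: "\<tau> [] \<in> borel_measurable (info ?A)" by (rule lifetime_info) simp
    have [measurable]: "(\<lambda>p. ?b t (snd p)) \<in> borel_measurable (info ?A \<Otimes>\<^sub>M info ?C)"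
      by (rule motion_eval_measurable[where I = ?C]) auto
    have [measurable]: "(\<lambda>p. ?b (\<tau> [] (fst p)) (snd p)) \<in> borel_measurable (info ?A \<Otimes>\<^sub>M info ?C)"
      by (rule motion_eval_measurable[where I = ?C]) auto
    have [measurable]: "(\<lambda>p. mm (t - \<tau> [] (fst p)) (x - ?b (\<tau> [] (fst p)) (snd p))) \<in> borel_measurable (info ?A \<Otimes>\<^sub>M info ?C)"
    proof -
      have "(\<lambda>p. (t - \<tau> [] (fst p), x - ?b (\<tau> [] (fst p)) (snd p))) \<in> info ?A \<Otimes>\<^sub>M info ?C \<rightarrow>\<^sub>M borel \<Otimes>\<^sub>M borel"
        by measurable
      from measurable_compose[OF this mm_borel] show ?thesis by simp
    qed
    have "expectation (\<lambda>\<omega>. (\<lambda>p. G (\<tau> [] (fst p)) (snd p)) (\<omega>, \<omega>)) =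
      expectation (\<lambda>\<omega>. expectation (\<lambda>\<omega>'. (\<lambda>p. G (\<tau> [] (fst p)) (snd p)) (\<omega>, \<omega>')))"
    proof (rule expectation_indep_pair[where K = 1 and ?N1.0 = "info ?A" and ?N2.0 = "info ?C"])
      show "indep_set (sets (info ?A)) (sets (info ?C))" by (rule info_indep) auto
      show "(\<lambda>p. G (\<tau> [] (fst p)) (snd p)) \<in> borel_measurable (info ?A \<Otimes>\<^sub>M info ?C)"
        unfolding G_def by measurable
    qed (auto simp: sets_info_events[THEN subsetD] G01)
    then show ?thesis by simp
  qed
  also have "\<dots> = (\<integral>s. exponential_density 1 s * expectation (G s) \<partial>lborel)"
    by (rule distributed_integral[OF lifetime_exponential, symmetric])
      (simp_all add: exponential_density_nonneg EGm)
  also have "\<dots> = (\<integral>s. exponential_density 1 s * indicator {t<..} s * heat_mom 0 t g x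
      + indicator {0<..<t} s * (exp (- s) / sqrt s ^ 0 * heat_mom 0 s (mm (t - s)) x) \<partial>lborel)"
  proof (rule integral_cong_AE)
    have "AE s in lborel. s \<noteq> 0 \<and> s \<noteq> t"
      using AE_lborel_singleton[of 0] AE_lborel_singleton[of t] by eventually_elim simp
    then show "AE s in lborel. exponential_density 1 s * expectation (G s) = exponential_density 1 s * indicator {t<..} s * heat_mom 0 t g x
      + indicator {0<..<t} s * (exp (- s) / sqrt s ^ 0 * heat_mom 0 s (mm (t - s)) x)"
    proof eventually_elim
      case (elim s)
      consider "s < 0" | "0 < s" "s < t" | "t < s" using elim by linarith
      then show ?case
      proof cases
        case 1
        then show ?thesis using t by (simp add: exponential_density_def)
      next
        case 2
        have "G s = (\<lambda>\<omega>. mm (t - s) (x - B [] s \<omega>))" using 2 by (auto simp: G_def)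
        then have "expectation (G s) = heat_mom 0 s (mm (t - s)) x"
          using motion_expectation[of s "mm (t - s)" x "[]"] 2 F.q_slice by simp
        then show ?thesis using 2 by (simp add: exponential_density_def)
      next
        case 3
        have "G s = (\<lambda>\<omega>. g (x - B [] t \<omega>))" using 3 t by (auto simp: G_def)
        then have "expectation (G s) = heat_mom 0 t g x"
          using motion_expectation[OF t g, of x "[]"] by simp
        then show ?thesis using 3 by simp
      qed
    qed
  next
    have [measurable]: "(\<lambda>s. heat_mom 0 s (mm (t - s)) x) \<in> borel_measurable borel"
      by (rule F.duhamel_integrand_borel1)
    show "(\<lambda>s. exponential_density 1 s * indicator {t<..} s * heat_mom 0 t g x
      + indicator {0<..<t} s * (exp (- s) / sqrt s ^ 0 * heat_mom 0 s (mm (t - s)) x)) \<in> borel_measurable lborel"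
      by measurable
  qed (use EGm in measurable)
  also have "\<dots> = (\<integral>s. exponential_density 1 s * indicator {t<..} s * heat_mom 0 t g x \<partial>lborel) + duhamel 0 mm t x"
    unfolding duhamel_def
  proof (rule Bochner_Integration.integral_add)
    have "integrable lborel (\<lambda>s. exponential_density 1 s * indicator {t<..} s)"
      using lifetime_tail[OF less_imp_le[OF t]] not_integrable_integral_eq by fastforce
    then show "integrable lborel (\<lambda>s. exponential_density 1 s * indicator {t<..} s * heat_mom 0 t g x)"
      by (rule integrable_mult_left)
  qed (rule F.integrand_integrable0[OF order.refl])
  also have "(\<integral>s. exponential_density 1 s * indicator {t<..} s * heat_mom 0 t g x \<partial>lborel) = exp (- t) * heat_mom 0 t g x"
    by (subst integral_mult_left_zero) (simp add: lifetime_tail[OF less_imp_le[OF t]])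
  also have "duhamel 0 mm t x = duhamel 0 (\<lambda>r y. (m r y)\<^sup>2) t x"
    unfolding duhamel_def
  proof (rule Bochner_Integration.integral_cong[OF refl])
    fix s
    show "indicator {0<..<t} s * (exp (- s) / sqrt s ^ 0 * heat_mom 0 s (mm (t - s)) x) =
      indicator {0<..<t} s * (exp (- s) / sqrt s ^ 0 * heat_mom 0 s (\<lambda>y. (m (t - s) y)\<^sup>2) x)"
    proof (cases "0 < s \<and> s < t")
      case True
      then have "mm (t - s) = (\<lambda>y. (m (t - s) y)\<^sup>2)" using mm_m by auto
      then show ?thesis by simp
    qed auto
  qed
  finally show ?thesis .
qed

end

lemma expectation_tree_product:
  assumes "binary_BBM M \<tau> B" and g: "g \<in> borel_measurable borel" "\<And>y. 0 \<le> g y" "\<And>y. g y \<le> 1"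
    and c: "0 \<le> c" "c \<le> 1" and t: "0 < t"
  shows "(\<integral>\<omega>. tree_product g c n \<tau> B t x \<omega> \<partial>M) = tree_mean g c n t x"
  using assms(1) t
proof (induction n arbitrary: \<tau> B t x)
  case 0
  interpret binary_BBM M \<tau> B by fact
  show ?case by (simp add: prob_space)
next
  case (Suc n)
  interpret binary_BBM M \<tau> B by fact
  show ?case
    unfolding tree_mean.simps
    by (rule expectation_first_branching[OF g c Suc.prems(2) tree_mean_borel[OF g(1)] Suc.IH[OF shifted]])
qed

section \<open>Nonexplosion\<close>

lemma exp_integral:
  assumes t: "0 < t" and c: "0 < c"
  shows "integrable lborel (\<lambda>s. indicator {0<..<t} s * exp (- (c * s)) :: real)"
    and "(\<integral>s. indicator {0<..<t} s * exp (- (c * s)) \<partial>lborel) = (1 - exp (- (c * t))) / c"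
proof -
  let ?F = "\<lambda>s. - exp (- (c * s)) / c"
  have d: "(?F has_real_derivative exp (- (c * s))) (at s)" for s
    using c by (auto intro!: derivative_eq_intros)
  have l: "(?F \<longlongrightarrow> - exp (- (c * 0)) / c) (at_right 0)" "(?F \<longlongrightarrow> ?F t) (at_left t)"
    by (intro tendsto_intros, use c in simp)+
  have cont: "isCont (\<lambda>s. exp (- (c * s))) s" for s by (intro continuous_intros)
  note * = integral_FTC_Ioo[OF t d cont _ l]
  show "integrable lborel (\<lambda>s. indicator {0<..<t} s * exp (- (c * s)) :: real)" by (rule *(1)) simp
  show "(\<integral>s. indicator {0<..<t} s * exp (- (c * s)) \<partial>lborel) = (1 - exp (- (c * t))) / c"
    by (subst *(2)) (simp_all add: diff_divide_distrib)
qed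

lemma heat_mom_lower_bound:
  assumes "f \<in> borel_measurable borel" "\<And>y. \<bar>f y\<bar> \<le> K" "\<And>y. k \<le> f y"
  shows "k \<le> heat_mom 0 s f x"
proof -
  have "(\<integral>z. k \<partial>\<gamma>) \<le> (\<integral>z. z ^ 0 * f (x + sqrt s * z) \<partial>\<gamma>)"
    by (rule integral_mono) (use heat_mom_integrable[OF assms(1,2), of 0 x s] assms(3) in auto)
  then show ?thesis using \<gamma>.prob_space by (simp add: heat_mom_def)
qed

context binary_BBM
begin

lemma tree_product_mean_range:
  assumes "g \<in> borel_measurable borel" "\<And>y. 0 \<le> g y" "\<And>y. g y \<le> 1" "0 \<le> c" "c \<le> 1" "0 \<le> t"
  shows "tree_product g c n \<tau> B t x \<in> borel_measurable M"
    and "0 < t \<Longrightarrow> 0 \<le> tree_mean g c n t x \<and> tree_mean g c n t x \<le> 1"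
proof -
  have id: "(\<lambda>\<omega>. \<omega>) \<in> M \<rightarrow>\<^sub>M info UNIV"
    by (rule measurable_ident_coarser) (use sets_info_events in auto)
  have "(\<lambda>p. tree_product g c n \<tau> B (max 0 (fst (fst p))) (snd (fst p)) (snd p))
      \<in> borel_measurable ((borel \<Otimes>\<^sub>M borel) \<Otimes>\<^sub>M info UNIV)"
    by (rule tree_product_measurable)
      (simp_all add: lifetime_info motion_info motion_continuous lifetime_pos assms(1))
  from measurable_compose[OF id measurable_compose[OF measurable_Pair1'[of "(t, x)"] this]]
  show m: "tree_product g c n \<tau> B t x \<in> borel_measurable M"
    using assms by (simp add: space_pair_measure)
  assume t: "0 < t"
  have r: "0 \<le> tree_product g c n \<tau> B t x \<omega>" "tree_product g c n \<tau> B t x \<omega> \<le> 1" for \<omega>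
    by (simp_all add: tree_product_range[of g c] assms)
  have "0 \<le> expectation (tree_product g c n \<tau> B t x)"
    by (rule Bochner_Integration.integral_nonneg) (rule r)
  moreover have "expectation (tree_product g c n \<tau> B t x) \<le> expectation (\<lambda>_. 1)"
    by (rule integral_mono) (auto intro!: integrable_const_bound[where B = 1] m simp: r)
  ultimately show "0 \<le> tree_mean g c n t x \<and> tree_mean g c n t x \<le> 1"
    using expectation_tree_product[OF binary_BBM_axioms assms(1-5) t, of n x] by (simp add: prob_space)
qed

text \<open>By the union bound over the two subtrees, the probability of reaching generation \<open>n + 1\<close> by
time \<open>t\<close> is at most \<open>2 \<integral>\<^sub>0\<^sup>t exp (- s) p(t - s) ds\<close>, with \<open>p\<close> the probability for generation \<open>n\<close>. If \<open>p(r)\<close> is at most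
\<open>exp (3 r) / 2\<^sup>n\<close>, the integral of \<open>exp (- 4 s)\<close> contributes a factor of at most \<open>1 / 4\<close>, so that the bound is halved in each step.\<close>

lemma generation_bound:
  assumes "0 < t"
  shows "1 - exp (3 * t) / 2 ^ n \<le> tree_mean (\<lambda>_. 1) 0 n t x"
  using assms
proof (induction n arbitrary: t x)
  case 0
  then show ?case by simp
next
  case (Suc n)
  let ?p = "tree_mean (\<lambda>_. 1) 0 n" and ?a = "2 * exp (3 * t) / 2 ^ n"
  have p01: "0 \<le> ?p r y \<and> ?p r y \<le> 1" if "0 < r" for r y
    using tree_product_mean_range(2)[of "\<lambda>_. 1" 0 r n y] that by simp
  have pm: "(\<lambda>(r, y). ?p r y) \<in> borel_measurable (borel \<Otimes>\<^sub>M borel)"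
    by (rule tree_mean_borel) simp
  have ps: "\<bar>(?p r y)\<^sup>2\<bar> \<le> 1" if "0 < r" for r y
    using p01[OF that, of y] by (simp add: abs_square_le_1)
  interpret F: bounded_field "\<lambda>r y. (?p r y)\<^sup>2" t 1
  proof
    show "(\<lambda>(r, y). (?p r y)\<^sup>2) \<in> borel_measurable (borel \<Otimes>\<^sub>M borel)"
      using borel_measurable_power[OF pm, of 2] by (simp add: case_prod_unfold)
  qed (rule ps)
  have g1: "heat_mom 0 t (\<lambda>_. 1) x = 1" using \<gamma>.prob_space by (simp add: heat_mom_def)
  let ?l = "\<lambda>s. indicator {0<..<t} s * exp (- (1 * s)) - ?a * (indicator {0<..<t} s * exp (- (4 * s)))"
  have li: "integrable lborel ?l"
    using exp_integral(1)[OF Suc.prems, of 1] exp_integral(1)[OF Suc.prems, of 4] by auto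
  have "(\<integral>s. ?l s \<partial>lborel) = (1 - exp (- (1 * t))) / 1 - ?a * ((1 - exp (- (4 * t))) / 4)"
    by (simp only: Bochner_Integration.integral_diff[OF exp_integral(1)[OF Suc.prems zero_less_one]
          integrable_mult_right[OF exp_integral(1)[OF Suc.prems zero_less_numeral]]]
        integral_mult_right_zero exp_integral(2)[OF Suc.prems zero_less_one]
        exp_integral(2)[OF Suc.prems zero_less_numeral])
  moreover have "?a * ((1 - exp (- (4 * t))) / 4) \<le> ?a * (1 / 4)"
    by (intro mult_left_mono divide_right_mono) auto
  ultimately have "1 - exp (- t) - exp (3 * t) / 2 ^ Suc n \<le> (\<integral>s. ?l s \<partial>lborel)"
    by simp
  also have "\<dots> \<le> duhamel 0 (\<lambda>r y. (?p r y)\<^sup>2) t x"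
    unfolding duhamel_def
  proof (rule integral_mono[OF li F.integrand_integrable0[OF order.refl]])
    fix s
    show "?l s \<le> indicator {0<..<t} s * (exp (- s) / sqrt s ^ 0 * heat_mom 0 s (\<lambda>y. (?p (t - s) y)\<^sup>2) x)"
    proof (cases "0 < s \<and> s < t")
      case True
      have "1 - 2 * exp (3 * (t - s)) / 2 ^ n \<le> heat_mom 0 s (\<lambda>y. (?p (t - s) y)\<^sup>2) x"
      proof (rule heat_mom_lower_bound[where K = 1])
        show "(\<lambda>y. (?p (t - s) y)\<^sup>2) \<in> borel_measurable borel" by (rule F.q_slice)
        show "\<bar>(?p (t - s) y)\<^sup>2\<bar> \<le> 1" for y by (rule ps) (use True in simp)
        show "1 - 2 * exp (3 * (t - s)) / 2 ^ n \<le> (?p (t - s) y)\<^sup>2" for y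
        proof -
          \<comment> \<open>the union bound, in the form \<open>1 - p\<^sup>2 \<le> 2 (1 - p)\<close>\<close>
          have "0 \<le> (?p (t - s) y - 1)\<^sup>2" by simp
          then have "2 * ?p (t - s) y - 1 \<le> (?p (t - s) y)\<^sup>2" by (simp add: power2_eq_square algebra_simps)
          moreover have "1 - exp (3 * (t - s)) / 2 ^ n \<le> ?p (t - s) y" by (rule Suc.IH) (use True in simp)
          ultimately show ?thesis by simp
        qed
      qed
      then have "exp (- s) * (1 - 2 * exp (3 * (t - s)) / 2 ^ n) \<le> exp (- s) * heat_mom 0 s (\<lambda>y. (?p (t - s) y)\<^sup>2) x"
        by (rule mult_left_mono) simp
      moreover have "exp (- s) * exp (3 * (t - s)) = exp (3 * t) * exp (- (4 * s))"
        by (simp add: exp_add[symmetric])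
      ultimately show ?thesis using True by (simp add: algebra_simps)
    qed auto
  qed
  finally show ?case using g1 by simp
qed

lemma nonexplosion:
  assumes t: "0 < t"
  shows "AE \<omega> in M. \<exists>n. \<forall>u. birth_time \<tau> u \<omega> \<le> t \<longrightarrow> length u < n"
proof -
  let ?X = "\<lambda>n. tree_product (\<lambda>_. 1) 0 n \<tau> B t 0"
  have X[measurable]: "?X n \<in> borel_measurable M" for n
    by (rule tree_product_mean_range) (use t in auto)
  have X01: "0 \<le> ?X n \<omega>" "?X n \<omega> \<le> 1" for n \<omega>
    by (simp_all add: tree_product_range)
  define N where "N = {\<omega> \<in> space M. \<forall>n. ?X n \<omega> = 0}"
  have N[measurable]: "N \<in> events" unfolding N_def by measurable
  have "prob N \<le> exp (3 * t) / 2 ^ n" for n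
  proof -
    have i: "integrable M (?X n)" by (rule integrable_const_bound[where B = 1]) (use X01 in auto)
    have "prob N = expectation (indicator N)" by simp
    also have "\<dots> \<le> expectation (\<lambda>\<omega>. 1 - ?X n \<omega>)"
    proof (rule integral_mono)
      show "integrable M (indicator N :: 'a \<Rightarrow> real)"
        by (rule integrable_real_indicator) (auto simp: less_top[symmetric])
      show "indicator N \<omega> \<le> 1 - ?X n \<omega>" for \<omega>
        using X01[of n \<omega>] by (auto simp: N_def indicator_def)
    qed (use i in auto)
    also have "\<dots> = 1 - tree_mean (\<lambda>_. 1) 0 n t 0"
      using i expectation_tree_product[OF binary_BBM_axioms _ _ _ _ _ t, of "\<lambda>_. 1" 0 n 0] by (simp add: prob_space)
    also have "\<dots> \<le> exp (3 * t) / 2 ^ n" using generation_bound[OF t, of n 0] by simp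
    finally show ?thesis .
  qed
  moreover have "(\<lambda>n. exp (3 * t) / 2 ^ n) \<longlonglongrightarrow> 0"
    by (rule LIMSEQ_divide_realpow_zero) simp
  ultimately have "prob N \<le> 0" by (intro LIMSEQ_le_const) auto
  then have "prob N = 0" by (simp add: measure_le_0_iff)
  then have "AE \<omega> in M. \<omega> \<notin> N" using prob_eq_0[OF N] by simp
  then show ?thesis
  proof (rule AE_mp, intro AE_I2 impI)
    fix \<omega> assume \<omega>: "\<omega> \<in> space M" "\<omega> \<notin> N"
    then obtain n where "?X n \<omega> \<noteq> 0" by (auto simp: N_def)
    then show "\<exists>n. \<forall>u. birth_time \<tau> u \<omega> \<le> t \<longrightarrow> length u < n"
      using tree_product_generation[of \<tau> \<omega> t n B 0] lifetime_pos[OF \<omega>(1)] t by auto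
  qed
qed

text \<open>On the event that only finitely many generations are reached, the truncated products are eventually
equal to the full product.\<close>

lemma alive_product_limit:
  assumes t: "0 < t"
  shows "AE \<omega> in M. finite (alive \<tau> t \<omega>) \<and> alive \<tau> t \<omega> \<noteq> {} \<and>
    (\<lambda>n. tree_product g c n \<tau> B t x \<omega>) \<longlonglongrightarrow> (\<Prod>u\<in>alive \<tau> t \<omega>. g (x - position \<tau> B u t \<omega>))"
  using nonexplosion[OF t]
proof (rule AE_mp, intro AE_I2 impI)
  fix \<omega> assume \<omega>: "\<omega> \<in> space M" and ex: "\<exists>n. \<forall>u. birth_time \<tau> u \<omega> \<le> t \<longrightarrow> length u < n"
  obtain n0 where n0: "\<And>u. birth_time \<tau> u \<omega> \<le> t \<Longrightarrow> length u < n0" using ex by auto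
  have *: "finite (alive \<tau> t \<omega>) \<and> alive \<tau> t \<omega> \<noteq> {} \<and>
    tree_product g c n \<tau> B t x \<omega> = (\<Prod>u\<in>alive \<tau> t \<omega>. g (x - position \<tau> B u t \<omega>))" if "n0 \<le> n" for n
    by (rule tree_product_eq_prod) (use \<omega> lifetime_pos t n0 that in \<open>auto intro: order.strict_trans2\<close>)
  have "(\<lambda>n. tree_product g c n \<tau> B t x \<omega>) \<longlonglongrightarrow> (\<Prod>u\<in>alive \<tau> t \<omega>. g (x - position \<tau> B u t \<omega>))"
    by (rule tendsto_eventually) (use * in \<open>auto simp: eventually_sequentially\<close>)
  then show "finite (alive \<tau> t \<omega>) \<and> alive \<tau> t \<omega> \<noteq> {} \<and>
    (\<lambda>n. tree_product g c n \<tau> B t x \<omega>) \<longlonglongrightarrow> (\<Prod>u\<in>alive \<tau> t \<omega>. g (x - position \<tau> B u t \<omega>))"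
    using *[of n0] by simp
qed

text \<open>The product over the living particles is only known to be measurable off the explosion event; \<open>f\<close> is
any measurable version of it.\<close>

lemma tree_mean_limit:
  assumes g: "g \<in> borel_measurable borel" "\<And>y. 0 \<le> g y" "\<And>y. g y \<le> 1" and c: "0 \<le> c" "c \<le> 1" and t: "0 < t"
    and f: "f \<in> borel_measurable M" "AE \<omega> in M. f \<omega> = (\<Prod>u\<in>alive \<tau> t \<omega>. g (x - position \<tau> B u t \<omega>))"
  shows "(\<lambda>n. tree_mean g c n t x) \<longlonglongrightarrow> expectation f"
proof -
  have "(\<lambda>n. expectation (tree_product g c n \<tau> B t x)) \<longlonglongrightarrow> expectation f"
  proof (rule integral_dominated_convergence[where w = "\<lambda>_. 1"])
    show "AE \<omega> in M. (\<lambda>n. tree_product g c n \<tau> B t x \<omega>) \<longlonglongrightarrow> f \<omega>"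
      using alive_product_limit[OF t, of g c x] f(2) by eventually_elim simp
    show "AE \<omega> in M. norm (tree_product g c n \<tau> B t x \<omega>) \<le> 1" for n
      by (intro AE_I2) (simp add: tree_product_range[of g c] g c abs_le_iff order.trans[of _ 0])
    show "tree_product g c n \<tau> B t x \<in> borel_measurable M" for n
      by (rule tree_product_mean_range[OF g c less_imp_le[OF t]])
  qed (use f in auto)
  then show ?thesis using expectation_tree_product[OF binary_BBM_axioms g c t] by simp
qed

section \<open>The mean product is a mild solution\<close>

definition product_mean :: "(real \<Rightarrow> real) \<Rightarrow> real \<Rightarrow> real \<Rightarrow> real" where
  "product_mean g t x = lim (\<lambda>n. tree_mean g 1 n t x)"

lemma product_mean_limit:
  assumes g: "g \<in> borel_measurable borel" "\<And>y. 0 \<le> g y" "\<And>y. g y \<le> 1" and t: "0 < t"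
  shows "(\<lambda>n. tree_mean g 1 n t x) \<longlonglongrightarrow> product_mean g t x"
proof -
  have [measurable]: "tree_product g 1 n \<tau> B t x \<in> borel_measurable M" for n
    by (rule tree_product_mean_range[OF g _ _ less_imp_le[OF t]]) auto
  have "(\<lambda>n. tree_mean g 1 n t x) \<longlonglongrightarrow> expectation (\<lambda>\<omega>. lim (\<lambda>n. tree_product g 1 n \<tau> B t x \<omega>))"
  proof (rule tree_mean_limit[OF g _ _ t])
    show "(\<lambda>\<omega>. lim (\<lambda>n. tree_product g 1 n \<tau> B t x \<omega>)) \<in> borel_measurable M"
      by (rule borel_measurable_lim_metric) measurable
    show "AE \<omega> in M. lim (\<lambda>n. tree_product g 1 n \<tau> B t x \<omega>) = (\<Prod>u\<in>alive \<tau> t \<omega>. g (x - position \<tau> B u t \<omega>))"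
      using alive_product_limit[OF t, of g 1 x] by eventually_elim (auto intro: limI)
  qed auto
  then show ?thesis unfolding product_mean_def by (simp add: limI)
qed

lemma product_mean_eq_expectation:
  assumes g: "g \<in> borel_measurable borel" "\<And>y. 0 \<le> g y" "\<And>y. g y \<le> 1" and t: "0 < t"
    and f: "f \<in> borel_measurable M" "AE \<omega> in M. f \<omega> = (\<Prod>u\<in>alive \<tau> t \<omega>. g (x - position \<tau> B u t \<omega>))"
  shows "product_mean g t x = expectation f"
  using LIMSEQ_unique[OF product_mean_limit[OF g t] tree_mean_limit[OF g _ _ t f]] by simp

text \<open>McKean's representation: dominated convergence in the recursion of the truncated means.\<close>

theorem product_mean_mild:
  assumes g[measurable]: "g \<in> borel_measurable borel" and g01: "\<And>y. 0 \<le> g y" "\<And>y. g y \<le> 1"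
  shows "mild_solution g (product_mean g)"
proof
  let ?h = "tree_mean g 1" and ?H = "product_mean g"
  have lim: "(\<lambda>n. ?h n t x) \<longlonglongrightarrow> ?H t x" if "0 < t" for t x
    by (rule product_mean_limit[OF g g01 that])
  have h01: "0 \<le> ?h n t x" "?h n t x \<le> 1" if "0 < t" for n t x
    using tree_product_mean_range(2)[OF g g01, of 1 t n x] that by auto
  have hs: "\<bar>(?h n r y)\<^sup>2\<bar> \<le> 1" if "0 < r" for n r y
    using h01[OF that, of n y] by (simp add: abs_square_le_1)
  have hm: "(\<lambda>(t, x). ?h n t x) \<in> borel_measurable (borel \<Otimes>\<^sub>M borel)" for n
    by (rule tree_mean_borel[OF g])
  show Hm: "(\<lambda>(t, x). ?H t x) \<in> borel_measurable (borel \<Otimes>\<^sub>M borel)"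
  proof -
    have "(\<lambda>p. lim (\<lambda>n. ?h n (fst p) (snd p))) \<in> borel_measurable (borel \<Otimes>\<^sub>M borel)"
      by (rule borel_measurable_lim_metric) (use hm in \<open>simp add: case_prod_unfold\<close>)
    then show ?thesis by (simp add: product_mean_def case_prod_unfold)
  qed
  show H0: "0 \<le> ?H t x" if "0 < t" for t x
    by (rule LIMSEQ_le_const[OF lim[OF that]]) (use h01[OF that] in auto)
  show H1: "?H t x \<le> 1" if "0 < t" for t x
    by (rule LIMSEQ_le_const2[OF lim[OF that]]) (use h01[OF that] in auto)
  have Fh: "bounded_field (\<lambda>r y. (?h n r y)\<^sup>2) T 1" for n T
  proof
    show "(\<lambda>(r, y). (?h n r y)\<^sup>2) \<in> borel_measurable (borel \<Otimes>\<^sub>M borel)"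
      using borel_measurable_power[OF hm[of n], of 2] by (simp add: case_prod_unfold)
  qed (rule hs)
  have Hs: "\<bar>(?H r y)\<^sup>2\<bar> \<le> 1" if "0 < r" for r y
    using H0[OF that, of y] H1[OF that, of y] by (simp add: abs_square_le_1)
  have FH: "bounded_field (\<lambda>r y. (?H r y)\<^sup>2) T 1" for T
  proof
    show "(\<lambda>(r, y). (?H r y)\<^sup>2) \<in> borel_measurable (borel \<Otimes>\<^sub>M borel)"
      using borel_measurable_power[OF Hm, of 2] by (simp add: case_prod_unfold)
  qed (rule Hs)
  fix t x :: real assume t: "0 < t"
  have D: "(\<lambda>n. duhamel 0 (\<lambda>r y. (?h n r y)\<^sup>2) t x) \<longlonglongrightarrow> duhamel 0 (\<lambda>r y. (?H r y)\<^sup>2) t x"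
    unfolding duhamel_def
  proof (rule integral_dominated_convergence)
    show "integrable lborel (\<lambda>s. indicator {0<..<t} s * 1 :: real)" by (rule integrable_indicator_Ioo)
    show "AE s in lborel. norm (indicator {0<..<t} s * (exp (- s) / sqrt s ^ 0 * heat_mom 0 s (\<lambda>y. (?h n (t - s) y)\<^sup>2) x)) \<le> indicator {0<..<t} s * 1" for n
      unfolding real_norm_def by (intro AE_I2 bounded_field.integrand_bound0[OF Fh order.refl])
    have [measurable]: "(\<lambda>s. heat_mom 0 s (\<lambda>y. (?h n (t - s) y)\<^sup>2) x) \<in> borel_measurable borel" for n
      using bounded_field.duhamel_integrand_borel1[OF Fh] .
    have [measurable]: "(\<lambda>s. heat_mom 0 s (\<lambda>y. (?H (t - s) y)\<^sup>2) x) \<in> borel_measurable borel"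
      using bounded_field.duhamel_integrand_borel1[OF FH] .
    show "(\<lambda>s. indicator {0<..<t} s * (exp (- s) / sqrt s ^ 0 * heat_mom 0 s (\<lambda>y. (?H (t - s) y)\<^sup>2) x)) \<in> borel_measurable lborel"
      by measurable
    show "(\<lambda>s. indicator {0<..<t} s * (exp (- s) / sqrt s ^ 0 * heat_mom 0 s (\<lambda>y. (?h n (t - s) y)\<^sup>2) x)) \<in> borel_measurable lborel" for n
      by measurable
    show "AE s in lborel. (\<lambda>n. indicator {0<..<t} s * (exp (- s) / sqrt s ^ 0 * heat_mom 0 s (\<lambda>y. (?h n (t - s) y)\<^sup>2) x))
        \<longlonglongrightarrow> indicator {0<..<t} s * (exp (- s) / sqrt s ^ 0 * heat_mom 0 s (\<lambda>y. (?H (t - s) y)\<^sup>2) x)"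
    proof (rule AE_I2)
      fix s
      show "(\<lambda>n. indicator {0<..<t} s * (exp (- s) / sqrt s ^ 0 * heat_mom 0 s (\<lambda>y. (?h n (t - s) y)\<^sup>2) x))
        \<longlonglongrightarrow> indicator {0<..<t} s * (exp (- s) / sqrt s ^ 0 * heat_mom 0 s (\<lambda>y. (?H (t - s) y)\<^sup>2) x)"
      proof (cases "0 < s \<and> s < t")
        case True
        then have r: "0 < t - s" by simp
        have [measurable]: "(\<lambda>y. (?h n (t - s) y)\<^sup>2) \<in> borel_measurable borel" for n
          using bounded_field.q_slice[OF Fh] .
        have [measurable]: "(\<lambda>y. (?H (t - s) y)\<^sup>2) \<in> borel_measurable borel"
          using bounded_field.q_slice[OF FH] .
        have "(\<lambda>n. heat_mom 0 s (\<lambda>y. (?h n (t - s) y)\<^sup>2) x) \<longlonglongrightarrow> heat_mom 0 s (\<lambda>y. (?H (t - s) y)\<^sup>2) x"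
          unfolding heat_mom_def
        proof (rule integral_dominated_convergence[where w = "\<lambda>_. 1"])
          show "AE z in \<gamma>. (\<lambda>n. z ^ 0 * (?h n (t - s) (x + sqrt s * z))\<^sup>2) \<longlonglongrightarrow> z ^ 0 * (?H (t - s) (x + sqrt s * z))\<^sup>2"
            by (intro AE_I2 tendsto_intros lim r)
          show "AE z in \<gamma>. norm (z ^ 0 * (?h n (t - s) (x + sqrt s * z))\<^sup>2) \<le> 1" for n
            using hs[OF r] by simp
        qed (simp_all, measurable)
        then show ?thesis by (intro tendsto_intros)
      qed auto
    qed
  qed
  have "(\<lambda>n. exp (- t) * heat_mom 0 t g x + duhamel 0 (\<lambda>r y. (?h n r y)\<^sup>2) t x)
      \<longlonglongrightarrow> exp (- t) * heat_mom 0 t g x + duhamel 0 (\<lambda>r y. (?H r y)\<^sup>2) t x"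
    by (intro tendsto_intros D)
  moreover have "(\<lambda>n. exp (- t) * heat_mom 0 t g x + duhamel 0 (\<lambda>r y. (?h n r y)\<^sup>2) t x) \<longlonglongrightarrow> ?H t x"
    using LIMSEQ_Suc[OF lim[OF t, of x]] by simp
  ultimately show "?H t x = exp (- t) * heat_mom 0 t g x + duhamel 0 (\<lambda>r y. (?H r y)\<^sup>2) t x"
    by (rule LIMSEQ_unique[symmetric])
qed (use g g01 in auto)

end

section \<open>The tilted law of branching Brownian motion\<close>

context binary_BBM
begin

lemma lifetime_measurable[measurable]: "\<tau> u \<in> borel_measurable M"
  using distributed_measurable[OF lifetime_exponential[of u]] by simp

lemma motion_at_measurable:
  assumes "a \<in> borel_measurable M"
  shows "(\<lambda>\<omega>. B u (max 0 (a \<omega>)) \<omega>) \<in> borel_measurable M"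
proof (rule motion_eval_measurable[where I = UNIV])
  show "(\<lambda>\<omega>. \<omega>) \<in> M \<rightarrow>\<^sub>M info UNIV"
    by (rule measurable_ident_coarser) (use sets_info_events in auto)
qed (use assms in auto)

lemma birth_time_measurable[measurable]: "(\<lambda>\<omega>. birth_time \<tau> u \<omega>) \<in> borel_measurable M"
  unfolding birth_time_def by measurable

lemma alive_pred[measurable]: "Measurable.pred M (\<lambda>\<omega>. u \<in> alive \<tau> t \<omega>)"
  unfolding alive_def by measurable

lemma below_event: "{\<omega> \<in> space M. \<forall>u\<in>alive \<tau> t \<omega>. position \<tau> B u t \<omega> \<le> x} \<in> events"
proof -
  define pos where "pos = (\<lambda>u \<omega>. (\<Sum>k<length u. B (take k u) (max 0 (\<tau> (take k u) \<omega>)) \<omega>)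
      + B u (max 0 (t - birth_time \<tau> u \<omega>)) \<omega>)"
  have [measurable]: "pos u \<in> borel_measurable M" for u
    unfolding pos_def by (intro borel_measurable_add borel_measurable_sum motion_at_measurable) measurable
  have "position \<tau> B u t \<omega> = pos u \<omega>" if "\<omega> \<in> space M" "u \<in> alive \<tau> t \<omega>" for u \<omega>
    using that lifetime_pos[OF that(1)]
    by (simp add: pos_def position_def birth_place_def alive_def max_absorb2 less_imp_le)
  then have "{\<omega> \<in> space M. \<forall>u\<in>alive \<tau> t \<omega>. position \<tau> B u t \<omega> \<le> x} =
      {\<omega> \<in> space M. \<forall>u. u \<in> alive \<tau> t \<omega> \<longrightarrow> pos u \<omega> \<le> x}"
    by auto
  also have "\<dots> \<in> events" by measurable
  finally show ?thesis .
qed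

text \<open>The set of living particles takes countably many finite values; on the remaining event the cardinality is
\<open>0\<close> by convention.\<close>

lemma num_particles_measurable[measurable]: "(\<lambda>\<omega>. num_particles \<tau> t \<omega>) \<in> M \<rightarrow>\<^sub>M count_space UNIV"
proof -
  have fin: "countable {F :: bool list set. finite F \<and> P F}" for P
    by (rule countable_subset[OF _ countable_Collect_finite]) auto
  have ex: "Measurable.pred M (\<lambda>\<omega>. \<exists>F\<in>{F. finite F \<and> P F}. \<forall>u. u \<in> alive \<tau> t \<omega> \<longleftrightarrow> u \<in> F)" for P
    unfolding pred_def by (rule sets.sets_Collect_countable_Ex'[OF _ fin]) measurable
  have "Measurable.pred M (\<lambda>\<omega>. num_particles \<tau> t \<omega> = n)" for n
  proof -
    have eq: "(\<lambda>\<omega>. num_particles \<tau> t \<omega> = n) =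
      (\<lambda>\<omega>. (\<exists>F\<in>{F. finite F \<and> card F = n}. \<forall>u. u \<in> alive \<tau> t \<omega> \<longleftrightarrow> u \<in> F) \<or>
        (n = 0 \<and> \<not> (\<exists>F\<in>{F. finite F \<and> True}. \<forall>u. u \<in> alive \<tau> t \<omega> \<longleftrightarrow> u \<in> F)))"
    proof
      fix \<omega>
      have e: "(\<exists>F\<in>{F. finite F \<and> P F}. \<forall>u. u \<in> alive \<tau> t \<omega> \<longleftrightarrow> u \<in> F) \<longleftrightarrow> finite (alive \<tau> t \<omega>) \<and> P (alive \<tau> t \<omega>)" for P
        unfolding set_eq_iff[symmetric] by auto
      show "(num_particles \<tau> t \<omega> = n) =
      ((\<exists>F\<in>{F. finite F \<and> card F = n}. \<forall>u. u \<in> alive \<tau> t \<omega> \<longleftrightarrow> u \<in> F) \<or>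
        (n = 0 \<and> \<not> (\<exists>F\<in>{F. finite F \<and> True}. \<forall>u. u \<in> alive \<tau> t \<omega> \<longleftrightarrow> u \<in> F)))"
        unfolding e[of "\<lambda>F. card F = n"] e[of "\<lambda>_. True"] num_particles_def
        by (cases "finite (alive \<tau> t \<omega>)") auto
    qed
    show ?thesis
      unfolding eq by (intro pred_intros_logic measurable_const ex[of "\<lambda>F. card F = n"] ex[of "\<lambda>_. True"]) simp
  qed
  then have "(\<lambda>\<omega>. num_particles \<tau> t \<omega>) -` {n} \<inter> space M \<in> events" for n
    by (simp add: pred_def vimage_def Int_def conj_commute)
  then show ?thesis by (simp add: measurable_count_space_eq2_countable)
qed

definition below :: "real \<Rightarrow> real \<Rightarrow> 'a set" where
  "below t x = {\<omega> \<in> space M. \<forall>u\<in>alive \<tau> t \<omega>. position \<tau> B u t \<omega> \<le> x}"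

lemma below_measurable[measurable]: "below t x \<in> events"
  unfolding below_def by (rule below_event)

context
  fixes \<sigma> :: real
  assumes \<sigma>: "0 < \<sigma>" "\<sigma> \<le> 1"
begin

definition barrier :: "real \<Rightarrow> real" where
  "barrier y = \<sigma> * of_bool (0 \<le> y)"

lemma barrier_props: "barrier \<in> borel_measurable borel" "0 \<le> barrier y" "barrier y \<le> 1"
  using \<sigma> by (auto simp: barrier_def[abs_def])

lemma product_mean_barrier:
  assumes t: "0 < t"
  shows "product_mean barrier t x = \<sigma> * expectation (\<lambda>\<omega>. indicator (below t x) \<omega> * \<sigma> ^ (num_particles \<tau> t \<omega> - 1))"
proof -
  have "product_mean barrier t x = expectation (\<lambda>\<omega>. \<sigma> * (indicator (below t x) \<omega> * \<sigma> ^ (num_particles \<tau> t \<omega> - 1)))"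
  proof (rule product_mean_eq_expectation[OF barrier_props t])
    show "(\<lambda>\<omega>. \<sigma> * (indicator (below t x) \<omega> * \<sigma> ^ (num_particles \<tau> t \<omega> - 1))) \<in> borel_measurable M"
      by measurable
    show "AE \<omega> in M. \<sigma> * (indicator (below t x) \<omega> * \<sigma> ^ (num_particles \<tau> t \<omega> - 1)) =
        (\<Prod>u\<in>alive \<tau> t \<omega>. barrier (x - position \<tau> B u t \<omega>))"
      using alive_product_limit[OF t, of barrier 1 x]
    proof (rule AE_mp, intro AE_I2 impI)
      fix \<omega> assume \<omega>: "\<omega> \<in> space M"
      assume "finite (alive \<tau> t \<omega>) \<and> alive \<tau> t \<omega> \<noteq> {} \<and>
        (\<lambda>n. tree_product barrier 1 n \<tau> B t x \<omega>) \<longlonglongrightarrow> (\<Prod>u\<in>alive \<tau> t \<omega>. barrier (x - position \<tau> B u t \<omega>))"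
      then have fin: "finite (alive \<tau> t \<omega>)" and pos: "0 < num_particles \<tau> t \<omega>"
        by (auto simp: num_particles_def card_gt_0_iff)
      have "(\<Prod>u\<in>alive \<tau> t \<omega>. barrier (x - position \<tau> B u t \<omega>)) =
          \<sigma> ^ num_particles \<tau> t \<omega> * (\<Prod>u\<in>alive \<tau> t \<omega>. of_bool (0 \<le> x - position \<tau> B u t \<omega>))"
        by (simp add: barrier_def prod.distrib num_particles_def)
      also have "(\<Prod>u\<in>alive \<tau> t \<omega>. of_bool (0 \<le> x - position \<tau> B u t \<omega>)) = (indicator (below t x) \<omega> :: real)"
        using fin \<omega> by (auto simp: below_def indicator_def prod_zero_iff intro!: prod.neutral)
      also have "\<sigma> ^ num_particles \<tau> t \<omega> = \<sigma> * \<sigma> ^ (num_particles \<tau> t \<omega> - 1)"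
        using pos by (simp add: power_eq_if)
      finally show "\<sigma> * (indicator (below t x) \<omega> * \<sigma> ^ (num_particles \<tau> t \<omega> - 1)) =
        (\<Prod>u\<in>alive \<tau> t \<omega>. barrier (x - position \<tau> B u t \<omega>))" by simp
    qed
  qed
  then show ?thesis by simp
qed

lemma product_mean_const:
  assumes t: "0 < t"
  shows "product_mean (\<lambda>_. \<sigma>) t x = \<sigma> * v_gen M \<tau> \<sigma> t"
proof -
  have "product_mean (\<lambda>_. \<sigma>) t x = expectation (\<lambda>\<omega>. \<sigma> * \<sigma> ^ (num_particles \<tau> t \<omega> - 1))"
  proof (rule product_mean_eq_expectation[OF _ _ _ t])
    show "AE \<omega> in M. \<sigma> * \<sigma> ^ (num_particles \<tau> t \<omega> - 1) = (\<Prod>u\<in>alive \<tau> t \<omega>. \<sigma>)"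
      using alive_product_limit[OF t, of "\<lambda>_. \<sigma>" 1 x]
      by eventually_elim (auto simp: num_particles_def card_gt_0_iff power_eq_if)
  qed (use \<sigma> in auto)
  then show ?thesis by (simp add: v_gen_def)
qed

text \<open>The mean product for a constant weight does not depend on \<open>x\<close>, so it solves \<open>V' = V\<^sup>2 - V\<close>. The
substitution \<open>1 / V - 1\<close> makes this Bernoulli equation linear.\<close>

lemma v_gen_explicit:
  assumes t: "0 < t"
  shows "\<sigma> * v_gen M \<tau> \<sigma> t = \<sigma> / ((1 - \<sigma>) * exp t + \<sigma>)"
proof -
  interpret S: mild_solution "\<lambda>_. \<sigma>" "product_mean (\<lambda>_. \<sigma>)"
    by (rule product_mean_mild) (use \<sigma> in auto)
  define V where "V = (\<lambda>t. product_mean (\<lambda>_. \<sigma>) t 0)"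
  have V: "product_mean (\<lambda>_. \<sigma>) t x = V t" if "0 < t" for t x
    using product_mean_const[OF that] by (simp add: V_def)
  have Vpos: "0 < V t" if t: "0 < t" for t
  proof -
    have "0 \<le> duhamel 0 (\<lambda>r y. (product_mean (\<lambda>_. \<sigma>) r y)\<^sup>2) t 0"
      unfolding duhamel_def heat_mom_def by (intro Bochner_Integration.integral_nonneg mult_nonneg_nonneg) auto
    moreover have "heat_mom 0 t (\<lambda>_. \<sigma>) 0 = \<sigma>" using \<gamma>.prob_space by (simp add: heat_mom_def)
    moreover have "0 < exp (- t) * \<sigma>" using \<sigma> by simp
    ultimately show ?thesis using S.mild[OF t, of 0] by (simp add: V_def)
  qed
  have Hx0: "S.Hx t x = 0" if t: "0 < t" for t x
  proof (rule DERIV_unique[OF S.Hx_deriv[OF t]])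
    have "product_mean (\<lambda>_. \<sigma>) t = (\<lambda>_. V t)" using V[OF t] by auto
    then show "(product_mean (\<lambda>_. \<sigma>) t has_real_derivative 0) (at x)" by simp
  qed
  have Hxx0: "S.Hxx t x = 0" if t: "0 < t" for t x
  proof (rule DERIV_unique[OF S.Hxx_deriv[OF t]])
    have "S.Hx t = (\<lambda>_. 0)" using Hx0[OF t] by auto
    then show "(S.Hx t has_real_derivative 0) (at x)" by simp
  qed
  have dV: "(V has_real_derivative (V t)\<^sup>2 - V t) (at t)" if t: "0 < t" for t
    using S.H_deriv_time[OF t, of 0] Hxx0[OF t] by (simp add: V_def)
  \<comment> \<open>a first integral of the equation\<close>
  define Q where "Q = (\<lambda>t. (1 / V t - 1) * exp (- t))"
  have dQ: "(Q has_real_derivative 0) (at t)" if t: "0 < t" for t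
  proof -
    have "(Q has_real_derivative ((- ((V t)\<^sup>2 - V t) / (V t)\<^sup>2) * exp (- t) + - exp (- t) * (1 / V t - 1))) (at t)"
      unfolding Q_def using Vpos[OF t]
      by (auto intro!: derivative_eq_intros dV[OF t] simp: power2_eq_square)
    moreover have "(- ((V t)\<^sup>2 - V t) / (V t)\<^sup>2) * exp (- t) + - exp (- t) * (1 / V t - 1) = 0"
      using Vpos[OF t] by (simp add: field_simps power2_eq_square)
    ultimately show ?thesis by simp
  qed
  have const: "Q s = Q t" if "0 < s" "s < t" for s
    using MVT2[of s t Q "\<lambda>_. 0"] dQ that by auto
  have V0: "(V \<longlongrightarrow> \<sigma>) (at_right 0)"
    unfolding V_def by (rule S.initial_value) simp
  have "(Q \<longlongrightarrow> (1 / \<sigma> - 1) * exp (- 0)) (at_right 0)"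
    unfolding Q_def by (intro tendsto_intros V0) (use \<sigma> in auto)
  moreover have "(Q \<longlongrightarrow> Q t) (at_right 0)"
  proof (rule tendsto_eventually)
    show "\<forall>\<^sub>F s in at_right 0. Q s = Q t"
      using t const by (auto simp: eventually_at_right intro!: exI[of _ t])
  qed
  ultimately have "Q t = 1 / \<sigma> - 1" using tendsto_unique[of "at_right (0::real)"] by fastforce
  then have "1 / V t - 1 = (1 / \<sigma> - 1) * exp t"
    unfolding Q_def by (simp add: exp_minus field_simps)
  then have "1 / V t = ((1 - \<sigma>) * exp t + \<sigma>) / \<sigma>" using \<sigma> by (simp add: field_simps)
  then have "V t = \<sigma> / ((1 - \<sigma>) * exp t + \<sigma>)" by (metis divide_divide_eq_right div_by_1 mult_1 inverse_eq_divide inverse_inverse_eq)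
  then show ?thesis using product_mean_const[OF t, of 0] by (simp add: V_def)
qed

end

lemma below_at_0: "\<omega> \<in> space M \<Longrightarrow> (\<forall>u\<in>alive \<tau> 0 \<omega>. position \<tau> B u 0 \<omega> \<le> x) \<longleftrightarrow> 0 \<le> x"
  and num_particles_0: "\<omega> \<in> space M \<Longrightarrow> num_particles \<tau> 0 \<omega> = 1"
  using alive_before[of \<tau> \<omega> 0] lifetime_pos[of \<omega>]
  by (simp_all add: num_particles_def position_def birth_place_def motion_start)

end

lemma sigma_param_range: "0 < sigma_param lam eps" "sigma_param lam eps \<le> 1"
  using cosh_real_ge_1[of "eps * sqrt (2 * lam)"] by (auto simp: sigma_param_def)

theorem lemma6p1:
  fixes M :: "'a measure"
    and \<tau> :: "bool list \<Rightarrow> 'a \<Rightarrow> real"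
    and B :: "bool list \<Rightarrow> real \<Rightarrow> 'a \<Rightarrow> real"
    and lam eps \<sigma> :: real
    and k :: "real \<Rightarrow> real"
  assumes "binary_BBM M \<tau> B"
    and "0 \<le> lam"
    and "0 < eps"
    and "\<sigma> = sigma_param lam eps"
    and "k = (\<lambda>t. \<sigma> / ((1 - \<sigma>) * exp t + \<sigma>))"
  shows "FKPP_solution k (\<lambda>x. of_bool (x < 0)) (w_sigma M \<tau> B lam eps) \<and>
    (\<forall>w. FKPP_solution k (\<lambda>x. of_bool (x < 0)) w \<longrightarrow>
       (\<forall>t>0. \<forall>x. w t x = w_sigma M \<tau> B lam eps t x))"
proof -
  interpret binary_BBM M \<tau> B by fact
  have \<sigma>: "0 < \<sigma>" "\<sigma> \<le> 1" using sigma_param_range assms(4) by auto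
  let ?f = "\<lambda>x :: real. of_bool (x < 0) :: real"
  let ?w = "w_sigma M \<tau> B lam eps"
  let ?g = "barrier \<sigma>"
  define H where "H = product_mean ?g"
  interpret S: mild_solution ?g H
    unfolding H_def by (rule product_mean_mild[OF barrier_props[OF \<sigma>]])
  have den: "0 < (1 - \<sigma>) * exp t + \<sigma>" for t
    using \<sigma> by (intro add_nonneg_pos) auto
  have kpos: "0 < k t" for t using \<sigma> den[of t] by (simp add: assms(5))
  have k1: "\<bar>k t\<bar> \<le> 1" for t
    using kpos[of t] den[of t] \<sigma> by (simp add: assms(5) divide_le_eq)
  have kv: "\<sigma> * v_gen M \<tau> \<sigma> t = k t" if "0 < t" for t
    using v_gen_explicit[OF \<sigma> that] by (simp add: assms(5))
  have dk: "(k has_real_derivative (k t)\<^sup>2 - k t) (at t)" for t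
  proof -
    let ?D = "(1 - \<sigma>) * exp t + \<sigma>"
    have D: "?D \<noteq> 0" using den[of t] by simp
    have "((\<lambda>t. (1 - \<sigma>) * exp t + \<sigma>) has_real_derivative ?D - \<sigma>) (at t)"
      by (auto intro!: derivative_eq_intros)
    from DERIV_divide[OF DERIV_const this D, of \<sigma>]
    have "(k has_real_derivative (0 * ?D - \<sigma> * (?D - \<sigma>)) / (?D * ?D)) (at t)"
      by (simp add: assms(5))
    also have "(0 * ?D - \<sigma> * (?D - \<sigma>)) / (?D * ?D) = (\<sigma> / ?D)\<^sup>2 - \<sigma> / ?D"
      using D by (simp only: power2_eq_square) (simp add: divide_simps, simp add: algebra_simps)
    finally show ?thesis by (simp only: assms(5))
  qed
  have w_int: "?w t x = 1 - expectation (\<lambda>\<omega>. indicator (below t x) \<omega> * \<sigma> ^ (num_particles \<tau> t \<omega> - 1)) / v_gen M \<tau> \<sigma> t" for t x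
    by (simp add: w_sigma_def P_hat_def below_def assms(4))
  have w_eq: "?w t x = 1 - H t x / k t" if "0 < t" for t x
    using product_mean_barrier[OF \<sigma> that, of x] \<sigma> by (simp add: w_int H_def kv[OF that, symmetric])
  have w_bound: "\<bar>?w t x\<bar> \<le> 1" if t: "0 < t" for t x
  proof -
    let ?I = "expectation (\<lambda>\<omega>. indicator (below t x) \<omega> * \<sigma> ^ (num_particles \<tau> t \<omega> - 1))"
    have p: "0 \<le> \<sigma> ^ n" "\<sigma> ^ n \<le> 1" for n using \<sigma> by (auto simp: power_le_one)
    have "?I \<le> v_gen M \<tau> \<sigma> t"
      unfolding v_gen_def
      by (rule integral_mono) (auto intro!: integrable_const_bound[where B = 1] simp: p indicator_def)
    moreover have "0 \<le> ?I" by (intro Bochner_Integration.integral_nonneg) (simp add: p)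
    moreover have "0 < v_gen M \<tau> \<sigma> t" using kv[OF t] kpos[of t] \<sigma> by (metis zero_less_mult_pos)
    ultimately have "0 \<le> ?I / v_gen M \<tau> \<sigma> t" "?I / v_gen M \<tau> \<sigma> t \<le> 1" by auto
    then show ?thesis unfolding w_int by (simp add: abs_le_iff)
  qed
  define wx where "wx = (\<lambda>t x. - (S.Hx t x / k t))"
  define wxx where "wxx = (\<lambda>t x. - (S.Hxx t x / k t))"
  define wt where "wt = (\<lambda>t x. 1 / 2 * wxx t x + ?w t x * (1 - ?w t x) * k t)"
  have sol: "FKPP_solution k ?f ?w"
    unfolding FKPP_solution_def
  proof (intro conjI)
    show "bounded ((\<lambda>(t, x). ?w t x) ` ({0<..} \<times> UNIV))"
      unfolding bounded_iff using w_bound by (intro exI[of _ 1]) auto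
    show "\<forall>x. ?w 0 x = ?f x"
    proof
      fix x
      have v0: "v_gen M \<tau> \<sigma> 0 = 1"
        unfolding v_gen_def
        by (subst Bochner_Integration.integral_cong[OF refl, of _ _ "\<lambda>_. 1"]) (simp_all add: num_particles_0 prob_space)
      have "expectation (\<lambda>\<omega>. indicator (below 0 x) \<omega> * \<sigma> ^ (num_particles \<tau> 0 \<omega> - 1)) = of_bool (0 \<le> x)"
        by (subst Bochner_Integration.integral_cong[OF refl, of _ _ "\<lambda>_. of_bool (0 \<le> x)"])
          (simp_all add: num_particles_0 below_def below_at_0 prob_space indicator_def)
      then show "?w 0 x = ?f x" by (simp add: w_int v0)
    qed
    show "\<forall>x. isCont ?f x \<longrightarrow> ((\<lambda>t. ?w t x) \<longlongrightarrow> ?f x) (at_right 0)"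
    proof (intro allI impI)
      fix x assume f: "isCont ?f x"
      have g: "?g = (\<lambda>y. \<sigma> * (1 - ?f y))" by (auto simp: barrier_def[OF \<sigma>] fun_eq_iff)
      have "isCont ?g x" unfolding g by (intro continuous_intros f)
      from S.initial_value[OF this] have H0: "((\<lambda>t. H t x) \<longlongrightarrow> ?g x) (at_right 0)" .
      have "isCont k 0" by (rule DERIV_isCont[OF dk])
      then have "(k \<longlongrightarrow> k 0) (at_right 0)" by (simp add: isCont_def filterlim_at_split)
      then have k0: "(k \<longlongrightarrow> \<sigma>) (at_right 0)" by (simp add: assms(5))
      have "((\<lambda>t. 1 - H t x / k t) \<longlongrightarrow> 1 - ?g x / \<sigma>) (at_right 0)"
        by (intro tendsto_intros H0 k0) (use \<sigma> in simp)
      also have "1 - ?g x / \<sigma> = ?f x" unfolding g using \<sigma> by simp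
      finally show "((\<lambda>t. ?w t x) \<longlongrightarrow> ?f x) (at_right 0)"
      proof (rule Lim_transform_eventually)
        show "\<forall>\<^sub>F t in at_right 0. 1 - H t x / k t = ?w t x"
          by (auto simp: eventually_at_filter w_eq)
      qed
    qed
    show "\<exists>wt wx wxx.
        (\<forall>t>0. \<forall>x.
           ((\<lambda>s. ?w s x) has_real_derivative wt t x) (at t) \<and>
           ((\<lambda>y. ?w t y) has_real_derivative wx t x) (at x) \<and>
           ((\<lambda>y. wx t y) has_real_derivative wxx t x) (at x) \<and>
           wt t x = 1 / 2 * wxx t x + ?w t x * (1 - ?w t x) * k t) \<and>
        (\<forall>g\<in>{?w, wt, wx, wxx}. continuous_on ({0<..} \<times> UNIV) (\<lambda>(t, x). g t x))"
    proof (rule exI[of _ wt], rule exI[of _ wx], rule exI[of _ wxx], intro conjI allI impI)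
      fix t x :: real assume t: "0 < t"
      have kn: "k t \<noteq> 0" using kpos[of t] by simp
      have "((\<lambda>s. 1 - H s x / k s) has_real_derivative
          0 - ((1 / 2 * S.Hxx t x - H t x + (H t x)\<^sup>2) * k t - H t x * ((k t)\<^sup>2 - k t)) / (k t * k t)) (at t)"
        by (intro DERIV_diff DERIV_const DERIV_divide S.H_deriv_time[OF t] dk kn)
      also have "0 - ((1 / 2 * S.Hxx t x - H t x + (H t x)\<^sup>2) * k t - H t x * ((k t)\<^sup>2 - k t)) / (k t * k t) = wt t x"
        using kn unfolding wt_def wxx_def w_eq[OF t] by (simp add: field_simps power2_eq_square)
      finally show "((\<lambda>s. ?w s x) has_real_derivative wt t x) (at t)"
        by (rule has_field_derivative_transform_within_open[of _ _ _ "{0<..}"]) (use t w_eq in auto)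
      have wt_fun: "?w t = (\<lambda>y. 1 - H t y / k t)" using w_eq[OF t] by auto
      have "((\<lambda>y. 1 - H t y / k t) has_real_derivative 0 - S.Hx t x / k t) (at x)"
        by (intro DERIV_diff DERIV_const DERIV_cdivide S.Hx_deriv t)
      then show "((\<lambda>y. ?w t y) has_real_derivative wx t x) (at x)"
        by (simp only: wt_fun wx_def diff_0)
      show "((\<lambda>y. wx t y) has_real_derivative wxx t x) (at x)"
        unfolding wx_def wxx_def by (intro DERIV_minus DERIV_cdivide S.Hxx_deriv t)
      show "wt t x = 1 / 2 * wxx t x + ?w t x * (1 - ?w t x) * k t" by (simp add: wt_def)
    next
      have "continuous_on UNIV k" using DERIV_isCont[OF dk] by (simp add: continuous_at_imp_continuous_on)
      then have kc: "continuous_on ({0<..} \<times> UNIV) (\<lambda>p :: real \<times> real. k (fst p))"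
        by (rule continuous_on_compose2) (auto intro: continuous_intros)
      have kn: "k s \<noteq> 0" for s using kpos[of s] by simp
      have "continuous_on ({0<..} \<times> UNIV) (\<lambda>p. 1 - (\<lambda>(t, x). H t x) p / k (fst p))"
        by (intro continuous_intros S.H_continuous kc) (simp add: kn)
      then have wc: "continuous_on ({0<..} \<times> UNIV) (\<lambda>p. ?w (fst p) (snd p))"
        by (rule continuous_on_eq) (auto simp: w_eq)
      have "continuous_on ({0<..} \<times> UNIV) (\<lambda>p. - ((\<lambda>(t, x). S.Hx t x) p / k (fst p)))"
        by (intro continuous_intros S.Hx_continuous kc) (simp add: kn)
      then have wxc: "continuous_on ({0<..} \<times> UNIV) (\<lambda>p. wx (fst p) (snd p))"
        by (simp add: wx_def case_prod_unfold)
      have "continuous_on ({0<..} \<times> UNIV) (\<lambda>p. - ((\<lambda>(t, x). S.Hxx t x) p / k (fst p)))"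
        by (intro continuous_intros S.Hxx_continuous kc) (simp add: kn)
      then have wxxc: "continuous_on ({0<..} \<times> UNIV) (\<lambda>p. wxx (fst p) (snd p))"
        by (simp add: wxx_def case_prod_unfold)
      have wtc: "continuous_on ({0<..} \<times> UNIV) (\<lambda>p. wt (fst p) (snd p))"
        unfolding wt_def by (intro continuous_intros wc wxxc kc)
      show "\<forall>g\<in>{?w, wt, wx, wxx}. continuous_on ({0<..} \<times> UNIV) (\<lambda>(t, x). g t x)"
        using wc wxc wxxc wtc by (simp add: case_prod_unfold)
    qed
  qed
  have fc: "isCont ?f x" if "x \<noteq> 0" for x
  proof -
    have "\<forall>\<^sub>F y in nhds x. ?f y = ?f x"
    proof (cases "x < 0")
      case True
      then show ?thesis using eventually_nhds_in_open[of "{..<0}" x] by (auto elim: eventually_mono)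
    next
      case False
      then have "0 < x" using that by simp
      then show ?thesis using eventually_nhds_in_open[of "{0<..}" x] by (auto elim: eventually_mono)
    qed
    then have "isCont ?f x \<longleftrightarrow> isCont (\<lambda>_. ?f x) x" by (rule isCont_cong)
    then show ?thesis by simp
  qed
  show ?thesis
    using sol FKPP_solution_unique[OF _ sol k1 fc] by blast
qed

end
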